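(* Fix constants $\varepsilon_0,\varepsilon_1,\delta_0,\delta_1>0$ and a function $a_0\in C^2([0,1])$ with $a_0>0$ on $[0,1]$. Let $(a,\alpha,u_0),(b,\beta,u_0)\in\mathcal A(\varepsilon_0,\varepsilon_1,\delta_0,\delta_1)$ and let $u_{a,\alpha},u_{b,\beta}$ be the corresponding solutions of the degenerate problem below. If for some $t_0>0$ $$\partial_x u_{a,\alpha}(1,t)=\partial_x u_{b,\beta}(1,t),\qquad 0<t<t_0,$$ then $x^\alpha a(x)=x^\beta b(x)$ for all $\varepsilon_1\le x\le1$. (The constant $t_0>0$ may be chosen independently of $\varepsilon_0,\varepsilon_1,\delta_0,\delta_1$.)
   Context: For $\alpha\in(0,1)$ and $a$ positive, $u_{a,\alpha}$ denotes the solution of $\partial_t u-\partial_x(x^\alpha a(x)\partial_x u)=0$ in $(0,1)\times(0,\infty)$, $u(0,t)=u(1,t)=0$, $u(x,0)=u_0(x)$, given by the analytic contraction semigroup generated on $L^2(0,1)$ by $Au=\partial_x(x^\alpha a\partial_x u)$ with domain $\{u\in L^2:\int_0^1x^\alpha|u'|^2<\infty,\ u(0)=u(1)=0,\ x^\alpha u'\in H^1(0,1)\}$. Let $W^{1,1}(0,1)=\{g\in L^1: g'\in L^1\}$. $\mathcal A_0$ is the set of triples $(a,\alpha,u_0)\in C^3([0,1])\times(0,1)\times C^4([0,1])$ such that $u_0,\ (x^\alpha a u_0')'\in W^{1,1}(0,1)$; $(x^\alpha a)^{1/2}u_0',\ (x^\alpha a)^{1/2}(x^\alpha a u_0')''\in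 L^2(0,1)$; $x^\alpha a u_0'\in H^1(0,1)$; $x^\alpha a(x^\alpha au_0')''\in H^1(0,1)$; and $u_0(\xi)=0$, $(x^\alpha a u_0')'(\xi)=0$ for $\xi=0,1$. Then $\mathcal A(\varepsilon_0,\varepsilon_1,\delta_0,\delta_1)$ is the set of $(a,\alpha,u_0)\in\mathcal A_0$ with $a\ge\delta_0$ on $[0,1]$, $a(x)=a_0(x)$ for $1-\varepsilon_0\le x\le1$, and $|u_0'(x)|\ge\delta_1$ for $\varepsilon_1\le x\le1$. *)

theory Defs
  imports "HOL-Analysis.Analysis"
begin

definition Ck_on :: "nat \<Rightarrow> (real \<Rightarrow> real) \<Rightarrow> bool" where
  "Ck_on k f \<longleftrightarrow> (\<exists>D. D 0 = f \<and>
     (\<forall>j<k. \<forall>x\<in>{0..1}. (D j has_real_derivative D (Suc j) x) (at x within {0..1})) \<and>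
     continuous_on {0..1} (D k))"

definition dx :: "(real \<Rightarrow> real) \<Rightarrow> real \<Rightarrow> real" where
  "dx f x = vector_derivative f (at x within {0..1})"

definition L2_on :: "(real \<Rightarrow> real) \<Rightarrow> bool" where
  "L2_on g \<longleftrightarrow> g measurable_on {0..1} \<and> (\<lambda>x. (g x)\<^sup>2) integrable_on {0..1}"

text \<open>W^{1,1}(0,1) and H^1(0,1), for functions continuous on (0,1) (the continuous
  representative is absolutely continuous with integrable / square integrable derivative).\<close>
definition W11_on :: "(real \<Rightarrow> real) \<Rightarrow> bool" where
  "W11_on g \<longleftrightarrow> (\<exists>h c. h absolutely_integrable_on {0..1} \<and>
       (\<forall>y\<in>{0<..<1}. g y = c + integral {0..y} h))"

definition H1_on :: "(real \<Rightarrow> real) \<Rightarrow> bool" where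
  "H1_on g \<longleftrightarrow> (\<exists>h c. L2_on h \<and> (\<forall>y\<in>{0<..<1}. g y = c + integral {0..y} h))"

definition classA0 :: "((real \<Rightarrow> real) \<times> real \<times> (real \<Rightarrow> real)) set" where
  "classA0 = {(a, \<alpha>, u0). Ck_on 3 a \<and> 0 < \<alpha> \<and> \<alpha> < 1 \<and> Ck_on 4 u0 \<and>
     (let p = (\<lambda>x. x powr \<alpha> * a x);
          q = (\<lambda>x. p x * dx u0 x);
          q1 = dx q;
          q2 = dx q1
      in W11_on u0 \<and> W11_on q1 \<and>
         L2_on (\<lambda>x. sqrt (p x) * dx u0 x) \<and> L2_on (\<lambda>x. sqrt (p x) * q2 x) \<and>
         H1_on q \<and> H1_on (\<lambda>x. p x * q2 x) \<and>
         u0 0 = 0 \<and> u0 1 = 0 \<and>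
         (q1 \<longlongrightarrow> 0) (at_right 0) \<and> (q1 \<longlongrightarrow> 0) (at_left 1))}"

definition classA :: "(real \<Rightarrow> real) \<Rightarrow> real \<Rightarrow> real \<Rightarrow> real \<Rightarrow> real \<Rightarrow>
    ((real \<Rightarrow> real) \<times> real \<times> (real \<Rightarrow> real)) set" where
  "classA a0 \<epsilon>0 \<epsilon>1 \<delta>0 \<delta>1 = {(a, \<alpha>, u0). (a, \<alpha>, u0) \<in> classA0 \<and>
     (\<forall>x\<in>{0..1}. a x \<ge> \<delta>0) \<and>
     (\<forall>x\<in>{1 - \<epsilon>0..1}. a x = a0 x) \<and>
     (\<forall>x\<in>{\<epsilon>1..1}. \<bar>dx u0 x\<bar> \<ge> \<delta>1)}"

text \<open>Domain of A u = (x^alpha a u')': f is in D(A) with flux F = x^alpha a f'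
  (an H^1 function, F(y) = F(0) + int_0^y h) and A f = h.
  f(0) = 0 is encoded by f(y) = int_0^y f'.\<close>
definition in_domA :: "(real \<Rightarrow> real) \<Rightarrow> real \<Rightarrow> (real \<Rightarrow> real) \<Rightarrow> (real \<Rightarrow> real) \<Rightarrow>
    (real \<Rightarrow> real) \<Rightarrow> bool" where
  "in_domA a \<alpha> f F h \<longleftrightarrow>
     L2_on h \<and> h absolutely_integrable_on {0..1} \<and>
     (\<forall>y\<in>{0..1}. F y = F 0 + integral {0..y} h) \<and>
     (\<lambda>x. F x / (x powr \<alpha> * a x)) absolutely_integrable_on {0..1} \<and>
     (\<forall>y\<in>{0..1}. f y = integral {0..y} (\<lambda>x. F x / (x powr \<alpha> * a x))) \<and>
     f 1 = 0 \<and>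
     (\<lambda>x. x powr \<alpha> * (F x / (x powr \<alpha> * a x))\<^sup>2) integrable_on {0..1}"

text \<open>u (x,t) is the semigroup solution: u(.,0) = u0, u(.,t) -> u0 in L^2 as t -> 0+,
  and for t > 0, u(.,t) lies in D(A) and t -> u(.,t) is differentiable in L^2 with
  derivative A u(.,t).\<close>
definition is_sol :: "(real \<Rightarrow> real) \<Rightarrow> real \<Rightarrow> (real \<Rightarrow> real) \<Rightarrow> (real \<Rightarrow> real \<Rightarrow> real) \<Rightarrow> bool" where
  "is_sol a \<alpha> u0 u \<longleftrightarrow>
     (\<forall>x\<in>{0..1}. u x 0 = u0 x) \<and>
     ((\<lambda>t. integral {0..1} (\<lambda>x. (u x t - u0 x)\<^sup>2)) \<longlongrightarrow> 0) (at_right 0) \<and>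
     (\<forall>t>0. \<exists>F h. in_domA a \<alpha> (\<lambda>x. u x t) F h \<and>
        ((\<lambda>s. integral {0..1} (\<lambda>x. ((u x s - u x t) / (s - t) - h x)\<^sup>2)) \<longlongrightarrow> 0) (at t))"

end

theory Submission
  imports Defs "HOL-Real_Asymp.Real_Asymp"
begin

text \<open>
  Let \<open>p = x\<^sup>\<alpha> a\<close>, \<open>\<eta> = \<surd>p\<close> and let \<open>\<tau> x\<close> be the travel time from \<open>x\<close> to \<open>1\<close>, i.e. the integral of
  \<open>1/\<eta>\<close> over \<open>[x, 1]\<close>. For large \<open>\<kappa>\<close> let \<open>\<psi>\<close> be a cut-off solution of \<open>(p \<psi>')' = \<kappa>\<^sup>2 \<psi>\<close>, decaying like
  \<open>exp (- \<kappa> \<tau>)\<close> away from \<open>1\<close>, with \<open>\<psi>(1) = 1\<close>. Up to exponentially small errors the time derivative of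
  \<open>exp (- \<kappa>\<^sup>2 t) \<integral> u \<psi>\<close> only involves the boundary flux, so equal data give
  \<open>\<integral> u0 \<psi>\<^sub>a \<approx> \<integral> u0 \<psi>\<^sub>b\<close>. With \<open>V\<close> solving \<open>\<kappa>\<^sup>2 V - (p\<^sub>b V')' = \<kappa>\<^sup>2 u0\<close>,
  integration by parts turns this into \<open>\<integral> (p\<^sub>a - p\<^sub>b) V' \<psi>\<^sub>a' \<approx> 0\<close>.

  Here \<open>V' = u0' + \<dots>\<close> and \<open>\<psi>\<^sub>a' = weight \<sqdot> exp (- \<kappa> \<tau>) (1 + \<dots>)\<close>, where the dots are Laplace transforms in \<open>\<kappa>\<close>
  of functions of at most exponential growth. This is expressed without the inverse transforms: along
  arithmetic progressions of \<open>\<kappa>\<close> the sequences \<open>C/k \<plusminus> \<dots>\<close> are completely monotone, a property inherited by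
  sums, products, integrals and limits, hence by the fixed points of the integral equations for \<open>V\<close> and
  \<open>\<psi>\<close>. Inverting by the real-variable formula \<open>N \<Sum>\<^sub>n (-1)\<^sup>n/n! exp ((n+1) N x) H ((n+1) N)\<close> bounds
  \<open>|p\<^sub>a - p\<^sub>b|\<close> at \<open>\<xi>\<close> by a multiple of its integral over \<open>[\<xi>, 1]\<close>, as long as \<open>\<tau> \<xi>\<close> stays slightly above the
  travel time to the set of agreement. By Gronwall's argument that set cannot stop before \<open>\<epsilon>1\<close>.
\<close>

section \<open>Completely monotone sequences and majorants\<close>

text \<open>The obstacle: equal data only control integrals of F exp (- k \<tau>) (v + E k), up to
  exp (- k c), and \<open>E k\<close> itself depends on k. Knowing |E k| = O(1/k) would not help,
  since the alternating inversion sum destroys bounds on absolute values. What survives inversion is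
  a bound on the inverse transform of \<open>E\<close>, and this is what a majorant records. These
  inverse transforms may grow like exp (C t); the shift \<kappa> = 2 C + k turns the growth into exp
  (- C t), so that the majorants are completely monotone in k. At spectral parameter \<kappa>^2 the
  equation behaves like a wave equation with speed \<eta>. Cutting off at m costs exp (- \<kappa>
  \<tau>(m)), while inversion at \<xi> tolerates errors exp (- k c) only if c > \<tau>(\<xi>); this
  is why agreement on [x0, 1] is pushed to the left in small steps. Stopping the observation at time
  T costs exp (- \<kappa>^2 T), which is eventually below every exp (- \<kappa> c), so an
  arbitrarily short observation suffices. The lower bound on |u0'| is what allows pa - pb to be
  recovered from its product with u0'.\<close>

definition dec :: "(nat \<Rightarrow> real) \<Rightarrow> nat \<Rightarrow> real" where
  "dec s = (\<lambda>n. s n - s (Suc n))"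

text \<open>By Hausdorff's theorem these are the moment sequences of positive measures on [0, 1].
  With r = exp (- B t), moments become samples of a Laplace transform along an arithmetic
  progression; the sign conditions on differences replace the measure.\<close>

definition cms :: "(nat \<Rightarrow> real) \<Rightarrow> bool" where
  "cms s \<longleftrightarrow> (\<forall>k n. (dec ^^ k) s n \<ge> 0)"

text \<open>Each condition in \<open>cms\<close> is a sign condition on a finite linear combination
  of entries. In this form it commutes with sums, pointwise limits and integrals over a
  parameter.\<close>

lemma dec_power_eq:
  "(dec ^^ k) s n = (\<Sum>j\<le>k. (-1) ^ j * real (k choose j) * s (n + j))"
proof (induction k arbitrary: n)
  case 0
  then show ?case by simp
next
  case (Suc k)
  have "(dec ^^ Suc k) s n = (dec ^^ k) s n - (dec ^^ k) s (Suc n)"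
    by (simp add: dec_def)
  also have "\<dots> = (\<Sum>j\<le>k. (-1) ^ j * real (k choose j) * s (n + j))
      - (\<Sum>j\<le>k. (-1) ^ j * real (k choose j) * s (n + Suc j))"
    by (simp add: Suc.IH)
  also have "(\<Sum>j\<le>k. (-1) ^ j * real (k choose j) * s (n + j))
      = (\<Sum>j\<le>Suc k. (-1) ^ j * real (k choose j) * s (n + j))"
    by simp
  also have "\<dots> = s n + (\<Sum>j\<le>k. (-1) ^ Suc j * real (k choose Suc j) * s (n + Suc j))"
    by (subst sum.atMost_Suc_shift) simp
  also have "\<dots> - (\<Sum>j\<le>k. (-1) ^ j * real (k choose j) * s (n + Suc j))
      = s n + (\<Sum>j\<le>k. (-1) ^ Suc j * real (Suc k choose Suc j) * s (n + Suc j))"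
    by (simp only: diff_conv_add_uminus add.assoc sum_negf[symmetric] sum.distrib[symmetric])
       (intro arg_cong2[where f = "(+)"] sum.cong refl, simp add: algebra_simps)
  also have "\<dots> = (\<Sum>j\<le>Suc k. (-1) ^ j * real (Suc k choose j) * s (n + j))"
    by (simp only: sum.atMost_Suc_shift[of _ k]) simp
  finally show ?case .
qed

lemma cms_nonneg: "cms s \<Longrightarrow> s n \<ge> 0"
  unfolding cms_def by (metis funpow_0)

lemma cms_dec: "cms s \<Longrightarrow> cms (dec s)"
  unfolding cms_def by (metis comp_apply funpow_Suc_right)

lemma cms_decreasing: "cms s \<Longrightarrow> s (Suc n) \<le> s n"
  using cms_nonneg[OF cms_dec, of s n] by (simp add: dec_def)

lemma cms_le_0:
  assumes "cms s"
  shows "s n \<le> s 0"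
  using lift_Suc_antimono_le[of s 0 n] cms_decreasing[OF assms] by simp

lemma cms_add: "cms s \<Longrightarrow> cms t \<Longrightarrow> cms (\<lambda>n. s n + t n)"
  unfolding cms_def dec_power_eq by (simp add: algebra_simps sum.distrib)

lemma cms_cmult: "c \<ge> 0 \<Longrightarrow> cms s \<Longrightarrow> cms (\<lambda>n. c * s n)"
  unfolding cms_def dec_power_eq
  by (simp add: mult.left_commute[of _ c] sum_distrib_left[symmetric])

lemma cms_const: "c \<ge> 0 \<Longrightarrow> cms (\<lambda>n. c)"
proof -
  assume c: "c \<ge> 0"
  have "(dec ^^ k) (\<lambda>n. c) = (\<lambda>n. if k = 0 then c else 0)" for k
    by (induction k) (auto simp: dec_def)
  then show ?thesis using c by (simp add: cms_def)
qed

text \<open>Discrete Leibniz rule: one difference of a product is a sum of two products in which one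
  factor is differenced and the other is unchanged or shifted. Both operations preserve
  \<open>cms\<close>, so the induction on the order runs over all pairs at once.\<close>

lemma cms_mult:
  assumes "cms s" "cms t"
  shows "cms (\<lambda>n. s n * t n)"
proof -
  have shift: "cms (\<lambda>n. s (Suc n))" if "cms s" for s
  proof -
    have "(dec ^^ k) (\<lambda>n. s (Suc n)) n = (dec ^^ k) s (Suc n)" for k n
      unfolding dec_power_eq by simp
    then show ?thesis using that by (simp add: cms_def)
  qed
  have "(dec ^^ k) (\<lambda>n. s n * t n) m \<ge> 0" if "cms s" "cms t" for k m s t
    using that
  proof (induction k arbitrary: s t m)
    case 0
    then show ?case by (simp add: cms_nonneg)
  next
    case (Suc k)
    have "dec (\<lambda>n. s n * t n) = (\<lambda>n. dec s n * t n + s (Suc n) * dec t n)"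
      by (auto simp: dec_def algebra_simps)
    then have "(dec ^^ Suc k) (\<lambda>n. s n * t n) m
        = (dec ^^ k) (\<lambda>n. dec s n * t n + s (Suc n) * dec t n) m"
      by (simp only: funpow_Suc_right comp_apply)
    also have "\<dots> = (dec ^^ k) (\<lambda>n. dec s n * t n) m + (dec ^^ k) (\<lambda>n. s (Suc n) * dec t n) m"
      unfolding dec_power_eq by (simp add: algebra_simps sum.distrib)
    also have "\<dots> \<ge> 0"
      using Suc by (intro add_nonneg_nonneg Suc.IH cms_dec shift) auto
    finally show ?case .
  qed
  then show ?thesis using assms by (simp add: cms_def)
qed

lemma cms_lim:
  assumes "\<And>m. cms (s m)" "\<And>n. (\<lambda>m. s m n) \<longlonglongrightarrow> t n"
  shows "cms t"
  unfolding cms_def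
proof (intro allI)
  fix k n
  have "(\<lambda>m. (dec ^^ k) (s m) n) \<longlonglongrightarrow> (dec ^^ k) t n"
    unfolding dec_power_eq by (intro tendsto_intros assms)
  moreover have "\<And>m. (dec ^^ k) (s m) n \<ge> 0"
    using assms(1) by (simp add: cms_def)
  ultimately show "(dec ^^ k) t n \<ge> 0"
    using LIMSEQ_le_const by blast
qed

lemma cms_integral:
  assumes "\<And>y. y \<in> S \<Longrightarrow> cms (s y)" "\<And>n. (\<lambda>y. s y n) integrable_on S"
  shows "cms (\<lambda>n. integral S (\<lambda>y. s y n))"
  unfolding cms_def
proof (intro allI)
  fix k n
  have "(dec ^^ k) (\<lambda>n. integral S (\<lambda>y. s y n)) n = integral S (\<lambda>y. (dec ^^ k) (s y) n)"
    unfolding dec_power_eq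
    by (subst integral_sum) (auto intro!: integrable_on_cmult_left assms(2) simp: mult.assoc)
  also have "\<dots> \<ge> 0"
    using assms(1) by (intro integral_nonneg)
      (auto simp: cms_def dec_power_eq mult.assoc intro!: integrable_sum integrable_on_cmult_left assms(2))
  finally show "(dec ^^ k) (\<lambda>n. integral S (\<lambda>y. s y n)) n \<ge> 0" .
qed

lemma cms_power:
  assumes "0 \<le> r" "r \<le> 1"
  shows "cms (\<lambda>n. r ^ n)"
proof -
  have "(dec ^^ k) (\<lambda>n. r ^ n) = (\<lambda>n. (1 - r) ^ k * r ^ n)" for k
    by (induction k) (auto simp: dec_def algebra_simps)
  then show ?thesis using assms by (simp add: cms_def)
qed

lemma cms_exp:
  assumes "0 \<le> B" "0 \<le> t"
  shows "cms (\<lambda>n. exp (- (A + B * real n) * t))"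
proof -
  have "(\<lambda>n. exp (- (A + B * real n) * t)) = (\<lambda>n. exp (- A * t) * exp (- B * t) ^ n)"
    by (auto simp: exp_of_nat_mult[symmetric] exp_add[symmetric] algebra_simps)
  then show ?thesis using assms by (simp only:) (intro cms_cmult cms_power, auto)
qed

text \<open>The k-th difference has the closed form k! B^k / ((A + B n) ... (A + B (n + k))), with
  all factors nonnegative.\<close>

lemma cms_inverse:
  assumes "0 < A" "0 \<le> B"
  shows "cms (\<lambda>n. 1 / (A + B * real n))"
proof -
  have pos: "A + B * real n > 0" for n
    using assms by (simp add: add_pos_nonneg)
  have "(dec ^^ k) (\<lambda>n. 1 / (A + B * real n)) n
      = fact k * B ^ k / (\<Prod>j\<le>k. A + B * real (n + j))" for k n
  proof (induction k arbitrary: n)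
    case (Suc k)
    let ?P = "\<lambda>n. \<Prod>j\<le>k. A + B * real (n + j)"
    have P: "?P n > 0" for n by (intro prod_pos ballI pos)
    have 1: "(\<Prod>j\<le>Suc k. A + B * real (n + j)) = (A + B * real n) * ?P (Suc n)"
      by (subst prod.atMost_Suc_shift) (simp add: algebra_simps)
    have 2: "(\<Prod>j\<le>Suc k. A + B * real (n + j)) = (A + B * real (n + Suc k)) * ?P n"
      by (simp add: algebra_simps)
    have expand: "x / p = x * c / (c * p)" if "c \<noteq> 0" for x p c :: real
      using that by simp
    have "(dec ^^ Suc k) (\<lambda>n. 1 / (A + B * real n)) n
        = fact k * B ^ k / ?P n - fact k * B ^ k / ?P (Suc n)"
      by (simp add: dec_def Suc.IH)
    also have "fact k * B ^ k / ?P n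
       = fact k * B ^ k * (A + B * real (n + Suc k)) / (\<Prod>j\<le>Suc k. A + B * real (n + j))"
      unfolding 2 by (rule expand) (use pos[of "n + Suc k"] in simp)
    also have "fact k * B ^ k / ?P (Suc n)
       = fact k * B ^ k * (A + B * real n) / (\<Prod>j\<le>Suc k. A + B * real (n + j))"
      unfolding 1 by (rule expand) (use pos[of n] in simp)
    finally show ?case
      by (simp add: diff_divide_distrib[symmetric] algebra_simps)
  qed simp
  moreover have "fact k * B ^ k / (\<Prod>j\<le>k. A + B * real (n + j)) \<ge> 0" for k n
    using assms pos by (intro divide_nonneg_nonneg prod_nonneg mult_nonneg_nonneg) (auto simp: less_imp_le)
  ultimately show ?thesis by (simp add: cms_def)
qed

lemma has_integral_real_derivative:
  fixes f :: "real \<Rightarrow> real"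
  assumes "a \<le> b" "\<And>x. x \<in> {a..b} \<Longrightarrow> (f has_real_derivative f' x) (at x within {a..b})"
  shows "(f' has_integral f b - f a) {a..b}"
  using assms by (intro fundamental_theorem_of_calculus)
    (simp_all add: has_real_derivative_iff_has_vector_derivative)

text \<open>This is the transform of the indicator function of [0, t]: an integral of exponential
  sequences.\<close>

lemma cms_one_minus_exp:
  assumes "0 < A" "0 \<le> B" "0 \<le> t"
  shows "cms (\<lambda>n. (1 - exp (- (A + B * real n) * t)) * (1 / (A + B * real n)))"
proof -
  have pos: "A + B * real n > 0" for n
    using assms by (simp add: add_pos_nonneg)
  have ftc: "((\<lambda>s. exp (- c * s)) has_integral - exp (- c * t) / c - - exp (- c * 0) / c) {0..t}" if "c > 0" for c :: real
    by (rule has_integral_real_derivative[OF assms(3)]) (use that in \<open>auto intro!: derivative_eq_intros\<close>)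
  have "integral {0..t} (\<lambda>s. exp (- (A + B * real n) * s))
      = (1 - exp (- (A + B * real n) * t)) * (1 / (A + B * real n))" for n
    unfolding integral_unique[OF ftc[OF pos]] by (simp add: diff_divide_distrib)
  moreover have "cms (\<lambda>n. integral {0..t} (\<lambda>s. exp (- (A + B * real n) * s)))"
    using assms by (intro cms_integral cms_exp integrable_continuous_real continuous_intros) auto
  ultimately show ?thesis by (simp only:)
qed

text \<open>
  If \<open>a\<close> and \<open>b\<close> are Laplace transforms sampled along an arithmetic progression, \<open>maj a b\<close> expresses that
  the inverse transform of \<open>a\<close> is bounded in modulus by that of \<open>b\<close>.
\<close>

definition maj :: "(nat \<Rightarrow> real) \<Rightarrow> (nat \<Rightarrow> real) \<Rightarrow> bool" where
  "maj a b \<longleftrightarrow> cms (\<lambda>n. b n + a n) \<and> cms (\<lambda>n. b n - a n)"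

lemma majD:
  assumes "maj a b"
  shows "cms b" "\<bar>a n\<bar> \<le> b n"
proof -
  have "cms (\<lambda>n. (1/2) * ((b n + a n) + (b n - a n)))"
    using assms by (intro cms_cmult cms_add[where s="\<lambda>n. b n + a n"]) (auto simp: maj_def)
  then show "cms b" by simp
  show "\<bar>a n\<bar> \<le> b n"
    using assms cms_nonneg[of "\<lambda>n. b n + a n" n] cms_nonneg[of "\<lambda>n. b n - a n" n]
    by (auto simp: maj_def)
qed

lemma maj_self: "cms a \<Longrightarrow> maj a a"
  using cms_add[of a a] cms_const[of 0] by (simp add: maj_def)

lemma maj_uminus: "maj a b \<Longrightarrow> maj (\<lambda>n. - a n) b"
  by (simp add: maj_def)

lemma maj_add: "maj a b \<Longrightarrow> maj c d \<Longrightarrow> maj (\<lambda>n. a n + c n) (\<lambda>n. b n + d n)"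
  unfolding maj_def
  using cms_add[of "\<lambda>n. b n + a n" "\<lambda>n. d n + c n"] cms_add[of "\<lambda>n. b n - a n" "\<lambda>n. d n - c n"]
  by (simp add: algebra_simps)

lemma maj_diff: "maj a b \<Longrightarrow> maj c d \<Longrightarrow> maj (\<lambda>n. a n - c n) (\<lambda>n. b n + d n)"
  using maj_add[OF _ maj_uminus] by force

text \<open>Polarisation: 2 (b d + a c) = (b + a) (d + c) + (b - a) (d - c), and 2 (b d - a c) is
  the same with the signs in the second factors exchanged. On the side of the inverse transforms,
  convolutions are dominated by convolutions of the majorants.\<close>

lemma maj_mult:
  assumes "maj a b" "maj c d"
  shows "maj (\<lambda>n. a n * c n) (\<lambda>n. b n * d n)"
proof -
  have "cms (\<lambda>n. (1/2) * ((b n + a n) * (d n + c n) + (b n - a n) * (d n - c n)))"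
    using assms by (intro cms_cmult cms_add[OF cms_mult cms_mult]) (auto simp: maj_def)
  moreover have "cms (\<lambda>n. (1/2) * ((b n + a n) * (d n - c n) + (b n - a n) * (d n + c n)))"
    using assms by (intro cms_cmult cms_add[OF cms_mult cms_mult]) (auto simp: maj_def)
  ultimately show ?thesis unfolding maj_def by (simp add: algebra_simps)
qed

lemma maj_const: "\<bar>c\<bar> \<le> d \<Longrightarrow> maj (\<lambda>n. c) (\<lambda>n. d)"
  by (auto simp: maj_def intro!: cms_const)

lemma maj_cmult: "\<bar>c\<bar> \<le> d \<Longrightarrow> maj a b \<Longrightarrow> maj (\<lambda>n. c * a n) (\<lambda>n. d * b n)"
  by (intro maj_mult maj_const)

lemma maj_trans: "maj a b \<Longrightarrow> cms (\<lambda>n. c n - b n) \<Longrightarrow> maj a c"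
  unfolding maj_def using cms_add[of "\<lambda>n. b n + a n" "\<lambda>n. c n - b n"]
    cms_add[of "\<lambda>n. b n - a n" "\<lambda>n. c n - b n"]
  by (simp add: add.commute)

lemma maj_lim:
  assumes "\<And>m. maj (s m) b" "\<And>n. (\<lambda>m. s m n) \<longlonglongrightarrow> t n"
  shows "maj t b"
  unfolding maj_def
proof
  show "cms (\<lambda>n. b n + t n)"
    by (rule cms_lim[of "\<lambda>m n. b n + s m n"]) (use assms in \<open>auto simp: maj_def intro!: tendsto_intros\<close>)
  show "cms (\<lambda>n. b n - t n)"
    by (rule cms_lim[of "\<lambda>m n. b n - s m n"]) (use assms in \<open>auto simp: maj_def intro!: tendsto_intros\<close>)
qed

lemma maj_integral:
  assumes "\<And>y. y \<in> S \<Longrightarrow> maj (s y) (b y)"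
    and "\<And>n. (\<lambda>y. s y n) integrable_on S" "\<And>n. (\<lambda>y. b y n) integrable_on S"
  shows "maj (\<lambda>n. integral S (\<lambda>y. s y n)) (\<lambda>n. integral S (\<lambda>y. b y n))"
  unfolding maj_def
proof
  have "cms (\<lambda>n. integral S (\<lambda>y. b y n + s y n))"
    using assms by (intro cms_integral integrable_add) (auto simp: maj_def)
  then show "cms (\<lambda>n. integral S (\<lambda>y. b y n) + integral S (\<lambda>y. s y n))"
    using assms by (simp add: integral_add)
  have "cms (\<lambda>n. integral S (\<lambda>y. b y n - s y n))"
    using assms by (intro cms_integral integrable_diff) (auto simp: maj_def)
  then show "cms (\<lambda>n. integral S (\<lambda>y. b y n) - integral S (\<lambda>y. s y n))"
    using assms by (simp add: integral_diff)
qed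

text \<open>
  On \<open>s n = exp (- k r (n + 1))\<close> with \<open>Y = exp (k t)\<close> and large \<open>k\<close>, \<open>k Y lap Y s\<close> is an approximate delta
  function of \<open>r\<close> at \<open>t\<close>; positivity on \<open>cms\<close> makes it respect \<open>maj\<close>.
\<close>

definition lap :: "real \<Rightarrow> (nat \<Rightarrow> real) \<Rightarrow> real" where
  "lap Y s = (\<Sum>n. (- Y) ^ n / fact n * s n)"

lemma lap_summable:
  fixes s :: "nat \<Rightarrow> real"
  assumes "\<And>n. \<bar>s n\<bar> \<le> K"
  shows "summable (\<lambda>n. \<bar>(- Y) ^ n / fact n * s n\<bar>)"
proof (rule summable_comparison_test'[where N = 0])
  show "summable (\<lambda>n. K * (\<bar>Y\<bar> ^ n / fact n))"
    using summable_exp[of "\<bar>Y\<bar>"] by (intro summable_mult) (simp add: field_simps)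
  show "norm \<bar>(- Y) ^ n / fact n * s n\<bar> \<le> K * (\<bar>Y\<bar> ^ n / fact n)" for n
    using mult_right_mono[OF assms[of n], of "\<bar>Y\<bar> ^ n / fact n"]
    by (simp add: abs_mult power_abs[symmetric] mult.commute)
qed

lemma lap_summable':
  fixes s :: "nat \<Rightarrow> real"
  assumes "\<And>n. \<bar>s n\<bar> \<le> K"
  shows "summable (\<lambda>n. (- Y) ^ n / fact n * s n)"
  by (rule summable_rabs_cancel, rule lap_summable, rule assms)

lemma lap_add:
  assumes "\<And>n. \<bar>s n\<bar> \<le> K" "\<And>n. \<bar>t n\<bar> \<le> L"
  shows "lap Y (\<lambda>n. s n + t n) = lap Y s + lap Y t"
  unfolding lap_def suminf_add[OF lap_summable'[OF assms(1)] lap_summable'[OF assms(2)]]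
  by (simp only: distrib_left right_diff_distrib)

lemma lap_diff:
  assumes "\<And>n. \<bar>s n\<bar> \<le> K" "\<And>n. \<bar>t n\<bar> \<le> L"
  shows "lap Y (\<lambda>n. s n - t n) = lap Y s - lap Y t"
  unfolding lap_def suminf_diff[OF lap_summable'[OF assms(1)] lap_summable'[OF assms(2)]]
  by (simp only: distrib_left right_diff_distrib)

text \<open>Multiply by exp Y > 0. The Cauchy product of the two series is the sum of Y^k / k! times
  the k-th difference of \<open>s\<close> at 0 (Euler's series transformation), and all these terms
  are nonnegative.\<close>

lemma lap_nonneg:
  assumes s: "cms s" and "Y \<ge> 0"
  shows "lap Y s \<ge> 0"
proof -
  have b: "\<bar>s n\<bar> \<le> s 0" for n
    using cms_nonneg[OF s] cms_le_0[OF s] by simp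
  define f where "f = (\<lambda>n. Y ^ n / fact n)"
  define g where "g = (\<lambda>n. (- Y) ^ n / fact n * s n)"
  have "f sums exp Y"
    using exp_converges[of Y] by (simp add: f_def divide_inverse mult.commute)
  then have sf: "summable f" "(\<Sum>n. f n) = exp Y"
    by (auto simp: sums_iff)
  have prod: "(\<lambda>k. \<Sum>i\<le>k. g i * f (k - i)) sums ((\<Sum>k. g k) * (\<Sum>k. f k))"
  proof (rule Cauchy_product_sums)
    show "summable (\<lambda>k. norm (g k))"
      using lap_summable[OF b, of Y] by (simp only: g_def real_norm_def)
    show "summable (\<lambda>k. norm (f k))"
      using sf(1) assms(2) by (simp add: f_def)
  qed
  have gf: "(\<Sum>i\<le>k. g i * f (k - i)) = Y ^ k / fact k * (dec ^^ k) s 0" for k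
  proof -
    have "g i * f (k - i) = Y ^ k / fact k * ((-1) ^ i * real (k choose i) * s (0 + i))" if "i \<le> k" for i
    proof -
      have "Y ^ k = Y ^ i * Y ^ (k - i)" using that by (simp add: power_add[symmetric])
      moreover have "real (k choose i) = fact k / (fact i * fact (k - i))"
        using that by (simp add: binomial_fact)
      ultimately show ?thesis
        by (simp add: g_def f_def power_minus[of Y])
    qed
    then show ?thesis by (simp add: dec_power_eq sum_distrib_left)
  qed
  have gf_nonneg: "(\<Sum>i\<le>k. g i * f (k - i)) \<ge> 0" for k
    unfolding gf using s assms(2) by (simp add: cms_def)
  have "(\<Sum>k. g k) * (\<Sum>k. f k) \<ge> 0"
    by (rule sums_le[OF gf_nonneg sums_zero prod])
  then have "(\<Sum>k. g k) * exp Y \<ge> 0"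
    by (simp only: sf(2))
  then have "(\<Sum>k. g k) \<ge> 0" by (simp add: zero_le_mult_iff)
  then show ?thesis by (simp add: lap_def g_def)
qed

lemma lap_maj:
  assumes "maj a b" "Y \<ge> 0"
  shows "\<bar>lap Y a\<bar> \<le> lap Y b"
proof -
  have b: "\<bar>b n\<bar> \<le> b 0" for n
    using cms_nonneg[OF majD(1)[OF assms(1)]] cms_le_0[OF majD(1)[OF assms(1)]] by simp
  have a: "\<bar>a n\<bar> \<le> b 0" for n
    using majD(2)[OF assms(1), of n] b[of n] by simp
  have "lap Y (\<lambda>n. b n + a n) \<ge> 0" "lap Y (\<lambda>n. b n - a n) \<ge> 0"
    using assms by (auto simp: maj_def intro: lap_nonneg)
  then show ?thesis using lap_add[OF b a] lap_diff[OF b a] by auto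
qed

section \<open>Fixed points and travel time\<close>

text \<open>Banach's fixed point theorem for functions that matter on \<open>S\<close> only. The
  convergence of the iterates started at 0 is part of the conclusion because majorants are carried
  to the fixed point along exactly this sequence.\<close>

lemma contraction_fixed_point:
  fixes \<Phi> :: "(real \<Rightarrow> real) \<Rightarrow> real \<Rightarrow> real"
  assumes S: "compact S"
    and cont: "\<And>X. continuous_on S X \<Longrightarrow> continuous_on S (\<Phi> X)"
    and contr: "\<And>X Y B x. continuous_on S X \<Longrightarrow> continuous_on S Y \<Longrightarrow>
        (\<And>y. y \<in> S \<Longrightarrow> \<bar>X y - Y y\<bar> \<le> B) \<Longrightarrow> x \<in> S \<Longrightarrow> \<bar>\<Phi> X x - \<Phi> Y x\<bar> \<le> B / 2"
  shows "\<exists>X. continuous_on S X \<and> (\<forall>x\<in>S. X x = \<Phi> X x) \<and>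
      (\<forall>x\<in>S. (\<lambda>m. (\<Phi> ^^ m) (\<lambda>_. 0) x) \<longlonglongrightarrow> X x)"
proof -
  define s where "s = (\<lambda>m. (\<Phi> ^^ m) (\<lambda>_. 0 :: real))"
  have s_Suc: "s (Suc m) = \<Phi> (s m)" for m by (simp add: s_def)
  have cs: "continuous_on S (s m)" for m
    by (induction m) (auto simp: s_Suc intro: cont, simp add: s_def)
  have "bounded ((\<lambda>x. s 1 x - s 0 x) ` S)"
    using S by (intro compact_imp_bounded compact_continuous_image continuous_intros cs)
  then obtain B where B: "\<And>x. x \<in> S \<Longrightarrow> \<bar>s 1 x - s 0 x\<bar> \<le> B"
    unfolding bounded_iff by auto
  have step: "\<bar>s (Suc m) x - s m x\<bar> \<le> B * (1/2) ^ m" if "x \<in> S" for m x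
    using that
  proof (induction m arbitrary: x)
    case 0
    then show ?case using B by simp
  next
    case (Suc m)
    show ?case
      using contr[OF cs cs Suc.IH Suc.prems] by (simp add: s_Suc)
  qed
  define X where "X = (\<lambda>x. \<Sum>m. s (Suc m) x - s m x)"
  have "uniform_limit S (\<lambda>n x. \<Sum>m<n. s (Suc m) x - s m x) X sequentially"
    unfolding X_def
    by (rule Weierstrass_m_test[where M = "\<lambda>m. B * (1/2) ^ m"])
      (use step in \<open>auto intro!: summable_mult summable_geometric\<close>)
  moreover have "(\<Sum>m<n. s (Suc m) x - s m x) = s n x" for n x
    using sum_lessThan_telescope[of "\<lambda>m. s m x" n] by (simp add: s_def)
  ultimately have ul: "uniform_limit S s X sequentially"
    by simp
  have cX: "continuous_on S X"
    by (rule uniform_limit_theorem[OF _ ul]) (use cs in auto)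
  have lim: "(\<lambda>m. s m x) \<longlonglongrightarrow> X x" if "x \<in> S" for x
    using tendsto_uniform_limitI[OF ul that] .
  have "X x = \<Phi> X x" if x: "x \<in> S" for x
  proof -
    have "(\<lambda>m. s (Suc m) x) \<longlonglongrightarrow> \<Phi> X x"
    proof (rule LIMSEQ_I)
      fix r :: real assume "r > 0"
      then have "\<forall>\<^sub>F m in sequentially. \<forall>y\<in>S. dist (s m y) (X y) < r"
        using ul by (auto simp: uniform_limit_iff)
      then obtain k where k: "\<And>m y. m \<ge> k \<Longrightarrow> y \<in> S \<Longrightarrow> dist (s m y) (X y) < r"
        by (auto simp: eventually_sequentially)
      have "norm (s (Suc m) x - \<Phi> X x) < r" if "m \<ge> k" for m
        using contr[OF cs[of m] cX _ x, of r] k[OF that] \<open>r > 0\<close>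
        by (force simp: s_Suc dist_real_def)
      then show "\<exists>no. \<forall>m\<ge>no. norm (s (Suc m) x - \<Phi> X x) < r" by blast
    qed
    then show ?thesis
      using LIMSEQ_unique LIMSEQ_Suc[OF lim[OF x]] by blast
  qed
  with cX lim show ?thesis unfolding s_def by blast
qed

section \<open>Travel time and transport along characteristics\<close>

locale medium =
  fixes p p' :: "real \<Rightarrow> real" and l :: real
  assumes l: "0 < l" "l < 1"
    and p_pos: "\<And>x. x \<in> {l..1} \<Longrightarrow> p x > 0"
    and dp: "\<And>x. x \<in> {l..1} \<Longrightarrow> (p has_real_derivative p' x) (at x within {l..1})"
    and cont_p': "continuous_on {l..1} p'"
begin

definition \<eta> :: "real \<Rightarrow> real" where "\<eta> x = sqrt (p x)"
text \<open>The logarithmic derivative of \<open>sqrt \<eta>\<close>: it measures how strongly the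
  medium reflects at x, and couples the two Riemann invariants.\<close>

definition \<nu> :: "real \<Rightarrow> real" where "\<nu> x = p' x / (4 * p x)"
definition \<tau> :: "real \<Rightarrow> real" where "\<tau> x = integral {x..1} (\<lambda>y. 1 / \<eta> y)"

text \<open>Response at x to sources \<open>w\<close> on the left, damped by the travel time: it
  solves X' = - (\<kappa>/\<eta>) X + w with X(l) = 0. Its mirror image \<open>Rt\<close> solves X'
  = (\<kappa>/\<eta>) X - w with X(1) = 0.\<close>

definition Lf :: "real \<Rightarrow> (real \<Rightarrow> real) \<Rightarrow> real \<Rightarrow> real" where
  "Lf \<kappa> w x = integral {l..x} (\<lambda>y. exp (- \<kappa> * (\<tau> y - \<tau> x)) * w y)"

definition Rt :: "real \<Rightarrow> (real \<Rightarrow> real) \<Rightarrow> real \<Rightarrow> real" where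
  "Rt \<kappa> w x = integral {x..1} (\<lambda>y. exp (- \<kappa> * (\<tau> x - \<tau> y)) * w y)"

lemma cont_p: "continuous_on {l..1} p"
  by (rule DERIV_continuous_on[OF dp])

lemma \<eta>_pos: "x \<in> {l..1} \<Longrightarrow> \<eta> x > 0"
  using p_pos by (simp add: \<eta>_def)

lemma \<eta>_square: "x \<in> {l..1} \<Longrightarrow> \<eta> x * \<eta> x = p x"
  using p_pos[of x] by (simp add: \<eta>_def)

lemma cont_\<eta>: "continuous_on {l..1} \<eta>"
  unfolding \<eta>_def by (intro continuous_intros cont_p)

lemma cont_\<nu>: "continuous_on {l..1} \<nu>"
  unfolding \<nu>_def using p_pos by (intro continuous_intros cont_p cont_p') force

lemma d\<eta>:
  assumes "x \<in> {l..1}"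
  shows "(\<eta> has_real_derivative 2 * \<nu> x * \<eta> x) (at x within {l..1})"
proof -
  have "(\<eta> has_real_derivative p' x * (inverse (sqrt (p x)) / 2)) (at x within {l..1})"
    unfolding \<eta>_def using DERIV_chain2[OF DERIV_real_sqrt dp] p_pos assms
    by (auto simp: mult.commute)
  moreover have "p' x * (inverse (sqrt (p x)) / 2) = 2 * \<nu> x * \<eta> x"
    using p_pos[OF assms] \<eta>_square[OF assms] \<eta>_pos[OF assms]
    unfolding \<nu>_def \<eta>_def by (simp add: field_simps)
  ultimately show ?thesis by (simp only:)
qed

lemma integral_left:
  assumes "continuous_on {l..1} w" "x \<in> {l..1}"
  shows "((\<lambda>x. integral {l..x} w) has_real_derivative w x) (at x within {l..1})"
  using integral_has_real_derivative[OF assms] .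

lemma integral_right:
  assumes "continuous_on {l..1} w" "x \<in> {l..1}"
  shows "((\<lambda>x. integral {x..1} w) has_real_derivative - w x) (at x within {l..1})"
  using integral_has_real_derivative'[OF assms] .

lemma cont_inv_\<eta>: "continuous_on {l..1} (\<lambda>y. 1 / \<eta> y)"
  by (intro continuous_on_divide continuous_on_const cont_\<eta>) (metis \<eta>_pos less_irrefl)

lemma d\<tau>: "x \<in> {l..1} \<Longrightarrow> (\<tau> has_real_derivative - (1 / \<eta> x)) (at x within {l..1})"
  unfolding \<tau>_def by (rule integral_right[OF cont_inv_\<eta>])

lemma cont_\<tau>: "continuous_on {l..1} \<tau>"
  by (rule DERIV_continuous_on[OF d\<tau>])

lemma \<tau>_1: "\<tau> 1 = 0"
  by (simp add: \<tau>_def)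

lemma \<tau>_less:
  assumes "l \<le> x" "x < y" "y \<le> 1"
  shows "\<tau> y < \<tau> x"
proof -
  have "(\<tau> has_real_derivative - (1 / \<eta> z)) (at z)" if "x < z" "z < y" for z
    using d\<tau>[of z] that assms by (simp add: at_within_Icc_at)
  then have "\<exists>u. u < 0 \<and> DERIV \<tau> z :> u" if "x < z" "z < y" for z
    using \<eta>_pos[of z] that assms by force
  moreover have "continuous_on {x..y} \<tau>"
    using cont_\<tau> assms by (auto intro: continuous_on_subset)
  ultimately show ?thesis
    using DERIV_neg_imp_decreasing_open[of x y \<tau>] assms by blast
qed

lemma \<tau>_le: "l \<le> x \<Longrightarrow> x \<le> y \<Longrightarrow> y \<le> 1 \<Longrightarrow> \<tau> y \<le> \<tau> x"
  using \<tau>_less[of x y] by (cases "x = y") auto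

lemma \<tau>_nonneg: "x \<in> {l..1} \<Longrightarrow> 0 \<le> \<tau> x"
  using \<tau>_le[of x 1] \<tau>_1 by simp

lemma Lf_eq: "Lf \<kappa> w x = exp (\<kappa> * \<tau> x) * integral {l..x} (\<lambda>y. exp (- \<kappa> * \<tau> y) * w y)"
proof -
  have "exp (- \<kappa> * (\<tau> y - \<tau> x)) * w y = exp (\<kappa> * \<tau> x) * (exp (- \<kappa> * \<tau> y) * w y)" for y
    by (simp add: mult.assoc[symmetric] mult_exp_exp) (simp add: algebra_simps)
  then show ?thesis unfolding Lf_def by (simp only: integral_mult_right)
qed

lemma Rt_eq: "Rt \<kappa> w x = exp (- \<kappa> * \<tau> x) * integral {x..1} (\<lambda>y. exp (\<kappa> * \<tau> y) * w y)"
proof -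
  have "exp (- \<kappa> * (\<tau> x - \<tau> y)) * w y = exp (- \<kappa> * \<tau> x) * (exp (\<kappa> * \<tau> y) * w y)" for y
    by (simp add: mult.assoc[symmetric] mult_exp_exp) (simp add: algebra_simps)
  then show ?thesis unfolding Rt_def by (simp only: integral_mult_right)
qed

lemma dLf:
  assumes "continuous_on {l..1} w" "x \<in> {l..1}"
  shows "(Lf \<kappa> w has_real_derivative - (\<kappa> / \<eta> x) * Lf \<kappa> w x + w x) (at x within {l..1})"
  unfolding Lf_eq
  by (rule derivative_eq_intros d\<tau> integral_left assms continuous_intros cont_\<tau> refl)+
    (simp add: exp_minus field_simps)

lemma dRt:
  assumes "continuous_on {l..1} w" "x \<in> {l..1}"
  shows "(Rt \<kappa> w has_real_derivative (\<kappa> / \<eta> x) * Rt \<kappa> w x - w x) (at x within {l..1})"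
  unfolding Rt_eq
  by (rule derivative_eq_intros d\<tau> integral_right assms continuous_intros cont_\<tau> refl)+
    (simp add: exp_minus field_simps)

lemma cont_Lf: "continuous_on {l..1} w \<Longrightarrow> continuous_on {l..1} (Lf \<kappa> w)"
  by (rule DERIV_continuous_on[OF dLf])

lemma cont_Rt: "continuous_on {l..1} w \<Longrightarrow> continuous_on {l..1} (Rt \<kappa> w)"
  by (rule DERIV_continuous_on[OF dRt])

text \<open>With the travel time as variable, exp (- \<kappa> \<phi>) / \<eta> integrates to (1 -
  exp (- \<kappa> \<phi>)) / \<kappa>, which lies below 1/\<kappa> in the sense of
  \<open>cms\<close>. Inserting the weight 1/\<eta> costs the factor S/\<eta> >= 1. The sign
  \<sigma> tells at which end \<phi> vanishes, so that both directions of transport are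
  covered.\<close>

lemma maj_exp_integral:
  assumes \<kappa>: "\<kappa> = (\<lambda>n. A + B * real n)" "A > 0" "B \<ge> 0"
    and w: "\<And>y. y \<in> {l..1} \<Longrightarrow> maj (w y) G" "\<And>n. continuous_on {l..1} (\<lambda>y. w y n)"
    and S: "\<And>y. y \<in> {l..1} \<Longrightarrow> \<eta> y \<le> S"
    and uv: "l \<le> u" "u \<le> v" "v \<le> 1"
    and \<phi>: "\<And>y. y \<in> {u..v} \<Longrightarrow> \<phi> y \<ge> 0"
      "\<And>y. y \<in> {u..v} \<Longrightarrow> (\<phi> has_real_derivative \<sigma> / \<eta> y) (at y within {u..v})"
      "\<sigma> = 1 \<and> \<phi> u = 0 \<or> \<sigma> = -1 \<and> \<phi> v = 0"
  shows "maj (\<lambda>n. integral {u..v} (\<lambda>y. exp (- \<kappa> n * \<phi> y) * w y n)) (\<lambda>n. S / \<kappa> n * G n)"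
proof -
  have sub: "{u..v} \<subseteq> {l..1}" using uv by auto
  have Spos: "S > 0" using S[of 1] \<eta>_pos[of 1] l by force
  have \<kappa>pos: "\<kappa> n > 0" for n using \<kappa> by (simp add: add_pos_nonneg)
  have G: "cms G" using majD(1)[OF w(1)[of 1]] l by simp
  have c\<phi>: "continuous_on {u..v} \<phi>" by (rule DERIV_continuous_on[OF \<phi>(2)])
  have e: "cms (\<lambda>n. exp (- \<kappa> n * \<phi> y))" if "y \<in> {u..v}" for y
    using cms_exp[OF \<kappa>(3) \<phi>(1)[OF that]] by (simp only: \<kappa>(1))
  have i: "cms (\<lambda>n. 1 / \<kappa> n)"
    using cms_inverse[OF \<kappa>(2,3)] by (simp only: \<kappa>(1))
  have point: "maj (\<lambda>n. exp (- \<kappa> n * \<phi> y) * w y n) (\<lambda>n. exp (- \<kappa> n * \<phi> y) * (S / \<eta> y * G n))"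
    if y: "y \<in> {u..v}" for y
  proof (intro maj_mult maj_self e y)
    have y1: "y \<in> {l..1}" using y sub by auto
    then have "S / \<eta> y - 1 \<ge> 0" using S[OF y1] \<eta>_pos[OF y1] by (simp add: field_simps)
    from cms_cmult[OF this G] show "maj (w y) (\<lambda>n. S / \<eta> y * G n)"
      by (intro maj_trans[OF w(1)[OF y1]]) (simp add: algebra_simps)
  qed
  define E where "E = (\<lambda>n. \<bar>exp (- \<kappa> n * \<phi> u) - exp (- \<kappa> n * \<phi> v)\<bar> / \<kappa> n)"
  have ftc: "((\<lambda>y. exp (- \<kappa> n * \<phi> y) / \<eta> y) has_integral
       - \<sigma> / \<kappa> n * exp (- \<kappa> n * \<phi> v) - - \<sigma> / \<kappa> n * exp (- \<kappa> n * \<phi> u)) {u..v}" for n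
    by (rule has_integral_real_derivative[OF uv(2)])
      (rule derivative_eq_intros \<phi>(2) refl | assumption | use \<kappa>pos[of n] \<phi>(3) in auto)+
  have hE: "((\<lambda>y. exp (- \<kappa> n * \<phi> y) / \<eta> y) has_integral E n) {u..v}" for n
  proof (rule has_integral_eq_rhs[OF ftc])
    have "- \<sigma> / \<kappa> n * exp (- \<kappa> n * \<phi> v) - - \<sigma> / \<kappa> n * exp (- \<kappa> n * \<phi> u)
        = \<sigma> * (exp (- \<kappa> n * \<phi> u) - exp (- \<kappa> n * \<phi> v)) / \<kappa> n"
      by (simp add: algebra_simps diff_divide_distrib)
    also have "\<sigma> * (exp (- \<kappa> n * \<phi> u) - exp (- \<kappa> n * \<phi> v)) = \<bar>exp (- \<kappa> n * \<phi> u) - exp (- \<kappa> n * \<phi> v)\<bar>"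
      using \<phi>(3) \<phi>(1)[of u] \<phi>(1)[of v] uv \<kappa>pos[of n] by (auto simp: zero_le_mult_iff)
    finally show "E n = - \<sigma> / \<kappa> n * exp (- \<kappa> n * \<phi> v) - - \<sigma> / \<kappa> n * exp (- \<kappa> n * \<phi> u)"
      by (simp only: E_def)
  qed
  have hE': "((\<lambda>y. exp (- \<kappa> n * \<phi> y) * (S / \<eta> y * G n)) has_integral S * E n * G n) {u..v}" for n
    using has_integral_mult_right[OF hE[of n], of "S * G n"] by (simp add: algebra_simps)
  have "maj (\<lambda>n. integral {u..v} (\<lambda>y. exp (- \<kappa> n * \<phi> y) * w y n))
     (\<lambda>n. integral {u..v} (\<lambda>y. exp (- \<kappa> n * \<phi> y) * (S / \<eta> y * G n)))"
    by (intro maj_integral point integrable_continuous_real continuous_intros c\<phi>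
      continuous_on_subset[OF w(2) sub] has_integral_integrable[OF hE'])
  then have "maj (\<lambda>n. integral {u..v} (\<lambda>y. exp (- \<kappa> n * \<phi> y) * w y n)) (\<lambda>n. S * E n * G n)"
    by (simp only: integral_unique[OF hE'])
  moreover have "cms (\<lambda>n. S / \<kappa> n * G n - S * E n * G n)"
  proof -
    \<comment> \<open>\<open>z\<close> is the end opposite to the zero of \<open>\<phi>\<close>. The
      claimed majorant then exceeds the computed one by S exp (- \<kappa> \<phi>(z)) G / \<kappa>, a
      product of completely monotone factors.\<close>
    obtain z where z: "z \<in> {u..v}" and Ez: "\<And>n. E n = (1 - exp (- \<kappa> n * \<phi> z)) / \<kappa> n"
    proof (cases "\<sigma> = 1 \<and> \<phi> u = 0")
      case True
      then show ?thesis using that[of v] uv \<kappa>pos \<phi>(1)[of v] by (auto simp: E_def less_imp_le)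
    next
      case False
      then have "\<phi> v = 0" using \<phi>(3) by auto
      then show ?thesis using that[of u] uv \<kappa>pos \<phi>(1)[of u] by (auto simp: E_def less_imp_le)
    qed
    have "(\<lambda>n. S / \<kappa> n * G n - S * E n * G n) = (\<lambda>n. S * (1 / \<kappa> n * (exp (- \<kappa> n * \<phi> z) * G n)))"
      by (auto simp: Ez diff_divide_distrib algebra_simps)
    then show ?thesis
      using Spos by (simp only:) (intro cms_cmult cms_mult i e z G, simp)
  qed
  ultimately show ?thesis by (rule maj_trans)
qed

lemma maj_Lf:
  assumes "\<kappa> = (\<lambda>n. A + B * real n)" "A > 0" "B \<ge> 0"
    and "\<And>y. y \<in> {l..1} \<Longrightarrow> maj (w y) G" "\<And>n. continuous_on {l..1} (\<lambda>y. w y n)"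
    and "\<And>y. y \<in> {l..1} \<Longrightarrow> \<eta> y \<le> S" and x: "x \<in> {l..1}"
  shows "maj (\<lambda>n. Lf (\<kappa> n) (\<lambda>y. w y n) x) (\<lambda>n. S / \<kappa> n * G n)"
  unfolding Lf_def
proof (rule maj_exp_integral[where \<sigma> = "-1" and \<phi> = "\<lambda>y. \<tau> y - \<tau> x" and w = w
      and \<kappa> = \<kappa> and G = G and u = l and v = x and S = S and A = A and B = B])
  show "((\<lambda>y. \<tau> y - \<tau> x) has_real_derivative - 1 / \<eta> y) (at y within {l..x})" if "y \<in> {l..x}" for y
    using DERIV_subset[OF d\<tau>[of y], of "{l..x}"] that x
    by (auto intro!: derivative_eq_intros)
qed (use assms x \<tau>_le in auto)

lemma maj_Rt:
  assumes "\<kappa> = (\<lambda>n. A + B * real n)" "A > 0" "B \<ge> 0"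
    and "\<And>y. y \<in> {l..1} \<Longrightarrow> maj (w y) G" "\<And>n. continuous_on {l..1} (\<lambda>y. w y n)"
    and "\<And>y. y \<in> {l..1} \<Longrightarrow> \<eta> y \<le> S" and x: "x \<in> {l..1}"
  shows "maj (\<lambda>n. Rt (\<kappa> n) (\<lambda>y. w y n) x) (\<lambda>n. S / \<kappa> n * G n)"
  unfolding Rt_def
proof (rule maj_exp_integral[where \<sigma> = 1 and \<phi> = "\<lambda>y. \<tau> x - \<tau> y" and w = w
      and \<kappa> = \<kappa> and G = G and u = x and v = 1 and S = S and A = A and B = B])
  show "((\<lambda>y. \<tau> x - \<tau> y) has_real_derivative 1 / \<eta> y) (at y within {x..1})" if "y \<in> {x..1}" for y
    using DERIV_subset[OF d\<tau>[of y], of "{x..1}"] that x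
    by (auto intro!: derivative_eq_intros)
qed (use assms x \<tau>_le in auto)

end

lemma continuous_on_Icc_bound:
  fixes f :: "real \<Rightarrow> real"
  assumes "continuous_on {a..b} f"
  obtains B where "B \<ge> 1" "\<And>x. x \<in> {a..b} \<Longrightarrow> \<bar>f x\<bar> \<le> B"
proof -
  have "bounded (f ` {a..b})"
    by (intro compact_imp_bounded compact_continuous_image assms compact_Icc)
  then obtain B where B: "\<forall>x\<in>{a..b}. \<bar>f x\<bar> \<le> B"
    by (auto simp: bounded_iff)
  show ?thesis
  proof (rule that[of "max B 1"])
    show "\<bar>f x\<bar> \<le> max B 1" if "x \<in> {a..b}" for x
      using B that by fastforce
  qed simp
qed

lemma continuous_on_Icc_common_bound:
  fixes S :: "(real \<Rightarrow> real) set"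
  assumes "finite S" "\<forall>f\<in>S. continuous_on {a..b} f"
  shows "\<exists>B\<ge>1. \<forall>f\<in>S. \<forall>x\<in>{a..b}. \<bar>f x\<bar> \<le> B"
  using assms
proof (induction S)
  case empty
  show ?case by (intro exI[of _ 1]) simp
next
  case (insert f S)
  then obtain B where B: "B \<ge> 1" "\<forall>f\<in>S. \<forall>x\<in>{a..b}. \<bar>f x\<bar> \<le> B" by auto
  obtain C where C: "\<And>x. x \<in> {a..b} \<Longrightarrow> \<bar>f x\<bar> \<le> C"
    using continuous_on_Icc_bound[of a b f] insert.prems by blast
  show ?case
  proof (intro exI[of _ "max B C"] conjI ballI)
    fix g x assume "g \<in> insert f S" "x \<in> {a..b}"
    then show "\<bar>g x\<bar> \<le> max B C" using B(2) C by (auto simp: le_max_iff_disj)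
  qed (use B(1) in simp)
qed

section \<open>Families of fixed points with a common majorant\<close>

lemma cms_C:
  assumes "C > 0" "N \<ge> 0"
  shows "cms (\<lambda>n. 1 / (2 * C + N * real (n + 1)))" "cms (\<lambda>n. C / (C + N * real (n + 1)))"
proof -
  show "cms (\<lambda>n. 1 / (2 * C + N * real (n + 1)))"
    using cms_inverse[of "2 * C + N" N] assms by (simp add: algebra_simps)
  have "cms (\<lambda>n. C * (1 / (C + N + N * real n)))"
    using assms by (intro cms_cmult cms_inverse) auto
  then show "cms (\<lambda>n. C / (C + N * real (n + 1)))"
    by (simp add: algebra_simps)
qed

text \<open>For \<kappa> = 2 C + N (n + 1) and j = C / (C + N (n + 1)) = C / (\<kappa> - C) this
  reads j = (C/\<kappa>) (1 + j). So j is reproduced by any integral operator whose output is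
  majorised by (C/\<kappa>) (1 + j), and it is the transform of a pure exponential.\<close>

lemma majorant_eq:
  assumes "C > 0" "N \<ge> 0"
  shows "C / (C + N * real (n + 1)) = C * (1 / (2 * C + N * real (n + 1)))
     + C * (1 / (2 * C + N * real (n + 1)) * (C / (C + N * real (n + 1))))"
proof -
  have "N * real (n + 1) \<ge> 0" using assms by simp
  then have "C + N * real (n + 1) > 0" "2 * C + N * real (n + 1) > 0" using assms by linarith+
  then show ?thesis by (simp add: divide_simps) (simp add: algebra_simps)
qed

text \<open>The spacing N stays free because the inversion needs N to tend to infinity. The index n
  + 1 makes \<kappa> - 2 C run through N, 2 N, ..., the nodes of the inversion sum.\<close>

definition maj_family :: "real \<Rightarrow> (real \<Rightarrow> (real \<Rightarrow> real) \<Rightarrow> real \<Rightarrow> real) \<Rightarrow> real \<Rightarrow> (real \<Rightarrow> real \<Rightarrow> real) \<Rightarrow> bool" where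
  "maj_family l \<Phi> C X \<longleftrightarrow>
     (\<forall>\<kappa>\<ge>2*C. continuous_on {l..1} (X \<kappa>) \<and> (\<forall>x\<in>{l..1}. X \<kappa> x = \<Phi> \<kappa> (X \<kappa>) x)) \<and>
     (\<forall>N\<ge>0. \<forall>x\<in>{l..1}. maj (\<lambda>n. X (2 * C + N * real (n + 1)) x) (\<lambda>n. C / (C + N * real (n + 1))))"

lemma maj_familyD:
  assumes "maj_family l \<Phi> C X"
  shows "\<kappa> \<ge> 2 * C \<Longrightarrow> continuous_on {l..1} (X \<kappa>)"
    and "\<kappa> \<ge> 2 * C \<Longrightarrow> \<forall>x\<in>{l..1}. X \<kappa> x = \<Phi> \<kappa> (X \<kappa>) x"
    and "N \<ge> 0 \<Longrightarrow> x \<in> {l..1} \<Longrightarrow> maj (\<lambda>n. X (2 * C + N * real (n + 1)) x) (\<lambda>n. C / (C + N * real (n + 1)))"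
  using assms by (auto simp: maj_family_def)

text \<open>The value at 2 C + k is the first entry of the progression with spacing k, so the
  majorant also yields an absolute bound.\<close>

lemma maj_family_half:
  assumes "maj_family l \<Phi> C X" "C > 0" "k \<ge> C"
  shows "\<forall>x\<in>{l..1}. \<bar>X (2 * C + k) x\<bar> \<le> 1 / 2"
proof
  fix x assume "x \<in> {l..1}"
  then have "\<bar>X (2 * C + k) x\<bar> \<le> C / (C + k)"
    using majD(2)[OF maj_familyD(3)[OF assms(1), of k x], of 0] assms(2,3) by simp
  also have "\<dots> \<le> 1 / 2" using assms(2,3) by (simp add: field_simps)
  finally show "\<bar>X (2 * C + k) x\<bar> \<le> 1 / 2" .
qed

text \<open>\<open>contr\<close> produces the fixed points, \<open>step\<close> keeps every iterate
  below the majorant j, and \<open>maj_lim\<close> passes to the limit. Allowing every C above a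
  threshold lets several operators share one C later.\<close>

lemma maj_family_exists:
  assumes K: "K > 0"
    and cont: "\<And>\<kappa> X. continuous_on {l..1} X \<Longrightarrow> continuous_on {l..1} (\<Phi> \<kappa> X)"
    and contr: "\<And>\<kappa> X Y B x. \<kappa> \<ge> 2 * K \<Longrightarrow> continuous_on {l..1} X \<Longrightarrow> continuous_on {l..1} Y \<Longrightarrow>
        (\<And>y. y \<in> {l..1} \<Longrightarrow> \<bar>X y - Y y\<bar> \<le> B) \<Longrightarrow> x \<in> {l..1} \<Longrightarrow> \<bar>\<Phi> \<kappa> X x - \<Phi> \<kappa> Y x\<bar> \<le> B / 2"
    and step: "\<And>C N \<kappa> j X x. C \<ge> K \<Longrightarrow> N \<ge> 0 \<Longrightarrow> \<kappa> = (\<lambda>n. 2 * C + N * real (n + 1)) \<Longrightarrow>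
        j = (\<lambda>n. C / (C + N * real (n + 1))) \<Longrightarrow> (\<And>n. continuous_on {l..1} (X n)) \<Longrightarrow>
        (\<And>y. y \<in> {l..1} \<Longrightarrow> maj (\<lambda>n. X n y) j) \<Longrightarrow> x \<in> {l..1} \<Longrightarrow> maj (\<lambda>n. \<Phi> (\<kappa> n) (X n) x) j"
  shows "\<exists>C0>0. \<forall>C\<ge>C0. \<exists>X. maj_family l \<Phi> C X"
proof -
  have "\<exists>X. \<kappa> \<ge> 2 * K \<longrightarrow> continuous_on {l..1} X \<and> (\<forall>x\<in>{l..1}. X x = \<Phi> \<kappa> X x) \<and>
      (\<forall>x\<in>{l..1}. (\<lambda>i. (\<Phi> \<kappa> ^^ i) (\<lambda>_. 0) x) \<longlonglongrightarrow> X x)" for \<kappa>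
    using contraction_fixed_point[of "{l..1}" "\<Phi> \<kappa>"] cont contr by blast
  then have "\<exists>X. \<forall>\<kappa>. \<kappa> \<ge> 2 * K \<longrightarrow> continuous_on {l..1} (X \<kappa>) \<and> (\<forall>x\<in>{l..1}. X \<kappa> x = \<Phi> \<kappa> (X \<kappa>) x) \<and>
      (\<forall>x\<in>{l..1}. (\<lambda>i. (\<Phi> \<kappa> ^^ i) (\<lambda>_. 0) x) \<longlonglongrightarrow> X \<kappa> x)"
    by (intro choice) blast
  then obtain X where X: "\<And>\<kappa>. \<kappa> \<ge> 2 * K \<Longrightarrow> continuous_on {l..1} (X \<kappa>)"
      "\<And>\<kappa>. \<kappa> \<ge> 2 * K \<Longrightarrow> \<forall>x\<in>{l..1}. X \<kappa> x = \<Phi> \<kappa> (X \<kappa>) x"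
      "\<And>\<kappa>. \<kappa> \<ge> 2 * K \<Longrightarrow> \<forall>x\<in>{l..1}. (\<lambda>i. (\<Phi> \<kappa> ^^ i) (\<lambda>_. 0) x) \<longlonglongrightarrow> X \<kappa> x"
    by blast
  have "maj_family l \<Phi> C X" if C: "C \<ge> K" for C
    unfolding maj_family_def
  proof (intro conjI allI impI)
    fix N :: real assume N: "N \<ge> 0"
    define \<kappa> where "\<kappa> = (\<lambda>n. 2 * C + N * real (n + 1))"
    define j where "j = (\<lambda>n. C / (C + N * real (n + 1)))"
    have "N * real (n + 1) \<ge> 0" for n using N by simp
    then have \<kappa>K: "\<kappa> n \<ge> 2 * K" for n
      unfolding \<kappa>_def using C by (smt (verit))
    have cj: "cms j" unfolding j_def using cms_C(2) K C N by simp
    have cit: "continuous_on {l..1} ((\<Phi> \<kappa> ^^ i) (\<lambda>_. 0))" for i \<kappa>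
      by (induction i) (auto intro: cont)
    have it: "maj (\<lambda>n. (\<Phi> (\<kappa> n) ^^ i) (\<lambda>_. 0) x) j" if "x \<in> {l..1}" for i x
      using that
    proof (induction i arbitrary: x)
      case 0
      show ?case using maj_mult[OF maj_const[of 0 1] maj_self[OF cj]] by simp
    next
      case (Suc i)
      show ?case using step[OF C N \<kappa>_def j_def cit Suc.IH Suc.prems] by simp
    qed
    have "maj (\<lambda>n. X (\<kappa> n) x) j" if "x \<in> {l..1}" for x
      by (rule maj_lim[OF it[OF that] X(3)[OF \<kappa>K, rule_format, OF that]])
    then show "\<forall>x\<in>{l..1}. maj (\<lambda>n. X (2 * C + N * real (n + 1)) x) (\<lambda>n. C / (C + N * real (n + 1)))"
      by (simp add: \<kappa>_def j_def)
  qed (use X C in auto)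
  then show ?thesis using K by blast
qed

context medium
begin

lemma Lf_diff:
  assumes "continuous_on {l..1} v" "continuous_on {l..1} w" "x \<in> {l..1}"
  shows "Lf \<kappa> v x - Lf \<kappa> w x = Lf \<kappa> (\<lambda>y. v y - w y) x"
proof -
  have sub: "{l..x} \<subseteq> {l..1}" using assms by auto
  show ?thesis
    unfolding Lf_def right_diff_distrib
    by (subst integral_diff) (auto intro!: integrable_continuous_real continuous_intros
      continuous_on_subset[OF cont_\<tau> sub] continuous_on_subset[OF assms(1) sub] continuous_on_subset[OF assms(2) sub])
qed

lemma Rt_diff:
  assumes "continuous_on {l..1} v" "continuous_on {l..1} w" "x \<in> {l..1}"
  shows "Rt \<kappa> v x - Rt \<kappa> w x = Rt \<kappa> (\<lambda>y. v y - w y) x"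
proof -
  have sub: "{x..1} \<subseteq> {l..1}" using assms by auto
  show ?thesis
    unfolding Rt_def right_diff_distrib
    by (subst integral_diff) (auto intro!: integrable_continuous_real continuous_intros
      continuous_on_subset[OF cont_\<tau> sub] continuous_on_subset[OF assms(1) sub] continuous_on_subset[OF assms(2) sub])
qed

text \<open>On constant sequences \<open>maj\<close> is the inequality between absolute value and
  bound, so the case B = 0 of the majorant estimates contains the sup-norm estimates needed for the
  contraction.\<close>

lemma Lf_Rt_bound:
  assumes "\<kappa> > 0" "continuous_on {l..1} w" "\<And>y. y \<in> {l..1} \<Longrightarrow> \<bar>w y\<bar> \<le> W"
    and "\<And>y. y \<in> {l..1} \<Longrightarrow> \<eta> y \<le> S" "x \<in> {l..1}"
  shows "\<bar>Lf \<kappa> w x\<bar> \<le> S / \<kappa> * W" "\<bar>Rt \<kappa> w x\<bar> \<le> S / \<kappa> * W"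
proof -
  have "maj (\<lambda>n::nat. Lf \<kappa> w x) (\<lambda>n. S / \<kappa> * W)"
    by (rule maj_Lf[where \<kappa> = "\<lambda>_. \<kappa>" and w = "\<lambda>y _. w y" and G = "\<lambda>_. W" and A = \<kappa> and B = 0])
      (use assms in \<open>auto intro: maj_const\<close>)
  then show "\<bar>Lf \<kappa> w x\<bar> \<le> S / \<kappa> * W" using majD(2) by blast
  have "maj (\<lambda>n::nat. Rt \<kappa> w x) (\<lambda>n. S / \<kappa> * W)"
    by (rule maj_Rt[where \<kappa> = "\<lambda>_. \<kappa>" and w = "\<lambda>y _. w y" and G = "\<lambda>_. W" and A = \<kappa> and B = 0])
      (use assms in \<open>auto intro: maj_const\<close>)
  then show "\<bar>Rt \<kappa> w x\<bar> \<le> S / \<kappa> * W" using majD(2) by blast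
qed

lemma integral_\<nu>:
  assumes "continuous_on {l..1} X"
  shows "continuous_on {l..1} (\<lambda>y. integral {y..1} (\<lambda>s. \<nu> s * X s))"
  by (rule DERIV_continuous_on, rule integral_right) (auto intro!: continuous_intros cont_\<nu> assms)

lemma integral_\<nu>_integrable:
  assumes "continuous_on {l..1} X" "y \<in> {l..1}"
  shows "(\<lambda>s. \<nu> s * X s) integrable_on {y..1}"
  using assms by (intro integrable_continuous_real continuous_intros)
    (auto intro: continuous_on_subset[OF cont_\<nu>] continuous_on_subset[OF assms(1)])

lemma maj_integral_\<nu>:
  assumes X: "\<And>n. continuous_on {l..1} (X n)"
    and maj: "\<And>x. x \<in> {l..1} \<Longrightarrow> maj (\<lambda>n. X n x) j"
    and M: "\<And>x. x \<in> {l..1} \<Longrightarrow> \<bar>\<nu> x\<bar> \<le> M" and y: "y \<in> {l..1}"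
  shows "maj (\<lambda>n. integral {y..1} (\<lambda>s. \<nu> s * X n s)) (\<lambda>n. M * j n)"
proof -
  have M0: "M \<ge> 0" using M[OF y] by linarith
  have cm: "cms j" by (rule majD(1)[OF maj[OF y]])
  have "maj (\<lambda>n. integral {y..1} (\<lambda>s. \<nu> s * X n s)) (\<lambda>n. integral {y..1} (\<lambda>s. M * j n))"
    using y by (intro maj_integral maj_cmult M maj integral_\<nu>_integrable X) auto
  moreover have "integral {y..1} (\<lambda>s. M * j n) = (1 - y) * M * j n" for n
    using y by simp
  moreover have "cms (\<lambda>n. M * j n - (1 - y) * M * j n)"
    using cms_cmult[OF _ cm, of "y * M"] y l M0 by (simp add: algebra_simps)
  ultimately show ?thesis by (simp only:) (rule maj_trans)
qed

text \<open>
  The Riemann invariants \<open>\<surd>\<eta> (\<kappa> u \<plusminus> p u'/\<eta>)\<close> of \<open>(p u')' = \<kappa>\<^sup>2 u\<close> travel in opposite directions and are coupled by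
  \<open>\<nu>\<close>. With the factor \<open>exp (- \<kappa> \<tau>)\<close> removed, the incoming one is \<open>1 - \<integral> \<nu> A\<close> and the reflected one is \<open>A\<close>, a
  fixed point of \<open>opA \<kappa>\<close> if nothing enters at \<open>l\<close>.
\<close>

definition opA :: "real \<Rightarrow> (real \<Rightarrow> real) \<Rightarrow> real \<Rightarrow> real" where
  "opA \<kappa> X = Lf (2 * \<kappa>) (\<lambda>y. \<nu> y * (1 - integral {y..1} (\<lambda>s. \<nu> s * X s)))"

lemma opA_src: "continuous_on {l..1} X \<Longrightarrow>
    continuous_on {l..1} (\<lambda>y. \<nu> y * (1 - integral {y..1} (\<lambda>s. \<nu> s * X s)))"
  by (intro continuous_intros cont_\<nu> integral_\<nu>)

text \<open>If M >= 1 bounds \<eta> and |\<nu>|, the source has majorant M (1 + M j) and transport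
  at rate 2 \<kappa> contributes M / (2 \<kappa>). The result stays below (C/\<kappa>) (1 + j) = j
  as soon as C >= M^3.\<close>

lemma opA_fixed_point: "\<exists>C0>0. \<forall>C\<ge>C0. \<exists>X. maj_family l opA C X"
proof -
  have "continuous_on {l..1} (\<lambda>x. \<bar>\<eta> x\<bar> + \<bar>\<nu> x\<bar>)" by (intro continuous_intros cont_\<eta> cont_\<nu>)
  then obtain M where M: "M \<ge> 1" and bd: "\<And>x. x \<in> {l..1} \<Longrightarrow> \<bar>\<bar>\<eta> x\<bar> + \<bar>\<nu> x\<bar>\<bar> \<le> M"
    using continuous_on_Icc_bound by blast
  have \<eta>M: "\<eta> x \<le> M" and \<nu>M: "\<bar>\<nu> x\<bar> \<le> M" if "x \<in> {l..1}" for x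
    using bd[OF that] by linarith+
  have MM: "M * M \<le> M * M * M" "M * M > 0" "M * M * M > 0" using M by auto
  show ?thesis
  proof (rule maj_family_exists[of "M * M * M"])
    show "continuous_on {l..1} (opA \<kappa> X)" if "continuous_on {l..1} X" for \<kappa> X
      unfolding opA_def by (intro cont_Lf opA_src that)
  next
    fix \<kappa> B x and X Y :: "real \<Rightarrow> real"
    assume \<kappa>: "\<kappa> \<ge> 2 * (M * M * M)" and X: "continuous_on {l..1} X" and Y: "continuous_on {l..1} Y"
      and B: "\<And>y. y \<in> {l..1} \<Longrightarrow> \<bar>X y - Y y\<bar> \<le> B" and x: "x \<in> {l..1}"
    have B0: "B \<ge> 0" using B[OF x] by linarith
    have \<kappa>0: "\<kappa> > 0" using \<kappa> MM by linarith
    let ?w = "\<lambda>X y. \<nu> y * (1 - integral {y..1} (\<lambda>s. \<nu> s * X s))"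
    have bound: "\<bar>?w X y - ?w Y y\<bar> \<le> M * (M * B)" if y: "y \<in> {l..1}" for y
    proof -
      have "?w X y - ?w Y y = \<nu> y * integral {y..1} (\<lambda>s. \<nu> s * Y s - \<nu> s * X s)"
        using integral_diff[OF integral_\<nu>_integrable[OF Y y] integral_\<nu>_integrable[OF X y]]
        by (simp only: right_diff_distrib[symmetric]) (simp add: right_diff_distrib)
      moreover have "maj (\<lambda>n. integral {y..1} (\<lambda>s. \<nu> s * (Y s - X s))) (\<lambda>n. M * B)"
        using B by (intro maj_integral_\<nu>[OF _ maj_const \<nu>M y] continuous_on_diff X Y) (simp_all add: abs_minus_commute)
      then have "\<bar>integral {y..1} (\<lambda>s. \<nu> s * Y s - \<nu> s * X s)\<bar> \<le> M * B"
        using majD(2) unfolding right_diff_distrib by blast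
      ultimately show ?thesis
        using M \<nu>M[OF y] by (simp only: abs_mult) (intro mult_mono, auto)
    qed
    have "\<bar>opA \<kappa> X x - opA \<kappa> Y x\<bar> \<le> M / (2 * \<kappa>) * (M * (M * B))"
      unfolding opA_def Lf_diff[OF opA_src[OF X] opA_src[OF Y] x]
      by (rule Lf_Rt_bound(1)) (use \<kappa>0 bound \<eta>M x in \<open>auto intro!: continuous_intros opA_src X Y\<close>)
    also have "\<dots> = (M * M * M) * B / (2 * \<kappa>)" by simp
    also have "\<dots> \<le> \<kappa> * B / (2 * \<kappa>)"
      using \<kappa> \<kappa>0 B0 MM by (intro divide_right_mono mult_right_mono) auto
    also have "\<dots> = B / 2" using \<kappa>0 by simp
    finally show "\<bar>opA \<kappa> X x - opA \<kappa> Y x\<bar> \<le> B / 2" .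
  next
    fix C N \<kappa> j x and X :: "nat \<Rightarrow> real \<Rightarrow> real"
    assume C: "C \<ge> M * M * M" and N: "N \<ge> 0" and \<kappa>: "\<kappa> = (\<lambda>n. 2 * C + N * real (n + 1))"
      and j: "j = (\<lambda>n. C / (C + N * real (n + 1)))" and cX: "\<And>n. continuous_on {l..1} (X n)"
      and X: "\<And>y. y \<in> {l..1} \<Longrightarrow> maj (\<lambda>n. X n y) j" and x: "x \<in> {l..1}"
    have C0: "C > 0" using C MM by linarith
    have cm: "cms (\<lambda>n. 1 / \<kappa> n)" "cms j"
      unfolding \<kappa> j by (rule cms_C[OF C0 N])+
    have "maj (\<lambda>n. opA (\<kappa> n) (X n) x) (\<lambda>n. M / (2 * \<kappa> n) * (M * (1 + M * j n)))"
      unfolding opA_def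
    proof (rule maj_Lf[where A = "2 * (2 * C + N)" and B = "2 * N"])
      show "(\<lambda>n. 2 * \<kappa> n) = (\<lambda>n. 2 * (2 * C + N) + 2 * N * real n)"
        by (auto simp: \<kappa> algebra_simps)
      show "maj (\<lambda>n. \<nu> y * (1 - integral {y..1} (\<lambda>s. \<nu> s * X n s))) (\<lambda>n. M * (1 + M * j n))" if "y \<in> {l..1}" for y
        using that by (intro maj_cmult maj_diff maj_const \<nu>M maj_integral_\<nu>[OF cX X]) auto
      show "continuous_on {l..1} (\<lambda>y. \<nu> y * (1 - integral {y..1} (\<lambda>s. \<nu> s * X n s)))" for n
        by (rule opA_src[OF cX])
    qed (use \<eta>M x C0 N in auto)
    moreover have "cms (\<lambda>n. j n - M / (2 * \<kappa> n) * (M * (1 + M * j n)))"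
    proof -
      have "j n - M / (2 * \<kappa> n) * (M * (1 + M * j n))
        = (C - M * M / 2) * (1 / \<kappa> n) + (C - M * M * M / 2) * (1 / \<kappa> n * j n)" for n
      proof -
        have "j n = C * (1 / \<kappa> n) + C * (1 / \<kappa> n * j n)" unfolding j \<kappa> by (rule majorant_eq[OF C0 N])
        then show ?thesis by (simp add: algebra_simps add_divide_distrib)
      qed
      moreover have "C - M * M / 2 \<ge> 0" "C - M * M * M / 2 \<ge> 0" using C MM by linarith+
      ultimately show ?thesis by (simp only:) (intro cms_add cms_cmult cms_mult cm)
    qed
    ultimately show "maj (\<lambda>n. opA (\<kappa> n) (X n) x) j" by (rule maj_trans)
  qed (rule MM)
qed

text \<open>
  For \<open>(p z')' = \<kappa>\<^sup>2 z - \<eta> q\<close> with \<open>z(1) = 0\<close> and nothing entering at \<open>l\<close>, the difference \<open>2 \<eta> z'\<close> of the invariants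
  \<open>\<kappa> z \<plusminus> p z'/\<eta>\<close> is a fixed point of \<open>opG q \<kappa>\<close>; the last term is the reflection at \<open>1\<close>.
\<close>

definition opG :: "(real \<Rightarrow> real) \<Rightarrow> real \<Rightarrow> (real \<Rightarrow> real) \<Rightarrow> real \<Rightarrow> real" where
  "opG q \<kappa> X x = (let w = \<lambda>y. q y + \<nu> y * X y
     in Rt \<kappa> w x - Lf \<kappa> w x - exp (- \<kappa> * \<tau> x) * Lf \<kappa> w 1)"

text \<open>Each of the three terms of \<open>opG\<close> is majorised by (M/\<kappa>) (M + M j),
  which explains the threshold 3 M^2.\<close>

lemma opG_fixed_point:
  assumes q: "continuous_on {l..1} q"
  shows "\<exists>C0>0. \<forall>C\<ge>C0. \<exists>X. maj_family l (opG q) C X"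
proof -
  have "continuous_on {l..1} (\<lambda>x. \<bar>\<eta> x\<bar> + \<bar>\<nu> x\<bar> + \<bar>q x\<bar>)" by (intro continuous_intros cont_\<eta> cont_\<nu> q)
  then obtain M where M: "M \<ge> 1" and bd: "\<And>x. x \<in> {l..1} \<Longrightarrow> \<bar>\<bar>\<eta> x\<bar> + \<bar>\<nu> x\<bar> + \<bar>q x\<bar>\<bar> \<le> M"
    using continuous_on_Icc_bound by blast
  have \<eta>M: "\<eta> x \<le> M" and \<nu>M: "\<bar>\<nu> x\<bar> \<le> M" and qM: "\<bar>q x\<bar> \<le> M" if "x \<in> {l..1}" for x
    using bd[OF that] by linarith+
  have src: "continuous_on {l..1} (\<lambda>y. q y + \<nu> y * X y)" if "continuous_on {l..1} X" for X
    by (intro continuous_intros q cont_\<nu> that)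
  have one: "1 \<in> {l..1}" using l by simp
  have MM: "3 * (M * M) > 0" using M by simp
  show ?thesis
  proof (rule maj_family_exists[of "3 * (M * M)"])
    show "continuous_on {l..1} (opG q \<kappa> X)" if "continuous_on {l..1} X" for \<kappa> X
      unfolding opG_def Let_def by (intro continuous_intros cont_Rt cont_Lf src that cont_\<tau>)
  next
    fix \<kappa> B x and X Y :: "real \<Rightarrow> real"
    assume \<kappa>: "\<kappa> \<ge> 2 * (3 * (M * M))" and X: "continuous_on {l..1} X" and Y: "continuous_on {l..1} Y"
      and B: "\<And>y. y \<in> {l..1} \<Longrightarrow> \<bar>X y - Y y\<bar> \<le> B" and x: "x \<in> {l..1}"
    have B0: "B \<ge> 0" using B[OF x] by linarith
    have \<kappa>0: "\<kappa> > 0" using \<kappa> MM by linarith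
    let ?w = "\<lambda>X y. q y + \<nu> y * X y"
    let ?d = "\<lambda>y. ?w X y - ?w Y y"
    have bound: "\<bar>?d y\<bar> \<le> M * B" if y: "y \<in> {l..1}" for y
      using mult_mono[OF \<nu>M[OF y] B[OF y]] M
      by (simp add: abs_mult[symmetric] right_diff_distrib)
    have cd: "continuous_on {l..1} ?d" by (intro continuous_intros src X Y)
    note LR = Lf_Rt_bound[OF \<kappa>0 cd bound \<eta>M]
    have "opG q \<kappa> X x - opG q \<kappa> Y x = Rt \<kappa> ?d x - Lf \<kappa> ?d x - exp (- \<kappa> * \<tau> x) * Lf \<kappa> ?d 1"
      unfolding opG_def Let_def Lf_diff[OF src[OF X] src[OF Y] x, symmetric]
        Lf_diff[OF src[OF X] src[OF Y] one, symmetric] Rt_diff[OF src[OF X] src[OF Y] x, symmetric]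
      by (simp add: right_diff_distrib)
    moreover have "\<bar>exp (- \<kappa> * \<tau> x) * Lf \<kappa> ?d 1\<bar> \<le> 1 * (M / \<kappa> * (M * B))"
      unfolding abs_mult using \<kappa>0 \<tau>_nonneg[OF x] by (intro mult_mono LR one) auto
    ultimately have "\<bar>opG q \<kappa> X x - opG q \<kappa> Y x\<bar> \<le> 3 * (M / \<kappa> * (M * B))"
      using LR(1)[OF _ _ x] LR(2)[OF _ _ x] by linarith
    also have "\<dots> = 3 * (M * M) * B / \<kappa>" by simp
    also have "\<dots> \<le> (\<kappa> / 2) * B / \<kappa>"
      using \<kappa> \<kappa>0 B0 by (intro divide_right_mono mult_right_mono) auto
    also have "\<dots> = B / 2" using \<kappa>0 by simp
    finally show "\<bar>opG q \<kappa> X x - opG q \<kappa> Y x\<bar> \<le> B / 2" .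
  next
    fix C N \<kappa> j x and X :: "nat \<Rightarrow> real \<Rightarrow> real"
    assume C: "C \<ge> 3 * (M * M)" and N: "N \<ge> 0" and \<kappa>: "\<kappa> = (\<lambda>n. 2 * C + N * real (n + 1))"
      and j: "j = (\<lambda>n. C / (C + N * real (n + 1)))" and cX: "\<And>n. continuous_on {l..1} (X n)"
      and X: "\<And>y. y \<in> {l..1} \<Longrightarrow> maj (\<lambda>n. X n y) j" and x: "x \<in> {l..1}"
    have C0: "C > 0" using C MM by linarith
    have cm: "cms (\<lambda>n. 1 / \<kappa> n)" "cms j"
      unfolding \<kappa> j by (rule cms_C[OF C0 N])+
    have \<kappa>_eq: "\<kappa> = (\<lambda>n. (2 * C + N) + N * real n)" by (auto simp: \<kappa> algebra_simps)
    have A_pos: "2 * C + N > 0" using C0 N by simp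
    define w where "w = (\<lambda>y n. q y + \<nu> y * X n y)"
    define G where "G = (\<lambda>n. M / \<kappa> n * (M + M * j n))"
    have w: "maj (w y) (\<lambda>n. M + M * j n)" if "y \<in> {l..1}" for y
      unfolding w_def using that by (intro maj_cmult maj_add maj_const \<nu>M qM X)
    have cw: "continuous_on {l..1} (\<lambda>y. w y n)" for n
      unfolding w_def by (rule src[OF cX])
    have LR: "maj (\<lambda>n. Lf (\<kappa> n) (\<lambda>y. w y n) x) G" "maj (\<lambda>n. Rt (\<kappa> n) (\<lambda>y. w y n) x) G"
      if "x \<in> {l..1}" for x
      unfolding G_def using maj_Lf[OF \<kappa>_eq A_pos N w cw \<eta>M that] maj_Rt[OF \<kappa>_eq A_pos N w cw \<eta>M that] by simp_all
    have e: "cms (\<lambda>n. exp (- \<kappa> n * \<tau> x))"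
      unfolding \<kappa>_eq by (rule cms_exp[OF N \<tau>_nonneg[OF x]])
    \<comment> \<open>\<open>exp (- \<kappa> \<tau>)\<close> is not majorised by \<open>1\<close>: the division by \<open>\<kappa>\<close> is essential\<close>
    have e': "cms (\<lambda>n. (1 - exp (- \<kappa> n * \<tau> x)) * (1 / \<kappa> n))"
      unfolding \<kappa>_eq by (rule cms_one_minus_exp[OF A_pos N \<tau>_nonneg[OF x]])
    have "cms (\<lambda>n. M * (((1 - exp (- \<kappa> n * \<tau> x)) * (1 / \<kappa> n)) * (M + M * j n)))"
      using M by (intro cms_cmult cms_mult[OF e'] cms_add cms_const cm) auto
    then have "cms (\<lambda>n. G n - exp (- \<kappa> n * \<tau> x) * G n)"
      by (simp add: G_def algebra_simps diff_divide_distrib add_divide_distrib)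
    then have "maj (\<lambda>n. exp (- \<kappa> n * \<tau> x) * Lf (\<kappa> n) (\<lambda>y. w y n) 1) G"
      by (rule maj_trans[OF maj_mult[OF maj_self[OF e] LR(1)[OF one]]])
    then have "maj (\<lambda>n. opG q (\<kappa> n) (X n) x) (\<lambda>n. G n + G n + G n)"
      unfolding opG_def Let_def by (intro maj_diff LR[OF x, unfolded w_def]) (simp add: w_def)
    moreover have "cms (\<lambda>n. j n - (G n + G n + G n))"
    proof -
      have "j n - (G n + G n + G n) = (C - 3 * (M * M)) * (1 / \<kappa> n + 1 / \<kappa> n * j n)" for n
      proof -
        have "j n = C * (1 / \<kappa> n) + C * (1 / \<kappa> n * j n)" unfolding j \<kappa> by (rule majorant_eq[OF C0 N])
        then show ?thesis by (simp add: G_def algebra_simps add_divide_distrib)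
      qed
      then show ?thesis using C by (simp only:) (intro cms_add cms_cmult cms_mult cm, simp)
    qed
    ultimately show "maj (\<lambda>n. opG q (\<kappa> n) (X n) x) j" by (rule maj_trans)
  qed (rule MM)
qed

end

section \<open>From fixed points back to solutions of the second order equations\<close>

context medium
begin

text \<open>The fixed point equation means A' = - (2 \<kappa>/\<eta>) A + \<nu> B and B' = \<nu> A.
  Restoring the factor exp (- \<kappa> \<tau>) and solving for function and flux in terms of the
  invariants gives \<theta> and P = p \<theta>'.\<close>

lemma theta_solution:
  assumes \<kappa>: "\<kappa> > 0" and cA: "continuous_on {l..1} A"
    and A: "\<And>x. x \<in> {l..1} \<Longrightarrow> A x = opA \<kappa> A x"
  defines "B \<equiv> \<lambda>x. 1 - integral {x..1} (\<lambda>s. \<nu> s * A s)"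
  defines "\<theta> \<equiv> \<lambda>x. exp (- \<kappa> * \<tau> x) * (A x + B x) / (2 * \<kappa> * sqrt (\<eta> x))"
    and "P \<equiv> \<lambda>x. sqrt (\<eta> x) * exp (- \<kappa> * \<tau> x) * (B x - A x) / 2"
  assumes x: "x \<in> {l..1}"
  shows "(\<theta> has_real_derivative P x / p x) (at x within {l..1})"
    and "(P has_real_derivative \<kappa>\<^sup>2 * \<theta> x) (at x within {l..1})"
proof -
  have dA: "(A has_real_derivative - (2 * \<kappa> / \<eta> x) * A x + \<nu> x * B x) (at x within {l..1})"
  proof (rule has_field_derivative_transform_within[OF _ zero_less_one x])
    show "(opA \<kappa> A has_real_derivative - (2 * \<kappa> / \<eta> x) * A x + \<nu> x * B x) (at x within {l..1})"
      using dLf[OF opA_src[OF cA] x, of "2 * \<kappa>"] A[OF x] by (simp add: opA_def B_def)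
    show "opA \<kappa> A y = A y" if "y \<in> {l..1}" for y using A[OF that] by simp
  qed
  have dB: "(B has_real_derivative \<nu> x * A x) (at x within {l..1})"
    unfolding B_def by (rule derivative_eq_intros integral_right continuous_intros cont_\<nu> cA x refl)+ simp
  have \<eta>: "\<eta> x > 0" by (rule \<eta>_pos[OF x])
  define r where "r = sqrt (\<eta> x)"
  have r: "r > 0" "\<eta> x = r * r" "p x = r * r * (r * r)"
    using \<eta> \<eta>_square[OF x] by (auto simp: r_def)
  have ds: "((\<lambda>x. sqrt (\<eta> x)) has_real_derivative \<nu> x * sqrt (\<eta> x)) (at x within {l..1})"
  proof -
    have "((\<lambda>x. sqrt (\<eta> x)) has_real_derivative inverse (sqrt (\<eta> x)) / 2 * (2 * \<nu> x * \<eta> x)) (at x within {l..1})"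
      by (rule DERIV_chain2[OF DERIV_real_sqrt[OF \<eta>] d\<eta>[OF x]])
    moreover have "inverse (sqrt (\<eta> x)) / 2 * (2 * \<nu> x * \<eta> x) = \<nu> x * sqrt (\<eta> x)"
      using r by (simp add: r_def[symmetric])
    ultimately show ?thesis by (simp only:)
  qed
  have de: "((\<lambda>x. exp (- \<kappa> * \<tau> x)) has_real_derivative \<kappa> / \<eta> x * exp (- \<kappa> * \<tau> x)) (at x within {l..1})"
    by (rule derivative_eq_intros d\<tau>[OF x] refl)+ simp
  note [derivative_intros] = dA dB ds de
  show "(\<theta> has_real_derivative P x / p x) (at x within {l..1})"
    unfolding \<theta>_def P_def
    by (rule derivative_eq_intros refl)+
      (use r \<kappa> in \<open>simp_all add: r_def[symmetric] field_simps power2_eq_square\<close>)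
  show "(P has_real_derivative \<kappa>\<^sup>2 * \<theta> x) (at x within {l..1})"
    unfolding \<theta>_def P_def
    by (rule derivative_eq_intros refl)+
      (use r \<kappa> in \<open>simp_all add: r_def[symmetric] field_simps power2_eq_square\<close>)
qed

text \<open>The two invariants are \<open>a\<close> and \<open>b\<close> in the proof, with z = (a +
  b) / (2 \<kappa>) and g = b - a. The reflected term in \<open>b\<close> makes a + b vanish at 1,
  and \<eta> g / 2 is the flux p z'.\<close>

lemma z_solution:
  assumes \<kappa>: "\<kappa> > 0" and q: "continuous_on {l..1} q" and cg: "continuous_on {l..1} g"
    and g: "\<And>x. x \<in> {l..1} \<Longrightarrow> g x = opG q \<kappa> g x"
  obtains z where "z 1 = 0"
    and "\<And>x. x \<in> {l..1} \<Longrightarrow> (z has_real_derivative g x / (2 * \<eta> x)) (at x within {l..1})"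
    and "\<And>x. x \<in> {l..1} \<Longrightarrow>
      ((\<lambda>x. \<eta> x * g x / 2) has_real_derivative \<kappa>\<^sup>2 * z x - \<eta> x * q x) (at x within {l..1})"
proof -
  define w where "w = (\<lambda>y. q y + \<nu> y * g y)"
  have cw: "continuous_on {l..1} w"
    unfolding w_def by (intro continuous_intros q cont_\<nu> cg)
  define a where "a = Lf \<kappa> w"
  define b where "b = (\<lambda>x. Rt \<kappa> w x - exp (- \<kappa> * \<tau> x) * Lf \<kappa> w 1)"
  have gab: "g x = b x - a x" if "x \<in> {l..1}" for x
    unfolding a_def b_def using g[OF that] by (simp add: opG_def Let_def w_def)
  define z where "z = (\<lambda>x. (a x + b x) / (2 * \<kappa>))"
  have da: "(a has_real_derivative - (\<kappa> / \<eta> x) * a x + w x) (at x within {l..1})" if "x \<in> {l..1}" for x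
    unfolding a_def by (rule dLf[OF cw that])
  have db: "(b has_real_derivative (\<kappa> / \<eta> x) * b x - w x) (at x within {l..1})" if "x \<in> {l..1}" for x
    unfolding b_def
    by (rule derivative_eq_intros dRt[OF cw that] d\<tau>[OF that] refl)+ (simp add: algebra_simps)
  show ?thesis
  proof (rule that[of z])
    have "Rt \<kappa> w 1 = 0" by (simp add: Rt_def)
    then show "z 1 = 0" by (simp add: z_def a_def b_def \<tau>_1)
    fix x assume x: "x \<in> {l..1}"
    have \<eta>: "\<eta> x > 0" by (rule \<eta>_pos[OF x])
    note [derivative_intros] = da[OF x] db[OF x] d\<eta>[OF x]
    show "(z has_real_derivative g x / (2 * \<eta> x)) (at x within {l..1})"
      unfolding z_def gab[OF x]
      by (rule derivative_eq_intros refl)+ (use \<kappa> \<eta> in \<open>simp_all add: field_simps\<close>)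
    have "((\<lambda>x. \<eta> x * (b x - a x) / 2) has_real_derivative \<kappa>\<^sup>2 * z x - \<eta> x * q x) (at x within {l..1})"
      unfolding z_def
      by (rule derivative_eq_intros refl)+
        (use \<kappa> \<eta> in \<open>simp_all add: w_def gab[OF x] field_simps power2_eq_square\<close>)
    then show "((\<lambda>x. \<eta> x * g x / 2) has_real_derivative \<kappa>\<^sup>2 * z x - \<eta> x * q x) (at x within {l..1})"
      by (rule has_field_derivative_transform_within[OF _ zero_less_one x]) (simp add: gab)
  qed
qed

end

section \<open>Pairing solutions with test functions\<close>

lemma absolutely_integrable_continuous_mult:
  fixes h \<psi> :: "real \<Rightarrow> real"
  assumes "h absolutely_integrable_on {a..b}" "continuous_on {a..b} \<psi>"
  shows "(\<lambda>x. h x * \<psi> x) absolutely_integrable_on {a..b}"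
proof -
  have "(\<lambda>x. \<psi> x * h x) absolutely_integrable_on {a..b}"
  proof (rule absolutely_integrable_bounded_measurable_product_real)
    show "\<psi> \<in> borel_measurable (lebesgue_on {a..b})"
      by (rule continuous_imp_measurable_on_sets_lebesgue[OF assms(2)]) simp
    show "bounded (\<psi> ` {a..b})"
      by (intro compact_imp_bounded compact_continuous_image assms compact_Icc)
  qed (use assms in auto)
  then show ?thesis by (simp add: mult.commute)
qed

text \<open>\<open>F\<close> is only absolutely continuous, so the product rule may fail at
  individual points. Instead, the defect D of the formula as a function of the upper limit satisfies
  |D y - D x| <= 2 K |y - x| |H y - H x| with H the continuous integral of |h|. Hence D' = 0 at
  every point and D is constant.\<close>

lemma integral_by_parts_absolutely_continuous:
  fixes h F \<psi> \<psi>' :: "real \<Rightarrow> real"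
  assumes ab: "a \<le> b"
    and h: "h absolutely_integrable_on {a..b}"
    and F: "\<And>y. y \<in> {a..b} \<Longrightarrow> F y = F a + integral {a..y} h"
    and d\<psi>: "\<And>y. y \<in> {a..b} \<Longrightarrow> (\<psi> has_real_derivative \<psi>' y) (at y within {a..b})"
    and c\<psi>': "continuous_on {a..b} \<psi>'"
  shows "integral {a..b} (\<lambda>y. h y * \<psi> y) = F b * \<psi> b - F a * \<psi> a - integral {a..b} (\<lambda>y. F y * \<psi>' y)"
proof -
  have hi: "h integrable_on {a..b}" "(\<lambda>x. \<bar>h x\<bar>) integrable_on {a..b}"
    using h by (auto simp: absolutely_integrable_on_def)
  have c\<psi>: "continuous_on {a..b} \<psi>" by (rule DERIV_continuous_on[OF d\<psi>])
  have h\<psi>: "(\<lambda>y. h y * \<psi> y) integrable_on {a..b}"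
    using absolutely_integrable_continuous_mult[OF h c\<psi>] by (simp add: absolutely_integrable_on_def)
  have cF: "continuous_on {a..b} F"
    by (rule continuous_on_eq[OF _ F[symmetric]])
      (auto intro!: continuous_intros indefinite_integral_continuous_1 hi)
  obtain K where K0: "K \<ge> 1" and K: "\<And>x. x \<in> {a..b} \<Longrightarrow> \<bar>\<psi>' x\<bar> \<le> K"
    using continuous_on_Icc_bound[OF c\<psi>'] by blast
  define H where "H = (\<lambda>y. integral {a..y} (\<lambda>s. \<bar>h s\<bar>))"
  have cH: "continuous_on {a..b} H"
    unfolding H_def by (rule indefinite_integral_continuous_1[OF hi(2)])
  define D where "D = (\<lambda>y. integral {a..y} (\<lambda>s. h s * \<psi> s) - F y * \<psi> y + integral {a..y} (\<lambda>s. F s * \<psi>' s))"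
  have step: "\<bar>D y - D x\<bar> \<le> 2 * K * (y - x) * (H y - H x)" if xy: "a \<le> x" "x \<le> y" "y \<le> b" for x y
  proof -
    have sub: "{x..y} \<subseteq> {a..b}" using xy by auto
    have int: "f integrable_on {a..b} \<Longrightarrow> f integrable_on {x..y}" for f :: "real \<Rightarrow> real"
      by (rule integrable_on_subinterval[OF _ sub])
    have inc: "integral {a..y} f - integral {a..x} f = integral {x..y} f"
      if "f integrable_on {a..b}" for f :: "real \<Rightarrow> real"
    proof -
      have "integral {a..x} f + integral {x..y} f = integral {a..y} f"
        using that xy by (intro Henstock_Kurzweil_Integration.integral_combine)
          (auto elim!: integrable_on_subinterval)
      then show ?thesis by simp
    qed
    have F\<psi>: "(\<lambda>s. F s * \<psi>' s) integrable_on {a..b}"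
      by (intro integrable_continuous_real continuous_intros cF c\<psi>')
    have Finc: "F s - F x = integral {x..s} h" if "s \<in> {x..y}" for s
    proof -
      have "integral {a..x} h + integral {x..s} h = integral {a..s} h"
        using that xy hi(1) by (intro Henstock_Kurzweil_Integration.integral_combine)
          (auto elim!: integrable_on_subinterval)
      moreover have "F s = F a + integral {a..s} h" "F x = F a + integral {a..x} h"
        using that xy by (auto intro!: F)
      ultimately show ?thesis by linarith
    qed
    have V: "H y - H x = integral {x..y} (\<lambda>s. \<bar>h s\<bar>)"
      unfolding H_def by (rule inc[OF hi(2)])
    have Fb: "\<bar>F s - F x\<bar> \<le> H y - H x" if s: "s \<in> {x..y}" for s
    proof -
      have sub': "{x..s} \<subseteq> {a..b}" "{x..s} \<subseteq> {x..y}" using s xy by auto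
      have "norm (integral {x..s} h) \<le> integral {x..s} (\<lambda>s. \<bar>h s\<bar>)"
        using hi sub'(1) by (intro integral_norm_bound_integral integrable_on_subinterval[OF hi(1)]
          integrable_on_subinterval[OF hi(2)]) auto
      also have "\<dots> \<le> integral {x..y} (\<lambda>s. \<bar>h s\<bar>)"
        using sub' by (intro integral_subset_le int integrable_on_subinterval[OF hi(2)] hi) auto
      finally show ?thesis using Finc[OF s] V by simp
    qed
    have ch: "(\<lambda>s. h s * (\<psi> s - \<psi> y)) integrable_on {x..y}"
      unfolding right_diff_distrib by (intro integrable_diff integrable_on_mult_left int h\<psi> hi)
    have cf: "(\<lambda>s. (F s - F x) * \<psi>' s) integrable_on {x..y}"
      by (intro integrable_continuous_real continuous_intros continuous_on_subset[OF cF sub] continuous_on_subset[OF c\<psi>' sub])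
    have dc: "integral {x..y} \<psi>' = \<psi> y - \<psi> x"
      by (rule integral_unique, rule has_integral_real_derivative[OF xy(2)])
        (rule DERIV_subset[OF d\<psi> sub], use sub in blast)
    have "integral {x..y} (\<lambda>s. h s * (\<psi> s - \<psi> y)) = integral {x..y} (\<lambda>s. h s * \<psi> s) - (F y - F x) * \<psi> y"
      unfolding right_diff_distrib using xy Finc[of y]
      by (subst integral_diff) (auto intro!: integrable_on_mult_left int h\<psi> hi)
    moreover have "integral {x..y} (\<lambda>s. (F s - F x) * \<psi>' s) = integral {x..y} (\<lambda>s. F s * \<psi>' s) - F x * (\<psi> y - \<psi> x)"
      unfolding left_diff_distrib using dc
      by (subst integral_diff) (auto intro!: integrable_on_mult_right int[OF F\<psi>] int[OF integrable_continuous_real[OF c\<psi>']])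
    \<comment> \<open>Subtracting the constants \<open>\<psi> y\<close> and \<open>F x\<close>
      leaves integrands with one factor that is small on [x, y].\<close>
    ultimately have "D y - D x = integral {x..y} (\<lambda>s. h s * (\<psi> s - \<psi> y)) + integral {x..y} (\<lambda>s. (F s - F x) * \<psi>' s)"
      using inc[OF h\<psi>] inc[OF F\<psi>] unfolding D_def by (simp add: algebra_simps)
    moreover have "norm (integral {x..y} (\<lambda>s. h s * (\<psi> s - \<psi> y))) \<le> integral {x..y} (\<lambda>s. K * (y - x) * \<bar>h s\<bar>)"
    proof (rule integral_norm_bound_integral[OF ch])
      show "(\<lambda>s. K * (y - x) * \<bar>h s\<bar>) integrable_on {x..y}"
        by (intro integrable_on_mult_right int hi)
      show "norm (h s * (\<psi> s - \<psi> y)) \<le> K * (y - x) * \<bar>h s\<bar>" if s: "s \<in> {x..y}" for s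
      proof -
        have "norm (\<psi> s - \<psi> y) \<le> K * norm (s - y)"
          by (rule field_differentiable_bound[where S = "{a..b}" and f' = \<psi>', OF _ d\<psi>]) (use K s xy in auto)
        also have "\<dots> \<le> K * (y - x)" using s K0 by (intro mult_left_mono) auto
        finally show ?thesis
          using mult_right_mono[of "\<bar>\<psi> s - \<psi> y\<bar>" "K * (y - x)" "\<bar>h s\<bar>"] by (simp add: abs_mult mult.commute)
      qed
    qed
    moreover have "norm (integral {x..y} (\<lambda>s. (F s - F x) * \<psi>' s)) \<le> integral {x..y} (\<lambda>s. (H y - H x) * K)"
    proof (rule integral_norm_bound_integral[OF cf])
      show "norm ((F s - F x) * \<psi>' s) \<le> (H y - H x) * K" if "s \<in> {x..y}" for s
        using mult_mono[OF Fb[OF that], of "\<bar>\<psi>' s\<bar>" K] K that xy Fb[of x]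
        by (auto simp: abs_mult)
    qed auto
    moreover have "integral {x..y} (\<lambda>s. K * (y - x) * \<bar>h s\<bar>) = K * (y - x) * (H y - H x)"
      by (simp add: V)
    moreover have "integral {x..y} (\<lambda>s. (H y - H x) * K) = K * (y - x) * (H y - H x)"
      using xy by simp
    ultimately have "\<bar>D y - D x\<bar> \<le> K * (y - x) * (H y - H x) + K * (y - x) * (H y - H x)"
      unfolding real_norm_def by linarith
    then show ?thesis by simp
  qed
  have "\<exists>c. \<forall>x\<in>{a..b}. D x = c"
  proof (rule has_field_derivative_zero_constant)
    fix x assume x: "x \<in> {a..b}"
    have "((\<lambda>y. (D y - D x) / (y - x)) \<longlongrightarrow> 0) (at x within {a..b})"
    proof (rule Lim_null_comparison)
      show "\<forall>\<^sub>F y in at x within {a..b}. norm ((D y - D x) / (y - x)) \<le> 2 * K * \<bar>H y - H x\<bar>"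
        unfolding eventually_at_filter
      proof (intro always_eventually allI impI)
        fix y assume y: "y \<noteq> x" "y \<in> {a..b}"
        have "\<bar>D y - D x\<bar> \<le> 2 * K * \<bar>y - x\<bar> * \<bar>H y - H x\<bar>"
        proof (cases "x \<le> y")
          case True
          have "2 * K * (y - x) * (H y - H x) \<le> 2 * K * \<bar>y - x\<bar> * \<bar>H y - H x\<bar>"
            using K0 True by (simp add: mult_left_mono)
          then show ?thesis using step[of x y] True x y by simp
        next
          case False
          have "2 * K * (x - y) * (H x - H y) \<le> 2 * K * \<bar>y - x\<bar> * \<bar>H y - H x\<bar>"
            using K0 False mult_left_mono[OF abs_ge_self[of "H x - H y"], of "2 * K * (x - y)"]
            by (simp add: abs_minus_commute)
          then show ?thesis using step[of y x] False x y by (simp add: abs_minus_commute)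
        qed
        then show "norm ((D y - D x) / (y - x)) \<le> 2 * K * \<bar>H y - H x\<bar>"
          using y by (simp add: divide_simps mult_ac)
      qed
      have "(H \<longlongrightarrow> H x) (at x within {a..b})" using cH x by (auto simp: continuous_on_def)
      from tendsto_mult_left[OF tendsto_rabs_zero[OF LIM_zero[OF this]], of "2 * K"]
      show "((\<lambda>y. 2 * K * \<bar>H y - H x\<bar>) \<longlongrightarrow> 0) (at x within {a..b})" by simp
    qed
    then show "(D has_field_derivative 0) (at x within {a..b})"
      by (simp add: has_field_derivative_iff)
  qed simp
  then have "D b = D a" using ab by auto
  then show ?thesis using ab by (simp add: D_def)
qed

text \<open>The interval has length 1, so c is the mean of |k| and the inequality says that the
  variance is nonnegative.\<close>

lemma L1_le_L2:
  fixes k :: "real \<Rightarrow> real"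
  assumes k: "k absolutely_integrable_on {0..1}" "(\<lambda>x. (k x)\<^sup>2) integrable_on {0..1}"
  shows "integral {0..1} (\<lambda>x. \<bar>k x\<bar>) \<le> sqrt (integral {0..1} (\<lambda>x. (k x)\<^sup>2))"
proof -
  have ki: "(\<lambda>x. \<bar>k x\<bar>) integrable_on {0..1}" using k by (auto simp: absolutely_integrable_on_def)
  define c where "c = integral {0..1} (\<lambda>x. \<bar>k x\<bar>)"
  have "0 \<le> integral {0..1} (\<lambda>x. (\<bar>k x\<bar> - c)\<^sup>2)"
  proof (rule integral_nonneg)
    show "(\<lambda>x. (\<bar>k x\<bar> - c)\<^sup>2) integrable_on {0..1}"
      unfolding power2_diff power2_abs using k(2) ki
      by (intro integrable_add integrable_diff integrable_on_mult_right integrable_on_mult_left) auto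
  qed simp
  moreover have "integral {0..1} (\<lambda>x. (\<bar>k x\<bar> - c)\<^sup>2) = integral {0..1} (\<lambda>x. (k x)\<^sup>2) + c\<^sup>2 - 2 * c * c"
  proof (rule integral_unique)
    show "((\<lambda>x. (\<bar>k x\<bar> - c)\<^sup>2) has_integral (integral {0..1} (\<lambda>x. (k x)\<^sup>2) + c\<^sup>2 - 2 * c * c)) {0..1}"
    using has_integral_diff[OF has_integral_add[OF integrable_integral[OF k(2)] has_integral_const_real[of "c\<^sup>2" 0 1]]
        has_integral_mult_right[OF integrable_integral[OF ki], of "2 * c"]]
    by (simp add: power2_diff c_def mult_ac)
  qed
  ultimately have "c\<^sup>2 \<le> integral {0..1} (\<lambda>x. (k x)\<^sup>2)" by (simp add: power2_eq_square)
  then show ?thesis unfolding c_def by (rule real_le_rsqrt)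
qed

lemma abs_integral_le_L2:
  fixes k \<psi> :: "real \<Rightarrow> real"
  assumes k: "k absolutely_integrable_on {0..1}" "(\<lambda>x. (k x)\<^sup>2) integrable_on {0..1}"
    and l: "0 \<le> l" "l \<le> 1"
    and \<psi>: "continuous_on {l..1} \<psi>" "\<And>x. x \<in> {l..1} \<Longrightarrow> \<bar>\<psi> x\<bar> \<le> M"
  shows "\<bar>integral {l..1} (\<lambda>x. k x * \<psi> x)\<bar> \<le> M * integral {0..1} (\<lambda>x. \<bar>k x\<bar>)"
    and "\<bar>integral {l..1} (\<lambda>x. k x * \<psi> x)\<bar> \<le> M * sqrt (integral {0..1} (\<lambda>x. (k x)\<^sup>2))"
proof -
  have M: "M \<ge> 0" using \<psi>(2)[of l] l by fastforce
  have ki: "(\<lambda>x. \<bar>k x\<bar>) integrable_on {0..1}" using k by (auto simp: absolutely_integrable_on_def)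
  have sub: "{l..1} \<subseteq> {0..1}" using l by auto
  have kl: "k absolutely_integrable_on {l..1}" using absolutely_integrable_on_subinterval[OF k(1)] sub by blast
  have "norm (integral {l..1} (\<lambda>x. k x * \<psi> x)) \<le> integral {l..1} (\<lambda>x. M * \<bar>k x\<bar>)"
  proof (rule integral_norm_bound_integral)
    show "(\<lambda>x. k x * \<psi> x) integrable_on {l..1}"
      using absolutely_integrable_continuous_mult[OF kl \<psi>(1)] by (simp add: absolutely_integrable_on_def)
    show "(\<lambda>x. M * \<bar>k x\<bar>) integrable_on {l..1}"
      using kl by (intro integrable_on_mult_right) (simp add: absolutely_integrable_on_def)
    show "norm (k x * \<psi> x) \<le> M * \<bar>k x\<bar>" if "x \<in> {l..1}" for x
      using mult_right_mono[OF \<psi>(2)[OF that], of "\<bar>k x\<bar>"] by (simp add: abs_mult mult.commute)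
  qed
  also have "\<dots> = M * integral {l..1} (\<lambda>x. \<bar>k x\<bar>)" by simp
  also have "\<dots> \<le> M * integral {0..1} (\<lambda>x. \<bar>k x\<bar>)"
    using kl by (intro mult_left_mono integral_subset_le sub ki M) (auto simp: absolutely_integrable_on_def)
  finally show 1: "\<bar>integral {l..1} (\<lambda>x. k x * \<psi> x)\<bar> \<le> M * integral {0..1} (\<lambda>x. \<bar>k x\<bar>)" by simp
  then show "\<bar>integral {l..1} (\<lambda>x. k x * \<psi> x)\<bar> \<le> M * sqrt (integral {0..1} (\<lambda>x. (k x)\<^sup>2))"
    using mult_left_mono[OF L1_le_L2[OF k] M] by (rule order_trans)
qed

text \<open>\<open>\<xi> = p \<psi>'\<close> is the flux of the test function and \<open>\<rho>\<close> the defect caused by the cut-off.\<close>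

definition test_fun :: "(real \<Rightarrow> real) \<Rightarrow> real \<Rightarrow> real \<Rightarrow> (real \<Rightarrow> real) \<Rightarrow> (real \<Rightarrow> real) \<Rightarrow> (real \<Rightarrow> real) \<Rightarrow> bool" where
  "test_fun p l \<kappa> \<psi> \<xi> \<rho> \<longleftrightarrow>
     (\<forall>x\<in>{l..1}. (\<psi> has_real_derivative \<xi> x / p x) (at x within {l..1}) \<and>
        (\<xi> has_real_derivative \<kappa>\<^sup>2 * \<psi> x + \<rho> x) (at x within {l..1})) \<and>
     continuous_on {l..1} \<rho> \<and> \<psi> l = 0 \<and> \<xi> l = 0 \<and> \<psi> 1 = 1"

lemma test_fun_cont:
  assumes "test_fun p l \<kappa> \<psi> \<xi> \<rho>"
  shows "continuous_on {l..1} \<psi>" "continuous_on {l..1} \<xi>" "continuous_on {l..1} \<rho>"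
  using assms DERIV_continuous_on[of "{l..1}" \<psi> "\<lambda>x. \<xi> x / p x"]
    DERIV_continuous_on[of "{l..1}" \<xi> "\<lambda>x. \<kappa>\<^sup>2 * \<psi> x + \<rho> x"]
  by (auto simp: test_fun_def)

lemma in_domA_cont:
  assumes "in_domA a \<alpha> f F h"
  shows "continuous_on {0..1} f" "continuous_on {0..1} F"
proof -
  have "h integrable_on {0..1}" "(\<lambda>x. F x / (x powr \<alpha> * a x)) integrable_on {0..1}"
    using assms by (auto simp: in_domA_def absolutely_integrable_on_def)
  then have c: "continuous_on {0..1} (\<lambda>y. F 0 + integral {0..y} h)"
      "continuous_on {0..1} (\<lambda>y. integral {0..y} (\<lambda>x. F x / (x powr \<alpha> * a x)))"
    by (auto intro!: continuous_intros indefinite_integral_continuous_1)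
  have "\<And>y. y \<in> {0..1} \<Longrightarrow> F 0 + integral {0..y} h = F y"
      "\<And>y. y \<in> {0..1} \<Longrightarrow> integral {0..y} (\<lambda>x. F x / (x powr \<alpha> * a x)) = f y"
    using assms unfolding in_domA_def by metis+
  then show "continuous_on {0..1} f" "continuous_on {0..1} F"
    using c continuous_on_eq by blast+
qed

text \<open>Two integrations by parts. The conditions \<psi>(l) = \<xi>(l) = 0 remove the left end;
  f(1) = 0 and \<psi>(1) = 1 leave only the flux \<open>F 1\<close>, which the data
  determine.\<close>

lemma domA_test:
  assumes dom: "in_domA a \<alpha> f F h" and p: "p = (\<lambda>x. x powr \<alpha> * a x)"
    and l: "0 < l" "l < 1" and cp: "continuous_on {l..1} p" "\<And>x. x \<in> {l..1} \<Longrightarrow> p x > 0"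
    and test: "test_fun p l \<kappa> \<psi> \<xi> \<rho>"
  shows "integral {l..1} (\<lambda>x. h x * \<psi> x) = F 1 + integral {l..1} (\<lambda>x. f x * (\<kappa>\<^sup>2 * \<psi> x + \<rho> x))"
proof -
  have sub: "{l..1} \<subseteq> {0..1}" using l by auto
  note c = test_fun_cont[OF test]
  have shift: "G y = G l + integral {l..y} k"
    if "k absolutely_integrable_on {0..1}" "\<forall>y\<in>{0..1}. G y = G 0 + integral {0..y} k" "y \<in> {l..1}"
    for G k :: "real \<Rightarrow> real" and y
  proof -
    have "integral {0..l} k + integral {l..y} k = integral {0..y} k"
      using that l by (intro Henstock_Kurzweil_Integration.integral_combine)
        (auto simp: absolutely_integrable_on_def elim!: integrable_on_subinterval)
    moreover have "G y = G 0 + integral {0..y} k" "G l = G 0 + integral {0..l} k"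
      using that(3) l by (auto intro!: that(2)[rule_format])
    ultimately show ?thesis by linarith
  qed
  have h: "h absolutely_integrable_on {0..1}" "\<forall>y\<in>{0..1}. F y = F 0 + integral {0..y} h"
    and f: "(\<lambda>x. F x / p x) absolutely_integrable_on {0..1}"
      "\<forall>y\<in>{0..1}. f y = integral {0..y} (\<lambda>x. F x / p x)" "f 1 = 0"
    using dom unfolding in_domA_def p by blast+
  have "f 0 = 0" using f(2)[rule_format, of 0] by simp
  then have f': "\<forall>y\<in>{0..1}. f y = f 0 + integral {0..y} (\<lambda>x. F x / p x)" using f(2) by simp
  have "integral {l..1} (\<lambda>x. h x * \<psi> x) = F 1 * \<psi> 1 - F l * \<psi> l - integral {l..1} (\<lambda>x. F x * (\<xi> x / p x))"
  proof (rule integral_by_parts_absolutely_continuous[where h = h and F = F and \<psi> = \<psi> and \<psi>' = "\<lambda>x. \<xi> x / p x"])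
    show "h absolutely_integrable_on {l..1}" using absolutely_integrable_on_subinterval[OF h(1)] sub by blast
    show "continuous_on {l..1} (\<lambda>x. \<xi> x / p x)"
      using cp(2) by (intro continuous_on_divide c cp) force
    show "F y = F l + integral {l..y} h" if "y \<in> {l..1}" for y
      by (rule shift[OF h that])
    show "(\<psi> has_real_derivative \<xi> y / p y) (at y within {l..1})" if "y \<in> {l..1}" for y
      using test that by (simp add: test_fun_def)
  qed (use l in simp)
  moreover have "integral {l..1} (\<lambda>x. F x / p x * \<xi> x)
      = f 1 * \<xi> 1 - f l * \<xi> l - integral {l..1} (\<lambda>x. f x * (\<kappa>\<^sup>2 * \<psi> x + \<rho> x))"
  proof (rule integral_by_parts_absolutely_continuous[where h = "\<lambda>x. F x / p x" and F = f and \<psi> = \<xi>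
      and \<psi>' = "\<lambda>x. \<kappa>\<^sup>2 * \<psi> x + \<rho> x"])
    show "(\<lambda>x. F x / p x) absolutely_integrable_on {l..1}"
      using absolutely_integrable_on_subinterval[OF f(1)] sub by blast
    show "continuous_on {l..1} (\<lambda>x. \<kappa>\<^sup>2 * \<psi> x + \<rho> x)" by (intro continuous_intros c)
    show "f y = f l + integral {l..y} (\<lambda>x. F x / p x)" if "y \<in> {l..1}" for y
      by (rule shift[OF f(1) f' that])
    show "(\<xi> has_real_derivative \<kappa>\<^sup>2 * \<psi> y + \<rho> y) (at y within {l..1})" if "y \<in> {l..1}" for y
      using test that by (simp add: test_fun_def)
  qed (use l in simp)
  ultimately show ?thesis using test f(3) by (simp add: test_fun_def)
qed

lemma continuous_square_integrable:
  fixes k :: "real \<Rightarrow> real"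
  assumes "continuous_on {0..1} k"
  shows "k absolutely_integrable_on {0..1}" "(\<lambda>x. (k x)\<^sup>2) integrable_on {0..1}"
  using assms by (auto intro!: absolutely_integrable_continuous_real integrable_continuous_real continuous_intros)

text \<open>Differentiability in L2 is all that \<open>is_sol\<close> provides in time; integrating
  the error of the difference quotient against the bounded \<open>\<psi>\<close> turns it into an
  ordinary derivative.\<close>

lemma pairing_has_derivative:
  assumes dom: "in_domA a \<alpha> (\<lambda>x. u x t) F h"
    and lim: "((\<lambda>s. integral {0..1} (\<lambda>x. ((u x s - u x t) / (s - t) - h x)\<^sup>2)) \<longlongrightarrow> 0) (at t)"
    and t: "t > 0" and cu: "\<And>s. s > 0 \<Longrightarrow> continuous_on {0..1} (\<lambda>x. u x s)"
    and l: "0 \<le> l" "l \<le> 1" and c\<psi>: "continuous_on {l..1} \<psi>"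
  shows "((\<lambda>s. integral {l..1} (\<lambda>x. u x s * \<psi> x)) has_real_derivative integral {l..1} (\<lambda>x. h x * \<psi> x)) (at t)"
proof -
  have sub: "{l..1} \<subseteq> {0..1}" using l by auto
  have h: "h absolutely_integrable_on {0..1}" "(\<lambda>x. (h x)\<^sup>2) integrable_on {0..1}"
    using dom by (auto simp: in_domA_def L2_on_def)
  obtain M where M: "\<And>x. x \<in> {l..1} \<Longrightarrow> \<bar>\<psi> x\<bar> \<le> M"
    using continuous_on_Icc_bound[OF c\<psi>] by blast
  define J where "J = (\<lambda>s. integral {l..1} (\<lambda>x. u x s * \<psi> x))"
  define I where "I = (\<lambda>s. integral {0..1} (\<lambda>x. ((u x s - u x t) / (s - t) - h x)\<^sup>2))"
  have bound: "norm ((J s - J t) / (s - t) - integral {l..1} (\<lambda>x. h x * \<psi> x)) \<le> M * sqrt (I s)"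
    if s: "s > 0" "s \<noteq> t" for s
  proof -
    define v where "v = (\<lambda>x. (u x s - u x t) / (s - t))"
    have cv: "continuous_on {0..1} v"
      unfolding v_def using s by (intro continuous_intros cu t) auto
    note v = continuous_square_integrable[OF cv]
    have "(\<lambda>x. h x * v x) integrable_on {0..1}"
      using absolutely_integrable_continuous_mult[OF h(1) cv] by (simp add: absolutely_integrable_on_def)
    then have "(\<lambda>x. (v x)\<^sup>2 + (h x)\<^sup>2 - 2 * (h x * v x)) integrable_on {0..1}"
      by (intro integrable_diff integrable_add integrable_on_mult_right v h)
    then have k2: "(\<lambda>x. (v x - h x)\<^sup>2) integrable_on {0..1}"
      by (simp add: power2_diff mult_ac)
    have k1: "(\<lambda>x. v x - h x) absolutely_integrable_on {0..1}"
      by (intro set_integral_diff v h)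
    have "\<bar>integral {l..1} (\<lambda>x. (v x - h x) * \<psi> x)\<bar> \<le> M * sqrt (I s)"
      using abs_integral_le_L2(2)[OF k1 k2 l c\<psi>, of M] M unfolding I_def v_def by blast
    moreover have "integral {l..1} (\<lambda>x. (v x - h x) * \<psi> x)
        = (J s - J t) / (s - t) - integral {l..1} (\<lambda>x. h x * \<psi> x)"
    proof -
      have us: "(\<lambda>x. u x r * \<psi> x) integrable_on {l..1}" if "r > 0" for r
        by (intro integrable_continuous_real continuous_intros continuous_on_subset[OF cu[OF that] sub] c\<psi>)
      have hl: "h absolutely_integrable_on {l..1}"
        using absolutely_integrable_on_subinterval[OF h(1)] sub by blast
      have hs: "(\<lambda>x. h x * \<psi> x) integrable_on {l..1}"
        using absolutely_integrable_continuous_mult[OF hl c\<psi>] by (simp add: absolutely_integrable_on_def)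
      have "(\<lambda>x. (v x - h x) * \<psi> x) = (\<lambda>x. (u x s * \<psi> x - u x t * \<psi> x) / (s - t) - h x * \<psi> x)"
        by (auto simp: v_def left_diff_distrib diff_divide_distrib)
      then show ?thesis
        using us[OF s(1)] us[OF t] hs unfolding J_def
        by (simp add: integral_diff integrable_diff integrable_on_divide)
    qed
    ultimately show ?thesis by simp
  qed
  have "((\<lambda>s. (J s - J t) / (s - t) - integral {l..1} (\<lambda>x. h x * \<psi> x)) \<longlongrightarrow> 0) (at t)"
  proof (rule Lim_null_comparison)
    have "\<forall>\<^sub>F s in at t. s > 0"
      using order_tendstoD(1)[OF tendsto_ident_at t] .
    moreover have "\<forall>\<^sub>F s in at t. s \<noteq> t" by (simp add: eventually_at_filter)
    ultimately show "\<forall>\<^sub>F s in at t. norm ((J s - J t) / (s - t) - integral {l..1} (\<lambda>x. h x * \<psi> x)) \<le> M * sqrt (I s)"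
      by eventually_elim (rule bound)
    show "((\<lambda>s. M * sqrt (I s)) \<longlongrightarrow> 0) (at t)"
      using tendsto_mult_left[OF tendsto_real_sqrt[OF lim], of M] by (simp add: I_def)
  qed
  then show ?thesis unfolding J_def[symmetric] has_field_derivative_iff by (rule LIM_zero_cancel)
qed

lemma sol_cont:
  assumes "is_sol a \<alpha> u0 u" "s > 0"
  shows "continuous_on {0..1} (\<lambda>x. u x s)"
  using assms in_domA_cont(1) unfolding is_sol_def by blast

lemma sol_initial:
  assumes sol: "is_sol a \<alpha> u0 u" and c0: "continuous_on {0..1} u0"
    and l: "0 \<le> l" "l \<le> 1" and c\<psi>: "continuous_on {l..1} \<psi>"
  shows "((\<lambda>t. integral {l..1} (\<lambda>x. u x t * \<psi> x)) \<longlongrightarrow> integral {l..1} (\<lambda>x. u0 x * \<psi> x)) (at_right 0)"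
proof -
  have sub: "{l..1} \<subseteq> {0..1}" using l by auto
  obtain M where M: "\<And>x. x \<in> {l..1} \<Longrightarrow> \<bar>\<psi> x\<bar> \<le> M"
    using continuous_on_Icc_bound[OF c\<psi>] by blast
  define I where "I = (\<lambda>t. integral {0..1} (\<lambda>x. (u x t - u0 x)\<^sup>2))"
  have "((\<lambda>t. integral {l..1} (\<lambda>x. u x t * \<psi> x) - integral {l..1} (\<lambda>x. u0 x * \<psi> x)) \<longlongrightarrow> 0) (at_right 0)"
  proof (rule Lim_null_comparison)
    have "norm (integral {l..1} (\<lambda>x. u x t * \<psi> x) - integral {l..1} (\<lambda>x. u0 x * \<psi> x)) \<le> M * sqrt (I t)"
      if t: "t > 0" for t
    proof -
      note cu = sol_cont[OF sol t]
      have ck: "continuous_on {0..1} (\<lambda>x. u x t - u0 x)" by (intro continuous_intros cu c0)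
      have "integral {l..1} (\<lambda>x. u x t * \<psi> x) - integral {l..1} (\<lambda>x. u0 x * \<psi> x)
          = integral {l..1} (\<lambda>x. (u x t - u0 x) * \<psi> x)"
        unfolding left_diff_distrib
        by (rule integral_diff[symmetric]) (intro integrable_continuous_real continuous_intros c\<psi>
          continuous_on_subset[OF cu sub] continuous_on_subset[OF c0 sub])+
      then show ?thesis
        using abs_integral_le_L2(2)[OF continuous_square_integrable[OF ck] l c\<psi>, of M] M by (simp add: I_def)
    qed
    then show "\<forall>\<^sub>F t in at_right 0. norm (integral {l..1} (\<lambda>x. u x t * \<psi> x) - integral {l..1} (\<lambda>x. u0 x * \<psi> x)) \<le> M * sqrt (I t)"
      by (auto simp: eventually_at_filter)
    have "(I \<longlongrightarrow> 0) (at_right 0)" using sol by (simp add: is_sol_def I_def)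
    from tendsto_mult_left[OF tendsto_real_sqrt[OF this], of M]
    show "((\<lambda>t. M * sqrt (I t)) \<longlongrightarrow> 0) (at_right 0)" by simp
  qed
  then show ?thesis by (rule LIM_zero_cancel)
qed

text \<open>The bound stems from L2 convergence to the initial value, hence is claimed for small
  times, where the data are used.\<close>

lemma sol_L1_bound:
  assumes sol: "is_sol a \<alpha> u0 u" and c0: "continuous_on {0..1} u0"
  shows "\<exists>T>0. \<forall>t. 0 < t \<and> t < T \<longrightarrow> integral {0..1} (\<lambda>x. \<bar>u x t\<bar>) \<le> 1 + integral {0..1} (\<lambda>x. \<bar>u0 x\<bar>)"
proof -
  have "((\<lambda>t. integral {0..1} (\<lambda>x. (u x t - u0 x)\<^sup>2)) \<longlongrightarrow> 0) (at_right 0)"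
    using sol by (simp add: is_sol_def)
  then have "\<forall>\<^sub>F t in at_right 0. integral {0..1} (\<lambda>x. (u x t - u0 x)\<^sup>2) < 1"
    by (rule order_tendstoD) simp
  then obtain T where T: "T > 0" "\<And>t. 0 < t \<Longrightarrow> t < T \<Longrightarrow> integral {0..1} (\<lambda>x. (u x t - u0 x)\<^sup>2) < 1"
    by (auto simp: eventually_at_right_field)
  have "integral {0..1} (\<lambda>x. \<bar>u x t\<bar>) \<le> 1 + integral {0..1} (\<lambda>x. \<bar>u0 x\<bar>)" if t: "0 < t" "t < T" for t
  proof -
    note cu = sol_cont[OF sol t(1)]
    have ck: "continuous_on {0..1} (\<lambda>x. u x t - u0 x)" by (intro continuous_intros cu c0)
    have "integral {0..1} (\<lambda>x. \<bar>u x t\<bar>) \<le> integral {0..1} (\<lambda>x. \<bar>u x t - u0 x\<bar> + \<bar>u0 x\<bar>)"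
      by (rule integral_le) (auto intro!: integrable_continuous_real continuous_intros cu c0)
    also have "\<dots> = integral {0..1} (\<lambda>x. \<bar>u x t - u0 x\<bar>) + integral {0..1} (\<lambda>x. \<bar>u0 x\<bar>)"
      by (rule integral_add) (auto intro!: integrable_continuous_real continuous_intros cu c0)
    also have "integral {0..1} (\<lambda>x. \<bar>u x t - u0 x\<bar>) \<le> sqrt (integral {0..1} (\<lambda>x. (u x t - u0 x)\<^sup>2))"
      by (rule L1_le_L2[OF continuous_square_integrable[OF ck]])
    also have "\<dots> \<le> 1" using T(2)[OF t] by simp
    finally show ?thesis by simp
  qed
  then show ?thesis using T(1) by blast
qed

text \<open>Near 1 the quotient F/p is continuous, so f has the one-sided derivative F(1)/p(1)
  there. This converts the observed slope into a flux.\<close>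

lemma domA_boundary_derivative:
  assumes dom: "in_domA a \<alpha> f F h" and p: "p = (\<lambda>x. x powr \<alpha> * a x)"
    and l: "0 < l" "l < 1" and cp: "continuous_on {l..1} p" "\<And>x. x \<in> {l..1} \<Longrightarrow> p x > 0"
    and d: "(f has_real_derivative d) (at 1 within {0..1})"
  shows "F 1 = p 1 * d"
proof -
  have sub: "{l..1} \<subseteq> {0..1}" using l by auto
  have i: "(\<lambda>x. F x / p x) integrable_on {0..1}"
    using dom unfolding in_domA_def p absolutely_integrable_on_def by blast
  have fe: "f y = integral {0..y} (\<lambda>x. F x / p x)" if "y \<in> {0..1}" for y
    using dom that unfolding in_domA_def p by blast
  have c: "continuous_on {l..1} (\<lambda>x. F x / p x)"
    using cp(2) by (intro continuous_on_divide cp continuous_on_subset[OF in_domA_cont(2)[OF dom] sub]) force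
  have one: "1 \<in> {l..1}" using l by simp
  have "((\<lambda>y. integral {0..l} (\<lambda>x. F x / p x) + integral {l..y} (\<lambda>x. F x / p x)) has_real_derivative F 1 / p 1) (at 1 within {l..1})"
    by (rule derivative_eq_intros integral_has_real_derivative[OF c one] refl)+ simp
  then have "(f has_real_derivative F 1 / p 1) (at 1 within {l..1})"
  proof (rule has_field_derivative_transform_within[OF _ zero_less_one one])
    fix y assume y: "y \<in> {l..1}"
    have "integral {0..l} (\<lambda>x. F x / p x) + integral {l..y} (\<lambda>x. F x / p x) = integral {0..y} (\<lambda>x. F x / p x)"
      using y l i by (intro Henstock_Kurzweil_Integration.integral_combine) (auto elim!: integrable_on_subinterval)
    then show "integral {0..l} (\<lambda>x. F x / p x) + integral {l..y} (\<lambda>x. F x / p x) = f y"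
      using fe[of y] y l by simp
  qed
  moreover have "(f has_real_derivative d) (at 1 within {l..1})" by (rule DERIV_subset[OF d sub])
  moreover have "at (1::real) within {l..1} \<noteq> bot" using l by (simp add: trivial_limit_within)
  ultimately have "F 1 / p 1 = d"
    unfolding has_field_derivative_iff by (metis tendsto_unique)
  then show ?thesis using cp(2)[OF one] by (simp add: field_simps)
qed

section \<open>Test functions and the orthogonality identity\<close>

text \<open>The weight exp (- \<kappa>^2 t) cancels the term \<kappa>^2 \<integral> u \<psi> from
  \<open>domA_test\<close>. The fluxes cancel by equality of the slopes and of pa, pb at 1, so the
  derivative of the weighted difference contains the defects only. T and U are fixed before
  \<kappa>, which may therefore tend to infinity.\<close>

lemma data_estimate:
  fixes a b u0 :: "real \<Rightarrow> real"
  assumes sola: "is_sol a \<alpha> u0 ua" and solb: "is_sol b \<beta> u0 ub"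
    and c0: "continuous_on {0..1} u0" and l: "0 < l" "l < 1"
    and pa: "pa = (\<lambda>x. x powr \<alpha> * a x)" "continuous_on {l..1} pa" "\<And>x. x \<in> {l..1} \<Longrightarrow> pa x > 0"
    and pb: "pb = (\<lambda>x. x powr \<beta> * b x)" "continuous_on {l..1} pb" "\<And>x. x \<in> {l..1} \<Longrightarrow> pb x > 0"
    and p1: "pa 1 = pb 1"
    and t0: "t0 > 0" "\<forall>t\<in>{0<..<t0}. \<exists>d. ((\<lambda>x. ua x t) has_real_derivative d) (at 1 within {0..1}) \<and>
           ((\<lambda>x. ub x t) has_real_derivative d) (at 1 within {0..1})"
  shows "\<exists>T>0. \<exists>U\<ge>0. \<forall>\<kappa> \<psi>a \<xi>a \<rho>a \<psi>b \<xi>b \<rho>b M R. test_fun pa l \<kappa> \<psi>a \<xi>a \<rho>a \<longrightarrow> test_fun pb l \<kappa> \<psi>b \<xi>b \<rho>b \<longrightarrow>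
    (\<forall>x\<in>{l..1}. \<bar>\<psi>a x\<bar> \<le> M \<and> \<bar>\<psi>b x\<bar> \<le> M \<and> \<bar>\<rho>a x\<bar> \<le> R \<and> \<bar>\<rho>b x\<bar> \<le> R) \<longrightarrow>
    \<bar>integral {l..1} (\<lambda>x. u0 x * \<psi>a x) - integral {l..1} (\<lambda>x. u0 x * \<psi>b x)\<bar> \<le> U * (M * exp (- \<kappa>\<^sup>2 * T) + R)"
proof -
  define U0 where "U0 = 1 + integral {0..1} (\<lambda>x. \<bar>u0 x\<bar>)"
  obtain Ta where Ta: "Ta > 0" "\<And>t. 0 < t \<Longrightarrow> t < Ta \<Longrightarrow> integral {0..1} (\<lambda>x. \<bar>ua x t\<bar>) \<le> U0"
    using sol_L1_bound[OF sola c0] unfolding U0_def by blast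
  obtain Tb where Tb: "Tb > 0" "\<And>t. 0 < t \<Longrightarrow> t < Tb \<Longrightarrow> integral {0..1} (\<lambda>x. \<bar>ub x t\<bar>) \<le> U0"
    using sol_L1_bound[OF solb c0] unfolding U0_def by blast
  \<comment> \<open>Below t0 for the data and below Ta, Tb for the L1 bounds; halving makes the
    inequalities strict.\<close>
  define T where "T = Min {t0, Ta, Tb} / 2"
  have T: "T > 0" "T < t0" "T < Ta" "T < Tb"
    using t0(1) Ta(1) Tb(1) by (auto simp: T_def min_def)
  have U0: "U0 \<ge> 0"
    unfolding U0_def using c0 by (intro add_nonneg_nonneg integral_nonneg integrable_continuous_real continuous_intros) auto
  have l01: "0 \<le> l" "l \<le> 1" using l by auto
  have main: "\<bar>integral {l..1} (\<lambda>x. u0 x * \<psi>a x) - integral {l..1} (\<lambda>x. u0 x * \<psi>b x)\<bar>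
      \<le> (2 * U0 * (1 + T)) * (M * exp (- \<kappa>\<^sup>2 * T) + R)"
    if ta: "test_fun pa l \<kappa> \<psi>a \<xi>a \<rho>a" and tb: "test_fun pb l \<kappa> \<psi>b \<xi>b \<rho>b"
      and bd: "\<forall>x\<in>{l..1}. \<bar>\<psi>a x\<bar> \<le> M \<and> \<bar>\<psi>b x\<bar> \<le> M \<and> \<bar>\<rho>a x\<bar> \<le> R \<and> \<bar>\<rho>b x\<bar> \<le> R"
    for \<kappa> \<psi>a \<xi>a \<rho>a \<psi>b \<xi>b \<rho>b M R
  proof -
    note ca = test_fun_cont[OF ta] and cb = test_fun_cont[OF tb]
    have M0: "M \<ge> 0" "R \<ge> 0" using bd[rule_format, of 1] l by (auto intro: order_trans[OF abs_ge_zero])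
    define \<Psi> where "\<Psi> = (\<lambda>t. exp (- \<kappa>\<^sup>2 * t) * (integral {l..1} (\<lambda>x. ua x t * \<psi>a x) - integral {l..1} (\<lambda>x. ub x t * \<psi>b x)))"
    define \<Psi>' where "\<Psi>' = (\<lambda>t. exp (- \<kappa>\<^sup>2 * t) * (integral {l..1} (\<lambda>x. ua x t * \<rho>a x) - integral {l..1} (\<lambda>x. ub x t * \<rho>b x)))"
    have pair: "\<bar>integral {l..1} (\<lambda>x. u x t * \<psi> x)\<bar> \<le> K * U0"
      if t: "0 < t" and sol: "is_sol c \<gamma> u0 u" and i: "integral {0..1} (\<lambda>x. \<bar>u x t\<bar>) \<le> U0"
        and c: "continuous_on {l..1} \<psi>" "\<And>x. x \<in> {l..1} \<Longrightarrow> \<bar>\<psi> x\<bar> \<le> K" and K: "K \<ge> 0"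
      for t c \<gamma> u \<psi> K
      using abs_integral_le_L2(1)[OF continuous_square_integrable[OF sol_cont[OF sol t]] l01 c]
        mult_left_mono[OF i K] by linarith
    have d\<Psi>: "(\<Psi> has_real_derivative \<Psi>' t) (at t)" if t: "0 < t" "t < t0" for t
    proof -
      obtain d where d: "((\<lambda>x. ua x t) has_real_derivative d) (at 1 within {0..1})"
          "((\<lambda>x. ub x t) has_real_derivative d) (at 1 within {0..1})"
        using t0(2) t by force
      obtain Fa ha where a: "in_domA a \<alpha> (\<lambda>x. ua x t) Fa ha"
          "((\<lambda>s. integral {0..1} (\<lambda>x. ((ua x s - ua x t) / (s - t) - ha x)\<^sup>2)) \<longlongrightarrow> 0) (at t)"
        using sola t unfolding is_sol_def by blast
      obtain Fb hb where b: "in_domA b \<beta> (\<lambda>x. ub x t) Fb hb"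
          "((\<lambda>s. integral {0..1} (\<lambda>x. ((ub x s - ub x t) / (s - t) - hb x)\<^sup>2)) \<longlongrightarrow> 0) (at t)"
        using solb t unfolding is_sol_def by blast
      have F: "Fa 1 = Fb 1"
        using domA_boundary_derivative[OF a(1) pa(1) l pa(2,3) d(1)]
          domA_boundary_derivative[OF b(1) pb(1) l pb(2,3) d(2)] p1 by simp
      have split: "integral {l..1} (\<lambda>x. u x * (\<kappa>\<^sup>2 * \<psi> x + \<rho> x))
          = \<kappa>\<^sup>2 * integral {l..1} (\<lambda>x. u x * \<psi> x) + integral {l..1} (\<lambda>x. u x * \<rho> x)"
        if "continuous_on {0..1} u" "continuous_on {l..1} \<psi>" "continuous_on {l..1} \<rho>" for u \<psi> \<rho> :: "real \<Rightarrow> real"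
      proof -
        have cu: "continuous_on {l..1} u" by (rule continuous_on_subset[OF that(1)]) (use l in auto)
        have "(\<lambda>x. u x * (\<kappa>\<^sup>2 * \<psi> x + \<rho> x)) = (\<lambda>x. \<kappa>\<^sup>2 * (u x * \<psi> x) + u x * \<rho> x)"
          by (auto simp: algebra_simps)
        then show ?thesis
          by (simp only:) (subst integral_add, auto intro!: integrable_continuous_real continuous_intros cu that)
      qed
      note Ja = pairing_has_derivative[OF a t(1) sol_cont[OF sola] l01 ca(1)]
      note Jb = pairing_has_derivative[OF b t(1) sol_cont[OF solb] l01 cb(1)]
      have ea: "integral {l..1} (\<lambda>x. ha x * \<psi>a x)
          = Fa 1 + (\<kappa>\<^sup>2 * integral {l..1} (\<lambda>x. ua x t * \<psi>a x) + integral {l..1} (\<lambda>x. ua x t * \<rho>a x))"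
        using domA_test[OF a(1) pa(1) l pa(2,3) ta] split[OF sol_cont[OF sola t(1)] ca(1,3)] by simp
      have eb: "integral {l..1} (\<lambda>x. hb x * \<psi>b x)
          = Fb 1 + (\<kappa>\<^sup>2 * integral {l..1} (\<lambda>x. ub x t * \<psi>b x) + integral {l..1} (\<lambda>x. ub x t * \<rho>b x))"
        using domA_test[OF b(1) pb(1) l pb(2,3) tb] split[OF sol_cont[OF solb t(1)] cb(1,3)] by simp
      have de: "((\<lambda>t. exp (- \<kappa>\<^sup>2 * t)) has_real_derivative - \<kappa>\<^sup>2 * exp (- \<kappa>\<^sup>2 * t)) (at t)"
        by (auto intro!: derivative_eq_intros)
      have alg: "- k * e * (A - B) + ((G + (k * A + C)) - (G + (k * B + D))) * e = e * (C - D)"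
        for k e A B C D G :: real
        by (simp add: algebra_simps)
      show ?thesis
        unfolding \<Psi>_def by (rule DERIV_cong[OF DERIV_mult[OF de DERIV_diff[OF Ja Jb]]])
          (assumption+, unfold \<Psi>'_def ea eb F, rule alg)
    qed
    have \<Psi>': "\<bar>\<Psi>' t\<bar> \<le> 2 * U0 * R" if t: "0 < t" "t \<le> T" for t
    proof -
      have "\<bar>integral {l..1} (\<lambda>x. ua x t * \<rho>a x)\<bar> \<le> R * U0"
        by (rule pair[OF t(1) sola Ta(2) ca(3)]) (use t T bd M0 in auto)
      moreover have "\<bar>integral {l..1} (\<lambda>x. ub x t * \<rho>b x)\<bar> \<le> R * U0"
        by (rule pair[OF t(1) solb Tb(2) cb(3)]) (use t T bd M0 in auto)
      moreover have "2 * U0 * R = R * U0 + R * U0" by simp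
      ultimately have "\<bar>integral {l..1} (\<lambda>x. ua x t * \<rho>a x) - integral {l..1} (\<lambda>x. ub x t * \<rho>b x)\<bar> \<le> 2 * U0 * R"
        by linarith
      moreover have "exp (- \<kappa>\<^sup>2 * t) \<le> 1" using t by simp
      ultimately show ?thesis
        unfolding \<Psi>'_def abs_mult using mult_mono[of "exp (- \<kappa>\<^sup>2 * t)" 1] by fastforce
    qed
    have \<Psi>T: "\<bar>\<Psi> T\<bar> \<le> exp (- \<kappa>\<^sup>2 * T) * (2 * U0 * M)"
    proof -
      have "\<bar>integral {l..1} (\<lambda>x. ua x T * \<psi>a x)\<bar> \<le> M * U0"
        by (rule pair[OF T(1) sola Ta(2) ca(1)]) (use T bd M0 in auto)
      moreover have "\<bar>integral {l..1} (\<lambda>x. ub x T * \<psi>b x)\<bar> \<le> M * U0"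
        by (rule pair[OF T(1) solb Tb(2) cb(1)]) (use T bd M0 in auto)
      moreover have "2 * U0 * M = M * U0 + M * U0" by simp
      ultimately have "\<bar>integral {l..1} (\<lambda>x. ua x T * \<psi>a x) - integral {l..1} (\<lambda>x. ub x T * \<psi>b x)\<bar> \<le> 2 * U0 * M"
        by linarith
      then show ?thesis unfolding \<Psi>_def abs_mult by simp
    qed
    define L where "L = integral {l..1} (\<lambda>x. u0 x * \<psi>a x) - integral {l..1} (\<lambda>x. u0 x * \<psi>b x)"
    \<comment> \<open>\<open>\<Psi>\<close> is differentiable for t > 0 only, so the initial pairing
      enters as a limit and the mean value estimate is applied on [t, T] with t tending to
      0.\<close>
    have "(\<Psi> \<longlongrightarrow> exp (- \<kappa>\<^sup>2 * 0) * L) (at_right 0)"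
      unfolding \<Psi>_def L_def
      by (intro tendsto_intros sol_initial[OF sola c0 l01 ca(1)] sol_initial[OF solb c0 l01 cb(1)])
    then have "((\<lambda>t. \<bar>\<Psi> t\<bar>) \<longlongrightarrow> \<bar>L\<bar>) (at_right 0)"
      using tendsto_rabs by fastforce
    moreover have "\<forall>\<^sub>F t in at_right 0. \<bar>\<Psi> t\<bar> \<le> \<bar>\<Psi> T\<bar> + 2 * U0 * R * T"
      unfolding eventually_at_right_field
    proof (intro exI[of _ T] conjI allI impI T)
      fix t assume t: "0 < t" "t < T"
      have "norm (\<Psi> t - \<Psi> T) \<le> (2 * U0 * R) * norm (t - T)"
      proof (rule field_differentiable_bound[where S = "{t..T}" and f' = \<Psi>'])
        show "(\<Psi> has_real_derivative \<Psi>' s) (at s within {t..T})" if "s \<in> {t..T}" for s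
          using d\<Psi>[of s] that t T by (auto intro: has_field_derivative_at_within)
        show "norm (\<Psi>' s) \<le> 2 * U0 * R" if "s \<in> {t..T}" for s
          using \<Psi>'[of s] that t by auto
      qed (use t in auto)
      also have "\<dots> \<le> 2 * U0 * R * T" using t U0 M0 by (intro mult_left_mono) auto
      finally show "\<bar>\<Psi> t\<bar> \<le> \<bar>\<Psi> T\<bar> + 2 * U0 * R * T" by simp
    qed
    ultimately have "\<bar>L\<bar> \<le> \<bar>\<Psi> T\<bar> + 2 * U0 * R * T"
      by (intro tendsto_upperbound) auto
    also have "\<dots> \<le> 2 * U0 * (M * exp (- \<kappa>\<^sup>2 * T)) + 2 * U0 * T * R"
      using \<Psi>T by (simp add: algebra_simps)
    also have "\<dots> \<le> (2 * U0 * (1 + T)) * (M * exp (- \<kappa>\<^sup>2 * T)) + (2 * U0 * (1 + T)) * R"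
    proof -
      have "2 * U0 * 1 \<le> 2 * U0 * (1 + T)" "2 * U0 * T \<le> 2 * U0 * (1 + T)"
        using U0 T(1) by (intro mult_left_mono; simp)+
      then show ?thesis using M0 by (intro add_mono mult_right_mono) auto
    qed
    finally show ?thesis unfolding L_def by (simp add: distrib_left)
  qed
  show ?thesis
    by (intro exI[of _ T] exI[of _ "2 * U0 * (1 + T)"] conjI allI impI main T) (use U0 T in auto)
qed

text \<open>Integrate the derivative of V \<xi> - pb V' \<psi>. For either test function the
  boundary terms reduce to - pb(1) V'(1), since V(1) = 0, \<psi>(1) = 1 and everything vanishes at
  l. Subtracting the two instances removes this unknown, and the instance with coefficient pb
  contributes no product term.\<close>

lemma orthogonality_identity:
  assumes l: "l < 1"
    and ta: "test_fun pa l \<kappa> \<psi>a \<xi>a \<rho>a" and tb: "test_fun pb l \<kappa> \<psi>b \<xi>b \<rho>b"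
    and p: "\<And>x. x \<in> {l..1} \<Longrightarrow> pa x > 0" "\<And>x. x \<in> {l..1} \<Longrightarrow> pb x > 0"
    and cp: "continuous_on {l..1} pa" "continuous_on {l..1} pb"
    and cu: "continuous_on {l..1} u0" and cV': "continuous_on {l..1} V'"
    and V: "\<And>x. x \<in> {l..1} \<Longrightarrow> (V has_real_derivative V' x) (at x within {l..1})" "V 1 = 0"
    and Y: "\<And>x. x \<in> {l..1} \<Longrightarrow> ((\<lambda>x. pb x * V' x) has_real_derivative \<kappa>\<^sup>2 * (V x - u0 x)) (at x within {l..1})"
  shows "integral {l..1} (\<lambda>x. (pa x - pb x) * V' x * (\<xi>a x / pa x))
     = - \<kappa>\<^sup>2 * (integral {l..1} (\<lambda>x. u0 x * \<psi>a x) - integral {l..1} (\<lambda>x. u0 x * \<psi>b x))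
       - integral {l..1} (\<lambda>x. V x * \<rho>a x) + integral {l..1} (\<lambda>x. V x * \<rho>b x)"
proof -
  have cV: "continuous_on {l..1} V" by (rule DERIV_continuous_on[OF V(1)])
  have eq: "integral {l..1} (\<lambda>x. (q x - pb x) * V' x * (\<xi> x / q x)) + integral {l..1} (\<lambda>x. V x * \<rho> x)
      + \<kappa>\<^sup>2 * integral {l..1} (\<lambda>x. u0 x * \<psi> x) = - (pb 1 * V' 1)"
    if t: "test_fun q l \<kappa> \<psi> \<xi> \<rho>" and q: "\<And>x. x \<in> {l..1} \<Longrightarrow> q x > 0" "continuous_on {l..1} q" for q \<psi> \<xi> \<rho>
  proof -
    note c = test_fun_cont[OF t]
    let ?D = "\<lambda>x. (q x - pb x) * V' x * (\<xi> x / q x) + V x * \<rho> x + \<kappa>\<^sup>2 * (u0 x * \<psi> x)"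
    have "(?D has_integral (V 1 * \<xi> 1 - pb 1 * V' 1 * \<psi> 1) - (V l * \<xi> l - pb l * V' l * \<psi> l)) {l..1}"
    proof (rule has_integral_real_derivative)
      fix x assume x: "x \<in> {l..1}"
      have d: "(\<psi> has_real_derivative \<xi> x / q x) (at x within {l..1})"
          "(\<xi> has_real_derivative \<kappa>\<^sup>2 * \<psi> x + \<rho> x) (at x within {l..1})"
        using t x by (auto simp: test_fun_def)
      show "((\<lambda>x. V x * \<xi> x - pb x * V' x * \<psi> x) has_real_derivative ?D x) (at x within {l..1})"
        by (rule derivative_eq_intros V(1)[OF x] Y[OF x] d refl)+
          (use q(1)[OF x] in \<open>simp add: field_simps\<close>)
    qed (use l in simp)
    then have "integral {l..1} ?D = - (pb 1 * V' 1)"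
      using t V(2) by (simp add: test_fun_def integral_unique)
    moreover have "integral {l..1} ?D = integral {l..1} (\<lambda>x. (q x - pb x) * V' x * (\<xi> x / q x)) + integral {l..1} (\<lambda>x. V x * \<rho> x)
      + \<kappa>\<^sup>2 * integral {l..1} (\<lambda>x. u0 x * \<psi> x)"
    proof -
      have 1: "(\<lambda>x. (q x - pb x) * V' x * (\<xi> x / q x)) integrable_on {l..1}"
        by (intro integrable_continuous_real continuous_intros q(2) cp cV' c) (use q(1) in force)
      have 2: "(\<lambda>x. V x * \<rho> x) integrable_on {l..1}"
        by (intro integrable_continuous_real continuous_intros cV c)
      have 3: "(\<lambda>x. \<kappa>\<^sup>2 * (u0 x * \<psi> x)) integrable_on {l..1}"
        by (intro integrable_continuous_real continuous_intros cu c)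
      show ?thesis
        unfolding integral_add[OF integrable_add[OF 1 2] 3] integral_add[OF 1 2] by simp
    qed
    ultimately show ?thesis by simp
  qed
  have "integral {l..1} (\<lambda>x. (pb x - pb x) * V' x * (\<xi>b x / pb x)) = 0" by simp
  then show ?thesis
    using eq[OF ta p(1) cp(1)] eq[OF tb p(2) cp(2)] by (simp add: algebra_simps)
qed

section \<open>Cut-off solutions concentrated near the right end\<close>

lemma max_0_power2_deriv:
  "((\<lambda>t::real. (max 0 t)\<^sup>2) has_real_derivative 2 * max 0 t) (at t)"
proof -
  consider "t > 0" | "t < 0" | "t = 0" by linarith
  then show ?thesis
  proof cases
    case 1
    have "((\<lambda>t::real. t\<^sup>2) has_real_derivative 2 * max 0 t) (at t)"
      using 1 by (auto intro!: derivative_eq_intros)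
    then show ?thesis
      by (rule has_field_derivative_transform_within_open[where S = "{0<..}"]) (use 1 in auto)
  next
    case 2
    have "((\<lambda>t::real. 0) has_real_derivative 2 * max 0 t) (at t)"
      using 2 by simp
    then show ?thesis
      by (rule has_field_derivative_transform_within_open[where S = "{..<0}"]) (use 2 in auto)
  next
    case 3
    have "((\<lambda>y::real. max 0 y) \<longlongrightarrow> 0) (at 0)"
      using tendsto_max[OF tendsto_const[of "0::real"] tendsto_ident_at, of 0 UNIV] by simp
    then have "((\<lambda>y::real. ((max 0 y)\<^sup>2 - (max 0 0)\<^sup>2) / (y - 0)) \<longlongrightarrow> 0) (at 0)"
      by (rule Lim_transform_eventually)
        (auto simp: eventually_at_filter max_def power2_eq_square)
    then show ?thesis using 3 by (simp add: has_field_derivative_iff)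
  qed
qed

text \<open>Take 1 minus the cube of the positive part of 1 - s^2, where s runs from 0 to 1 on
  [l, m]. Being even in s it is flat at l, and the cube makes it twice continuously differentiable
  at m.\<close>

lemma cutoff_exists:
  assumes "l < m"
  obtains \<phi> \<phi>' \<phi>'' :: "real \<Rightarrow> real"
  where "\<And>x. (\<phi> has_real_derivative \<phi>' x) (at x)" "\<And>x. (\<phi>' has_real_derivative \<phi>'' x) (at x)"
    and "continuous_on UNIV \<phi>''" "\<phi> l = 0" "\<phi>' l = 0"
    and "\<And>x. m \<le> x \<Longrightarrow> \<phi> x = 1" "\<And>x. m \<le> x \<Longrightarrow> \<phi>' x = 0" "\<And>x. m \<le> x \<Longrightarrow> \<phi>'' x = 0"
proof -
  define c where "c = 1 / (m - l)"
  define s where "s = (\<lambda>x. c * (x - l))"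
  have s1: "1 - (s x)\<^sup>2 \<le> 0" if "m \<le> x" for x
  proof -
    have "s x \<ge> 1" using that assms by (simp add: s_def c_def)
    then show ?thesis by simp
  qed
  have sl: "s l = 0" by (simp add: s_def)
  have ds: "(s has_real_derivative c) (at x)" for x
    unfolding s_def by (auto intro!: derivative_eq_intros)
  have d2: "((\<lambda>x. (max 0 (1 - (s x)\<^sup>2))\<^sup>2) has_real_derivative 2 * max 0 (1 - (s x)\<^sup>2) * (- (2 * s x * c))) (at x)" for x
    by (rule DERIV_chain2[OF max_0_power2_deriv]) (auto intro!: derivative_eq_intros ds)
  \<comment> \<open>The cube is written as the squared positive part times 1 - s^2, so that only the
    derivative of the squared positive part has to be known.\<close>
  define \<phi> where "\<phi> = (\<lambda>x. 1 - (max 0 (1 - (s x)\<^sup>2))\<^sup>2 * (1 - (s x)\<^sup>2))"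
  define \<phi>' where "\<phi>' = (\<lambda>x. 6 * c * s x * (max 0 (1 - (s x)\<^sup>2))\<^sup>2)"
  define \<phi>'' where "\<phi>'' = (\<lambda>x. 6 * c * c * (max 0 (1 - (s x)\<^sup>2))\<^sup>2 - 24 * c * c * (s x)\<^sup>2 * max 0 (1 - (s x)\<^sup>2))"
  have m: "max 0 r * r = (max 0 r)\<^sup>2" for r :: real by (simp add: max_def power2_eq_square)
  show ?thesis
  proof (rule that[of \<phi> \<phi>' \<phi>''])
    fix x
    have dq: "((\<lambda>x. 1 - (s x)\<^sup>2) has_real_derivative - (2 * s x * c)) (at x)"
      by (auto intro!: derivative_eq_intros ds)
    have dcs: "((\<lambda>x. 6 * c * s x) has_real_derivative 6 * c * c) (at x)"
      by (auto intro!: derivative_eq_intros ds)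
    have "2 * max 0 (1 - (s x)\<^sup>2) * (- (2 * s x * c)) * (1 - (s x)\<^sup>2)
        = 2 * (- (2 * s x * c)) * (max 0 (1 - (s x)\<^sup>2) * (1 - (s x)\<^sup>2))" by (simp only: mult_ac)
    then have "2 * max 0 (1 - (s x)\<^sup>2) * (- (2 * s x * c)) * (1 - (s x)\<^sup>2)
        = 2 * (- (2 * s x * c)) * (max 0 (1 - (s x)\<^sup>2))\<^sup>2" by (simp only: m)
    then have e: "0 - (2 * max 0 (1 - (s x)\<^sup>2) * (- (2 * s x * c)) * (1 - (s x)\<^sup>2)
        + - (2 * s x * c) * (max 0 (1 - (s x)\<^sup>2))\<^sup>2) = \<phi>' x"
      by (simp add: \<phi>'_def)
    show "(\<phi> has_real_derivative \<phi>' x) (at x)"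
      unfolding \<phi>_def by (rule DERIV_cong[OF DERIV_diff[OF DERIV_const DERIV_mult[OF d2 dq]] e])
    show "(\<phi>' has_real_derivative \<phi>'' x) (at x)"
      unfolding \<phi>'_def
      by (rule DERIV_cong[OF DERIV_mult[OF dcs d2]]) (simp add: \<phi>''_def algebra_simps power2_eq_square)
  next
    show "continuous_on UNIV \<phi>''" unfolding \<phi>''_def s_def by (intro continuous_intros)
  qed (use s1 in \<open>auto simp: \<phi>_def \<phi>'_def \<phi>''_def sl max_absorb1\<close>)
qed

context medium
begin

text \<open>Left of m only size matters, and everything carries exp (- \<kappa> \<tau>(m)); on
  [m, 1] the flux is that of an exact solution. The lower bound on the amplitude \<open>c\<close>
  permits division by it.\<close>

definition concentrated_test ::
    "real \<Rightarrow> real \<Rightarrow> real \<Rightarrow> (real \<Rightarrow> real) \<Rightarrow> (real \<Rightarrow> real) \<Rightarrow> (real \<Rightarrow> real) \<Rightarrow> (real \<Rightarrow> real) \<Rightarrow> real \<Rightarrow> bool" where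
  "concentrated_test m K \<kappa> A \<psi> \<xi> \<rho> c \<longleftrightarrow> test_fun p l \<kappa> \<psi> \<xi> \<rho> \<and>
     (\<forall>x\<in>{l..1}. \<bar>\<psi> x\<bar> \<le> K \<and> \<bar>\<rho> x\<bar> \<le> K * \<kappa> * exp (- \<kappa> * \<tau> m)) \<and>
     (\<forall>x\<in>{l..m}. \<bar>\<xi> x\<bar> \<le> K * \<kappa> * exp (- \<kappa> * \<tau> m)) \<and> c \<ge> 1 / K \<and>
     (\<forall>x\<in>{m..1}. \<xi> x = c * (sqrt (\<eta> x) * exp (- \<kappa> * \<tau> x) * (1 - integral {x..1} (\<lambda>s. \<nu> s * A s) - A x)))"

text \<open>\<open>K\<close> is chosen before \<kappa>. The terms caused by the cut-off live on
  [l, m], where exp (- \<kappa> \<tau>) is at most its value at m.\<close>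

lemma concentrated_test_exists:
  assumes m: "l < m" "m < 1"
  shows "\<exists>K>0. \<forall>\<kappa> A. \<kappa> \<ge> 1 \<longrightarrow> continuous_on {l..1} A \<longrightarrow> (\<forall>x\<in>{l..1}. A x = opA \<kappa> A x) \<longrightarrow>
    (\<forall>x\<in>{l..1}. \<bar>A x\<bar> \<le> 1 / 2) \<longrightarrow> (\<exists>\<psi> \<xi> \<rho> c. concentrated_test m K \<kappa> A \<psi> \<xi> \<rho> c)"
proof -
  obtain \<phi> \<phi>' \<phi>'' :: "real \<Rightarrow> real"
    where d\<phi>: "\<And>x. (\<phi> has_real_derivative \<phi>' x) (at x)" and d\<phi>': "\<And>x. (\<phi>' has_real_derivative \<phi>'' x) (at x)"
      and c\<phi>'': "continuous_on UNIV \<phi>''" and \<phi>l: "\<phi> l = 0" "\<phi>' l = 0"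
      and \<phi>1: "\<And>x. m \<le> x \<Longrightarrow> \<phi> x = 1" "\<And>x. m \<le> x \<Longrightarrow> \<phi>' x = 0" "\<And>x. m \<le> x \<Longrightarrow> \<phi>'' x = 0"
    using cutoff_exists[OF m(1)] by blast
  have c\<phi>: "continuous_on {l..1} \<phi>" "continuous_on {l..1} \<phi>'" "continuous_on {l..1} \<phi>''"
    using c\<phi>'' by (auto intro: DERIV_continuous_on has_field_derivative_at_within d\<phi> d\<phi>' continuous_on_subset)
  have "continuous_on {l..1} (\<lambda>x. 1 / sqrt (\<eta> x))"
    by (intro continuous_on_divide continuous_on_const continuous_on_real_sqrt cont_\<eta>) (use \<eta>_pos in force)
  moreover have "continuous_on {l..1} (\<lambda>x. sqrt (\<eta> x))" by (intro continuous_on_real_sqrt cont_\<eta>)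
  ultimately have "\<exists>M\<ge>1. \<forall>f\<in>{\<phi>, \<phi>', \<phi>'', p, p', \<nu>, \<lambda>x. sqrt (\<eta> x), \<lambda>x. 1 / sqrt (\<eta> x)}. \<forall>x\<in>{l..1}. \<bar>f x\<bar> \<le> M"
    using c\<phi> cont_p cont_p' cont_\<nu> by (intro continuous_on_Icc_common_bound) simp_all
  then obtain M where M: "M \<ge> 1" and bd:
    "\<forall>f\<in>{\<phi>, \<phi>', \<phi>'', p, p', \<nu>, \<lambda>x. sqrt (\<eta> x), \<lambda>x. 1 / sqrt (\<eta> x)}. \<forall>x\<in>{l..1}. \<bar>f x\<bar> \<le> M"
    by blast
  have \<phi>M: "\<bar>\<phi> x\<bar> \<le> M" "\<bar>\<phi>' x\<bar> \<le> M" "\<bar>\<phi>'' x\<bar> \<le> M" and pM: "\<bar>p x\<bar> \<le> M" "\<bar>p' x\<bar> \<le> M" and \<nu>M: "\<bar>\<nu> x\<bar> \<le> M"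
    and rM: "\<bar>sqrt (\<eta> x)\<bar> \<le> M" "\<bar>1 / sqrt (\<eta> x)\<bar> \<le> M" if "x \<in> {l..1}" for x
    using bd that by simp_all
  \<comment> \<open>Collects the bound 4 \<kappa> M on the normalisation N, the bound 2 + M on |A +
    B| and |B - A|, and M for \<open>sqrt (\<eta> x)\<close> and its reciprocal.\<close>
  define Q where "Q = 4 * M * (2 + M) * M * M"
  have Q: "4 * M \<le> Q" "Q \<ge> 1" "Q > 0"
  proof -
    have "4 * M * 1 * 1 * 1 \<le> 4 * M * (2 + M) * M * M" using M by (intro mult_mono) auto
    then show "4 * M \<le> Q" by (simp add: Q_def)
    then show "Q \<ge> 1" "Q > 0" using M by linarith+
  qed
  \<comment> \<open>The 4 is there because \<rho> is a sum of four products, the one with factor 2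
    counted twice; each is at most a quarter of K \<kappa> exp (- \<kappa> \<tau>).\<close>
  define K where "K = 4 * Q * M * M"
  have K: "Q * M * 4 \<le> K" "Q * (M * M) * 4 \<le> K" "K > 0"
  proof -
    have "Q * M * 4 * 1 \<le> Q * M * 4 * M" using M Q by (intro mult_left_mono) auto
    then show "Q * M * 4 \<le> K" by (simp add: K_def mult_ac)
    show "Q * (M * M) * 4 \<le> K" by (simp add: K_def mult_ac)
    show "K > 0" using M Q by (simp add: K_def)
  qed
  have one: "1 \<in> {l..1}" using l by simp
  have main: "\<exists>\<psi> \<xi> \<rho> c. concentrated_test m K \<kappa> A \<psi> \<xi> \<rho> c"
    if \<kappa>: "\<kappa> \<ge> 1" and cA: "continuous_on {l..1} A" and A: "\<forall>x\<in>{l..1}. A x = opA \<kappa> A x"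
      and Ab: "\<forall>x\<in>{l..1}. \<bar>A x\<bar> \<le> 1 / 2" for \<kappa> A
  proof -
    have \<kappa>0: "\<kappa> > 0" using \<kappa> by simp
    define B where "B = (\<lambda>x. 1 - integral {x..1} (\<lambda>s. \<nu> s * A s))"
    define \<theta> where "\<theta> = (\<lambda>x. exp (- \<kappa> * \<tau> x) * (A x + B x) / (2 * \<kappa> * sqrt (\<eta> x)))"
    define P where "P = (\<lambda>x. sqrt (\<eta> x) * exp (- \<kappa> * \<tau> x) * (B x - A x) / 2)"
    have d\<theta>: "(\<theta> has_real_derivative P x / p x) (at x within {l..1})"
      and dP: "(P has_real_derivative \<kappa>\<^sup>2 * \<theta> x) (at x within {l..1})" if "x \<in> {l..1}" for x
      using theta_solution[OF \<kappa>0 cA _ that] A unfolding \<theta>_def P_def B_def by blast+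
    have c\<theta>: "continuous_on {l..1} \<theta>" by (rule DERIV_continuous_on[OF d\<theta>])
    have cP: "continuous_on {l..1} P" by (rule DERIV_continuous_on[OF dP])
    define r where "r = sqrt (\<eta> 1)"
    have r: "r > 0" "1 / r \<le> M" "r \<le> M" using \<eta>_pos[OF one] rM[OF one] by (auto simp: r_def)
    have \<theta>1: "\<theta> 1 = (1 + A 1) / (2 * \<kappa> * r)"
      by (simp add: \<theta>_def B_def \<tau>_1 r_def add.commute)
    have A1: "\<bar>A 1\<bar> \<le> 1 / 2" using Ab one by blast
    have \<theta>1_pos: "\<theta> 1 > 0" unfolding \<theta>1 using A1 \<kappa>0 r by (intro divide_pos_pos) auto
    \<comment> \<open>Normalises \<psi>(1) = 1. Because |A(1)| <= 1/2, the value \<theta>(1) has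
      exact order 1/\<kappa>, so N is at most a multiple of \<kappa> and bounded away from
      0.\<close>
    define N where "N = 1 / \<theta> 1"
    have N: "N > 0" "N = 2 * \<kappa> * r / (1 + A 1)" using \<theta>1_pos by (simp add: N_def) (simp add: N_def \<theta>1)
    have N_le: "N \<le> 4 * \<kappa> * M"
    proof -
      have "N \<le> 2 * \<kappa> * r / (1 / 2)"
        unfolding N(2) using A1 \<kappa>0 r by (intro divide_left_mono) auto
      also have "\<dots> \<le> 4 * \<kappa> * M" using r \<kappa>0 by simp
      finally show ?thesis .
    qed
    have N_ge: "N / 2 \<ge> 1 / (2 * M)"
    proof -
      have "1 / M \<le> r" using r M by (simp add: field_simps)
      also have "\<dots> \<le> 2 * 1 * r / 2" by simp
      also have "\<dots> \<le> N" unfolding N(2) using A1 \<kappa> r by (intro frac_le mult_mono) auto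
      finally show ?thesis using M by (simp add: field_simps)
    qed
    have Bb: "\<bar>B x\<bar> \<le> 1 + M" if x: "x \<in> {l..1}" for x
    proof -
      have "norm (integral {x..1} (\<lambda>s. \<nu> s * A s)) \<le> (M * 1) * (1 - x)"
      proof (rule integral_bound)
        show "continuous_on {x..1} (\<lambda>s. \<nu> s * A s)"
          using x by (intro continuous_intros continuous_on_subset[OF cont_\<nu>] continuous_on_subset[OF cA]) auto
        show "norm (\<nu> s * A s) \<le> M * 1" if "s \<in> {x..1}" for s
          unfolding real_norm_def abs_mult
        proof (rule mult_mono)
          have s: "s \<in> {l..1}" using that x by auto
          show "\<bar>\<nu> s\<bar> \<le> M" by (rule \<nu>M[OF s])
          show "\<bar>A s\<bar> \<le> 1" using Ab s by fastforce
        qed (use M in auto)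
      qed (use x in auto)
      also have "\<dots> \<le> M" using x l M by (simp add: mult_left_le)
      finally show ?thesis unfolding B_def by simp
    qed
    have ABb: "\<bar>A x + B x\<bar> \<le> 2 + M" "\<bar>B x - A x\<bar> \<le> 2 + M" if "x \<in> {l..1}" for x
      using Bb[OF that] Ab that by (fastforce simp: abs_le_iff)+
    define e where "e = (\<lambda>x. exp (- \<kappa> * \<tau> x))"
    have e0: "e x \<ge> 0" for x by (simp add: e_def)
    have e1: "e x \<le> 1" if "x \<in> {l..1}" for x
      using \<tau>_nonneg[OF that] \<kappa>0 by (simp add: e_def)
    have em: "e x \<le> e m" if "x \<in> {l..m}" for x
      using \<tau>_le[of x m] that m \<kappa>0 by (simp add: e_def)
    have Qe: "2 * M * (2 + M) * M \<le> Q"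
    proof -
      have "2 * M * (2 + M) * M * 1 \<le> 2 * M * (2 + M) * M * (2 * M)"
        using M by (intro mult_left_mono) auto
      then show ?thesis by (simp add: Q_def mult_ac)
    qed
    have N\<theta>: "\<bar>N * \<theta> x\<bar> \<le> Q * e x" if x: "x \<in> {l..1}" for x
    proof -
      have "\<bar>N * \<theta> x\<bar> = N * (e x * \<bar>A x + B x\<bar> * \<bar>1 / sqrt (\<eta> x)\<bar> / (2 * \<kappa>))"
        using N(1) \<kappa>0 by (simp add: \<theta>_def e_def abs_mult)
      also have "\<dots> \<le> (4 * \<kappa> * M) * (e x * (2 + M) * M / (2 * \<kappa>))"
        using N(1) N_le ABb(1)[OF x] rM(2)[OF x] e0 \<kappa>0 M
        by (intro mult_mono divide_right_mono) auto
      also have "\<dots> = (2 * M * (2 + M) * M) * e x" using \<kappa>0 by simp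
      also have "\<dots> \<le> Q * e x" using Qe by (rule mult_right_mono[OF _ e0])
      finally show ?thesis .
    qed
    have NP: "\<bar>N * P x\<bar> \<le> Q * \<kappa> * e x" if x: "x \<in> {l..1}" for x
    proof -
      have "\<bar>N * P x\<bar> = N * (\<bar>sqrt (\<eta> x)\<bar> * e x * \<bar>B x - A x\<bar> / 2)"
        using N(1) by (simp add: P_def e_def abs_mult)
      also have "\<dots> \<le> (4 * \<kappa> * M) * (M * e x * (2 + M) / 2)"
        using N(1) N_le ABb(2)[OF x] rM(1)[OF x] e0 \<kappa>0 M
        by (intro mult_mono divide_right_mono) auto
      also have "\<dots> = (2 * M * (2 + M) * M) * \<kappa> * e x" by simp
      also have "\<dots> \<le> Q * \<kappa> * e x" using Qe \<kappa>0 by (intro mult_right_mono e0) auto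
      finally show ?thesis .
    qed
    have N\<theta>': "\<bar>N * \<theta> x\<bar> \<le> Q * \<kappa> * e x" if x: "x \<in> {l..1}" for x
    proof -
      have "Q * 1 * e x \<le> Q * \<kappa> * e x" using Q \<kappa> e0 by (intro mult_right_mono mult_left_mono) auto
      then show ?thesis using N\<theta>[OF x] by simp
    qed
    define \<psi> where "\<psi> = (\<lambda>x. \<phi> x * (N * \<theta> x))"
    define \<xi> where "\<xi> = (\<lambda>x. \<phi> x * (N * P x) + \<phi>' x * p x * (N * \<theta> x))"
    define \<rho> where "\<rho> = (\<lambda>x. 2 * \<phi>' x * (N * P x) + \<phi>'' x * p x * (N * \<theta> x) + \<phi>' x * p' x * (N * \<theta> x))"
    have test: "test_fun p l \<kappa> \<psi> \<xi> \<rho>"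
      unfolding test_fun_def
    proof (intro conjI ballI)
      fix x assume x: "x \<in> {l..1}"
      note D = has_field_derivative_at_within[OF d\<phi>] has_field_derivative_at_within[OF d\<phi>'] d\<theta>[OF x] dP[OF x] dp[OF x]
      have px: "p x > 0" by (rule p_pos[OF x])
      show "(\<psi> has_real_derivative \<xi> x / p x) (at x within {l..1})"
        unfolding \<psi>_def
        by (rule DERIV_cong[OF DERIV_mult[OF D(1) DERIV_cmult[OF D(3)]]])
          (use px in \<open>simp add: \<xi>_def field_simps\<close>)
      show "(\<xi> has_real_derivative \<kappa>\<^sup>2 * \<psi> x + \<rho> x) (at x within {l..1})"
        unfolding \<xi>_def
        by (rule DERIV_cong[OF DERIV_add[OF DERIV_mult[OF D(1) DERIV_cmult[OF D(4)]]
            DERIV_mult[OF DERIV_mult[OF D(2) D(5)] DERIV_cmult[OF D(3)]]]])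
          (use px in \<open>simp add: \<psi>_def \<rho>_def field_simps\<close>)
    next
      show "continuous_on {l..1} \<rho>"
        unfolding \<rho>_def by (intro continuous_intros c\<phi> cont_p cont_p' c\<theta> cP)
      show "\<psi> l = 0" "\<xi> l = 0" by (simp_all add: \<psi>_def \<xi>_def \<phi>l)
      show "\<psi> 1 = 1" using \<phi>1(1)[of 1] m \<theta>1_pos by (simp add: \<psi>_def N_def)
    qed
    have prod: "\<bar>f * g\<bar> \<le> K / 4 * (\<kappa> * e x)"
      if "\<bar>f\<bar> \<le> F" "\<bar>g\<bar> \<le> Q * \<kappa> * e x" "Q * F * 4 \<le> K" for f g F x
    proof -
      have "\<bar>f * g\<bar> \<le> F * (Q * \<kappa> * e x)"
        unfolding abs_mult using that by (intro mult_mono) auto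
      also have "\<dots> = Q * F * (\<kappa> * e x)" by simp
      also have "\<dots> \<le> K / 4 * (\<kappa> * e x)"
        using that \<kappa>0 e0 by (intro mult_right_mono) auto
      finally show ?thesis .
    qed
    have two: "\<bar>f * g\<bar> \<le> F * G" if "\<bar>f\<bar> \<le> F" "\<bar>g\<bar> \<le> G" for f g F G :: real
      unfolding abs_mult using that by (intro mult_mono) auto
    have \<rho>_le: "\<bar>\<rho> x\<bar> \<le> K * (\<kappa> * e x)" if x: "x \<in> {l..1}" for x
    proof -
      have "\<bar>\<phi>' x * (N * P x)\<bar> \<le> K / 4 * (\<kappa> * e x)" by (rule prod[OF \<phi>M(2)[OF x] NP[OF x] K(1)])
      moreover have "\<bar>\<phi>'' x * p x * (N * \<theta> x)\<bar> \<le> K / 4 * (\<kappa> * e x)"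
        by (rule prod[OF two[OF \<phi>M(3)[OF x] pM(1)[OF x]] N\<theta>'[OF x] K(2)])
      moreover have "\<bar>\<phi>' x * p' x * (N * \<theta> x)\<bar> \<le> K / 4 * (\<kappa> * e x)"
        by (rule prod[OF two[OF \<phi>M(2)[OF x] pM(2)[OF x]] N\<theta>'[OF x] K(2)])
      moreover have "2 * \<phi>' x * (N * P x) = 2 * (\<phi>' x * (N * P x))" by simp
      ultimately show ?thesis unfolding \<rho>_def by linarith
    qed
    have \<xi>_le: "\<bar>\<xi> x\<bar> \<le> K * (\<kappa> * e x)" if x: "x \<in> {l..1}" for x
    proof -
      have "\<bar>\<phi> x * (N * P x)\<bar> \<le> K / 4 * (\<kappa> * e x)" by (rule prod[OF \<phi>M(1)[OF x] NP[OF x] K(1)])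
      moreover have "\<bar>\<phi>' x * p x * (N * \<theta> x)\<bar> \<le> K / 4 * (\<kappa> * e x)"
        by (rule prod[OF two[OF \<phi>M(2)[OF x] pM(1)[OF x]] N\<theta>'[OF x] K(2)])
      moreover have "K / 4 * (\<kappa> * e x) \<ge> 0" using K(3) \<kappa>0 e0 by simp
      ultimately show ?thesis unfolding \<xi>_def by linarith
    qed
    have mono: "K * (\<kappa> * e x) \<le> K * \<kappa> * e m" if "x \<in> {l..m}" for x
      using em[OF that] K(3) \<kappa>0 by simp
    have f1: "\<forall>x\<in>{l..1}. \<bar>\<psi> x\<bar> \<le> K \<and> \<bar>\<rho> x\<bar> \<le> K * \<kappa> * exp (- \<kappa> * \<tau> m)"
    proof (intro ballI conjI)
      fix x assume x: "x \<in> {l..1}"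
      have "Q * e x \<le> Q * 1" using e1[OF x] Q by (intro mult_left_mono) auto
      then have "\<bar>N * \<theta> x\<bar> \<le> Q * 1" using N\<theta>[OF x] by linarith
      from two[OF \<phi>M(1)[OF x] this] have "\<bar>\<phi> x * (N * \<theta> x)\<bar> \<le> M * (Q * 1)" .
      also have "\<dots> \<le> K"
      proof -
        have "M * (Q * 1) = Q * M" "0 \<le> Q * M" using Q M by simp_all
        then show ?thesis using K(1) by linarith
      qed
      finally show "\<bar>\<psi> x\<bar> \<le> K" by (simp add: \<psi>_def)
      show "\<bar>\<rho> x\<bar> \<le> K * \<kappa> * exp (- \<kappa> * \<tau> m)"
      proof (cases "x \<le> m")
        case True
        then show ?thesis using \<rho>_le[OF x] mono[of x] x by (simp add: e_def)
      next
        case False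
        then have "\<rho> x = 0" using \<phi>1 by (simp add: \<rho>_def)
        then show ?thesis using K(3) \<kappa>0 by simp
      qed
    qed
    have f2: "\<forall>x\<in>{l..m}. \<bar>\<xi> x\<bar> \<le> K * \<kappa> * exp (- \<kappa> * \<tau> m)"
    proof
      fix x assume x: "x \<in> {l..m}"
      then show "\<bar>\<xi> x\<bar> \<le> K * \<kappa> * exp (- \<kappa> * \<tau> m)"
        using \<xi>_le[of x] mono[of x] m by (simp add: e_def)
    qed
    have f3: "N / 2 \<ge> 1 / K"
    proof -
      have "Q * 1 \<le> Q * M" using Q M by (intro mult_left_mono) auto
      then have "2 * M \<le> K" using K(1) Q(1) M by linarith
      then have "1 / K \<le> 1 / (2 * M)" using M by (intro divide_left_mono) auto
      then show ?thesis using N_ge by linarith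
    qed
    have f4: "\<forall>x\<in>{m..1}. \<xi> x = N / 2 * (sqrt (\<eta> x) * exp (- \<kappa> * \<tau> x) * (1 - integral {x..1} (\<lambda>s. \<nu> s * A s) - A x))"
    proof
      fix x assume x: "x \<in> {m..1}"
      then show "\<xi> x = N / 2 * (sqrt (\<eta> x) * exp (- \<kappa> * \<tau> x) * (1 - integral {x..1} (\<lambda>s. \<nu> s * A s) - A x))"
        using \<phi>1 by (simp add: \<xi>_def P_def B_def)
    qed
    show ?thesis
      using test f1 f2 f3 f4 unfolding concentrated_test_def by blast
  qed
  show ?thesis using main K(3) by (intro exI[of _ K]) blast
qed

end

section \<open>Inversion of the Laplace transform\<close>

text \<open>For z = exp (- N r) and Y = exp (N t), multiplication by N Y gives N y exp (- y) with y
  = exp (N (t - r)): the density in r of a Gumbel distribution with location t and scale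
  1/N.\<close>

lemma lap_exp:
  "lap Y (\<lambda>n. z ^ Suc n) = z * exp (- Y * z)"
proof -
  have "(\<lambda>n. z * ((- Y * z) ^ n /\<^sub>R fact n)) sums (z * exp (- Y * z))"
    by (intro sums_mult exp_converges)
  moreover have "z * ((- Y * z) ^ n /\<^sub>R fact n) = (- Y) ^ n / fact n * z ^ Suc n" for n
    by (simp only: power_mult_distrib) (simp add: divide_inverse mult_ac)
  ultimately have "(\<lambda>n. (- Y) ^ n / fact n * z ^ Suc n) sums (z * exp (- Y * z))"
    by (simp only:)
  then show ?thesis by (simp add: lap_def sums_iff)
qed

text \<open>The extra 1/(n + 1) turns the approximate delta function into a smoothed step: in the
  notation above, 1 - exp (- y) tends to 1 for r < t and to 0 for r > t. This is how a majorant L/k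
  becomes an integral over [\<xi>, 1].\<close>

lemma lap_exp_div:
  assumes "Y \<noteq> 0"
  shows "Y * lap Y (\<lambda>n. z ^ Suc n / real (Suc n)) = 1 - exp (- Y * z)"
proof -
  have "(\<lambda>n. (- Y * z) ^ n /\<^sub>R fact n) sums exp (- Y * z)"
    by (rule exp_converges)
  then have "(\<lambda>n. (- Y * z) ^ Suc n /\<^sub>R fact (Suc n)) sums (exp (- Y * z) - 1)"
    by (subst sums_Suc_iff) simp
  from sums_mult[OF this, of "- 1 / Y"]
  have "(\<lambda>n. - 1 / Y * ((- Y * z) ^ Suc n /\<^sub>R fact (Suc n))) sums (- 1 / Y * (exp (- Y * z) - 1))" .
  moreover have "- 1 / Y * ((- Y * z) ^ Suc n /\<^sub>R fact (Suc n)) = (- Y) ^ n / fact n * (z ^ Suc n / real (Suc n))" for n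
    using assms by (simp only: power_mult_distrib) (simp add: divide_inverse mult_ac)
  moreover have "- 1 / Y * (exp (- Y * z) - 1) = (1 - exp (- Y * z)) / Y"
    by (simp add: diff_divide_distrib)
  ultimately have "(\<lambda>n. (- Y) ^ n / fact n * (z ^ Suc n / real (Suc n))) sums ((1 - exp (- Y * z)) / Y)"
    by (simp only:)
  then show ?thesis using assms by (simp add: lap_def sums_iff)
qed

text \<open>The alternation of signs is given up here, which costs exp (Y z). The estimate is
  therefore useful only while Y z stays bounded, whence the condition
  \<open>\<tau> \<xi> < c\<close> in \<open>pointwise_bound\<close>.\<close>

lemma lap_bound:
  assumes "\<And>n. \<bar>s n\<bar> \<le> K * z ^ Suc n" "Y \<ge> 0" "0 \<le> z"
  shows "\<bar>lap Y s\<bar> \<le> K * z * exp (Y * z)"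
proof -
  have sums: "(\<lambda>n. K * z * ((Y * z) ^ n /\<^sub>R fact n)) sums (K * z * exp (Y * z))"
    by (intro sums_mult exp_converges)
  have le: "norm ((- Y) ^ n / fact n * s n) \<le> K * z * ((Y * z) ^ n /\<^sub>R fact n)" for n
  proof -
    have "norm ((- Y) ^ n / fact n * s n) = Y ^ n / fact n * \<bar>s n\<bar>"
      using assms(2) by (simp add: abs_mult power_abs)
    also have "\<dots> \<le> Y ^ n / fact n * (K * z ^ Suc n)"
      using assms by (intro mult_left_mono) auto
    finally show ?thesis by (simp add: power_mult_distrib divide_inverse mult_ac)
  qed
  have "summable (\<lambda>n. norm ((- Y) ^ n / fact n * s n))"
    by (rule summable_comparison_test'[OF sums_summable[OF sums], where N = 0]) (use le in simp)
  then have "norm (lap Y s) \<le> (\<Sum>n. norm ((- Y) ^ n / fact n * s n))"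
    unfolding lap_def by (rule summable_norm)
  also have "\<dots> \<le> (\<Sum>n. K * z * ((Y * z) ^ n /\<^sub>R fact n))"
    by (rule suminf_le[OF le \<open>summable _\<close> sums_summable[OF sums]])
  also have "\<dots> = K * z * exp (Y * z)" using sums by (rule sums_unique[symmetric])
  finally show ?thesis by simp
qed

lemma lap_integral:
  fixes q :: "nat \<Rightarrow> real \<Rightarrow> real"
  assumes G: "continuous_on {a..b} G" and q: "\<And>n. continuous_on {a..b} (q n)"
    and bound: "\<And>n x. x \<in> {a..b} \<Longrightarrow> \<bar>q n x\<bar> \<le> K"
  shows "lap Y (\<lambda>n. integral {a..b} (\<lambda>x. G x * q n x)) = integral {a..b} (\<lambda>x. G x * lap Y (\<lambda>n. q n x))"
proof -
  obtain B where B: "B \<ge> 1" "\<And>x. x \<in> {a..b} \<Longrightarrow> \<bar>G x\<bar> \<le> B"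
    using continuous_on_Icc_bound[OF G] by blast
  define f where "f = (\<lambda>n x. (- Y) ^ n / fact n * (G x * q n x))"
  have cf: "continuous_on {a..b} (f n)" for n
    unfolding f_def by (intro continuous_intros G q)
  have ul: "uniform_limit {a..b} (\<lambda>n x. \<Sum>i<n. f i x) (\<lambda>x. \<Sum>i. f i x) sequentially"
  proof (rule Weierstrass_m_test)
    show "norm (f n x) \<le> \<bar>Y\<bar> ^ n / fact n * (B * K)" if "x \<in> {a..b}" for n x
    proof -
      have "\<bar>G x\<bar> * \<bar>q n x\<bar> \<le> B * K"
        by (rule mult_mono[OF B(2)[OF that] bound[OF that]]) (use B(1) in auto)
      then have "\<bar>Y\<bar> ^ n / fact n * (\<bar>G x\<bar> * \<bar>q n x\<bar>) \<le> \<bar>Y\<bar> ^ n / fact n * (B * K)"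
        by (rule mult_left_mono) simp
      then show ?thesis by (simp add: f_def abs_mult power_abs)
    qed
    show "summable (\<lambda>n. \<bar>Y\<bar> ^ n / fact n * (B * K))"
      using summable_exp[of "\<bar>Y\<bar>"] by (intro summable_mult2) (simp add: field_simps)
  qed
  obtain I J where I: "\<And>n. ((\<lambda>x. \<Sum>i<n. f i x) has_integral I n) {a..b}"
    and J: "((\<lambda>x. \<Sum>i. f i x) has_integral J) {a..b}" and IJ: "I \<longlonglongrightarrow> J"
    by (rule uniform_limit_integral[OF ul]) (auto intro!: continuous_on_sum cf)
  have "I = (\<lambda>n. \<Sum>i<n. (- Y) ^ i / fact i * integral {a..b} (\<lambda>x. G x * q i x))"
  proof
    fix n
    have "I n = (\<Sum>i<n. integral {a..b} (f i))"
      using integral_unique[OF I[of n]] cf by (simp add: integral_sum integrable_continuous_real)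
    then show "I n = (\<Sum>i<n. (- Y) ^ i / fact i * integral {a..b} (\<lambda>x. G x * q i x))" by (simp add: f_def)
  qed
  then have "(\<lambda>i. (- Y) ^ i / fact i * integral {a..b} (\<lambda>x. G x * q i x)) sums J"
    using IJ unfolding sums_def by (simp only:)
  then have "lap Y (\<lambda>n. integral {a..b} (\<lambda>x. G x * q n x)) = J"
    unfolding lap_def by (rule sums_unique[symmetric])
  moreover have "(\<Sum>i. f i x) = G x * lap Y (\<lambda>n. q n x)" if "x \<in> {a..b}" for x
  proof -
    have "summable (\<lambda>n. (- Y) ^ n / fact n * q n x)" by (rule lap_summable'[OF bound[OF that]])
    from suminf_mult[OF this, of "G x"] show ?thesis by (simp add: f_def lap_def mult_ac)
  qed
  then have "integral {a..b} (\<lambda>x. G x * lap Y (\<lambda>n. q n x)) = integral {a..b} (\<lambda>x. \<Sum>i. f i x)"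
    by (intro integral_cong) simp
  then have "integral {a..b} (\<lambda>x. G x * lap Y (\<lambda>n. q n x)) = J" using integral_unique[OF J] by simp
  ultimately show ?thesis by simp
qed

section \<open>Approximate identities in the travel time and the pointwise bound\<close>

context medium
begin

lemma gumbel_kernel:
  fixes t :: real
  assumes m: "l \<le> m" "m < 1" and N: "N > 0"
  defines "y \<equiv> \<lambda>x. exp (N * (t - \<tau> x))"
  assumes uv: "m \<le> u" "u \<le> v" "v \<le> 1"
  shows "((\<lambda>x. N * y x * exp (- y x) / \<eta> x) has_integral exp (- y u) - exp (- y v)) {u..v}"
    and "((\<lambda>x. y x / \<eta> x) has_integral (y v - y u) / N) {u..v}"
proof -
  have sub: "{u..v} \<subseteq> {l..1}" using uv m by auto
  have dy: "(y has_real_derivative N * y x / \<eta> x) (at x within {u..v})" if "x \<in> {u..v}" for x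
  proof -
    have "(\<tau> has_real_derivative - (1 / \<eta> x)) (at x within {u..v})"
      by (rule DERIV_subset[OF d\<tau> sub]) (use that sub in blast)
    then show ?thesis unfolding y_def by (auto intro!: derivative_eq_intros)
  qed
  have "((\<lambda>x. N * y x * exp (- y x) / \<eta> x) has_integral - exp (- y v) - - exp (- y u)) {u..v}"
  proof (rule has_integral_real_derivative[OF uv(2)])
    show "((\<lambda>x. - exp (- y x)) has_real_derivative N * y x * exp (- y x) / \<eta> x) (at x within {u..v})"
      if "x \<in> {u..v}" for x
      by (rule derivative_eq_intros dy that refl)+ simp
  qed
  then show "((\<lambda>x. N * y x * exp (- y x) / \<eta> x) has_integral exp (- y u) - exp (- y v)) {u..v}"
    by simp
  have "((\<lambda>x. y x / \<eta> x) has_integral y v / N - y u / N) {u..v}"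
    by (rule has_integral_real_derivative[OF uv(2)]) (use DERIV_cdivide[OF dy, of _ N] N in simp)
  then show "((\<lambda>x. y x / \<eta> x) has_integral (y v - y u) / N) {u..v}"
    by (simp add: diff_divide_distrib)
qed

text \<open>The kernel is positive and its mass on [u, v] is exp (- y(u)) - exp (- y(v)). As exp (-
  y) tends to 1 left of \<xi> and to 0 right of it, the mass concentrates at \<xi>; the proof splits
  the interval around \<xi>.\<close>

lemma gumbel_limit:
  assumes m: "l \<le> m" and \<xi>: "m < \<xi>" "\<xi> < 1" and W: "continuous_on {m..1} W"
  shows "(\<lambda>N. integral {m..1} (\<lambda>x. W x * (real (Suc N) * exp (real (Suc N) * (\<tau> \<xi> - \<tau> x)) *
      exp (- exp (real (Suc N) * (\<tau> \<xi> - \<tau> x))) / \<eta> x))) \<longlonglongrightarrow> W \<xi>"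
proof (rule LIMSEQ_I)
  fix r :: real assume r: "r > 0"
  define y where "y = (\<lambda>N x. exp (real (Suc N) * (\<tau> \<xi> - \<tau> x)))"
  define \<delta> where "\<delta> = (\<lambda>N x. real (Suc N) * y N x * exp (- y N x) / \<eta> x)"
  have m1: "m < 1" using \<xi> by simp
  have h\<delta>: "(\<delta> N has_integral exp (- y N u) - exp (- y N v)) {u..v}" if "m \<le> u" "u \<le> v" "v \<le> 1" for N u v
    unfolding \<delta>_def y_def by (rule gumbel_kernel(1)[OF m m1 _ that]) simp
  have \<delta>0: "\<delta> N x \<ge> 0" if "x \<in> {m..1}" for N x
    using \<eta>_pos[of x] that m by (simp add: \<delta>_def y_def)
  obtain B where B: "B \<ge> 1" "\<And>x. x \<in> {m..1} \<Longrightarrow> \<bar>W x\<bar> \<le> B"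
    using continuous_on_Icc_bound[OF W] by blast
  have "\<exists>d>0. \<forall>x\<in>{m..1}. dist x \<xi> < d \<longrightarrow> dist (W x) (W \<xi>) < r / 4"
    using W[unfolded continuous_on_iff, rule_format, of \<xi> "r / 4"] \<xi> r by simp
  then obtain d0 where d0: "d0 > 0" "\<And>x. x \<in> {m..1} \<Longrightarrow> \<bar>x - \<xi>\<bar> < d0 \<Longrightarrow> \<bar>W x - W \<xi>\<bar> < r / 4"
    by (auto simp: dist_real_def)
  define d where "d = Min {d0 / 2, \<xi> - m, 1 - \<xi>}"
  have d: "d > 0" "d < d0" "m \<le> \<xi> - d" "\<xi> + d \<le> 1"
    using d0(1) \<xi> by (auto simp: d_def min_def)
  have cW: "continuous_on {u..v} W" if "m \<le> u" "v \<le> 1" for u v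
    by (rule continuous_on_subset[OF W]) (use that in auto)
  have c\<delta>: "continuous_on {u..v} (\<delta> N)" if "m \<le> u" "v \<le> 1" for u v N
  proof -
    have sub: "{u..v} \<subseteq> {l..1}" using that m by auto
    show ?thesis unfolding \<delta>_def y_def
      by (intro continuous_intros continuous_on_subset[OF cont_\<tau> sub] continuous_on_subset[OF cont_\<eta> sub])
        (metis \<eta>_pos sub subsetD less_irrefl)
  qed
  have part: "\<bar>integral {u..v} (\<lambda>x. (W x - W \<xi>) * \<delta> N x)\<bar> \<le> K * (exp (- y N u) - exp (- y N v))"
    if uv: "m \<le> u" "u \<le> v" "v \<le> 1" and K: "\<And>x. x \<in> {u..v} \<Longrightarrow> \<bar>W x - W \<xi>\<bar> \<le> K" for u v K N
  proof -
    have "norm (integral {u..v} (\<lambda>x. (W x - W \<xi>) * \<delta> N x)) \<le> integral {u..v} (\<lambda>x. K * \<delta> N x)"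
    proof (rule integral_norm_bound_integral)
      show "(\<lambda>x. (W x - W \<xi>) * \<delta> N x) integrable_on {u..v}" "(\<lambda>x. K * \<delta> N x) integrable_on {u..v}"
        using uv by (auto intro!: integrable_continuous_real continuous_intros cW c\<delta>)
      show "norm ((W x - W \<xi>) * \<delta> N x) \<le> K * \<delta> N x" if x: "x \<in> {u..v}" for x
        using mult_right_mono[OF K[OF x] \<delta>0[of x N]] \<delta>0[of x N] x uv by (simp add: abs_mult)
    qed
    also have "\<dots> = K * (exp (- y N u) - exp (- y N v))"
      using integral_unique[OF h\<delta>[OF uv]] by simp
    finally show ?thesis by simp
  qed
  have dec: "exp (- y N u) - exp (- y N v) \<ge> 0" "exp (- y N u) - exp (- y N v) \<le> 1" if "m \<le> u" "u \<le> v" "v \<le> 1" for u v N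
  proof -
    show "exp (- y N u) - exp (- y N v) \<ge> 0"
      using \<tau>_le[of u v] that m by (simp add: y_def mult_left_mono)
    have "exp (- y N u) \<le> 1" by (simp add: y_def)
    then show "exp (- y N u) - exp (- y N v) \<le> 1"
      using exp_gt_zero[of "- y N v"] by linarith
  qed
  have "(\<lambda>N. exp (- y N x)) \<longlonglongrightarrow> 1" if x: "m \<le> x" "x < \<xi>" for x
  proof -
    have "\<tau> \<xi> - \<tau> x < 0" using \<tau>_less[of x \<xi>] x m \<xi> by simp
    then have "(\<lambda>N. exp (real (Suc N) * q)) \<longlonglongrightarrow> 0" if "q = \<tau> \<xi> - \<tau> x" for q
      unfolding that[symmetric] by real_asymp
    then have "(\<lambda>N. y N x) \<longlonglongrightarrow> 0" by (simp add: y_def)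
    from tendsto_exp[OF tendsto_minus[OF this]] show ?thesis by simp
  qed
  note to1 = this
  have "(\<lambda>N. exp (- y N x)) \<longlonglongrightarrow> 0" if x: "\<xi> < x" "x \<le> 1" for x
  proof -
    have "\<tau> \<xi> - \<tau> x > 0" using \<tau>_less[of \<xi> x] x m \<xi> by simp
    then have "(\<lambda>N. exp (- exp (real (Suc N) * q))) \<longlonglongrightarrow> 0" if "q = \<tau> \<xi> - \<tau> x" for q
      unfolding that[symmetric] by real_asymp
    then show ?thesis by (simp add: y_def)
  qed
  note to0 = this
  define R where "R = (\<lambda>N. 2 * B * (exp (- y N m) - exp (- y N (\<xi> - d))) + 2 * B * (exp (- y N (\<xi> + d)) - exp (- y N 1))
      + B * \<bar>(exp (- y N m) - exp (- y N 1)) - 1\<bar>)"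
  have "R \<longlonglongrightarrow> 2 * B * (1 - 1) + 2 * B * (0 - 0) + B * \<bar>(1 - 0) - 1\<bar>"
    unfolding R_def by (intro tendsto_intros to1 to0) (use \<xi> d in auto)
  then have "R \<longlonglongrightarrow> 0" by simp
  from LIMSEQ_D[OF this, of "r / 2"] r obtain N0 where N0: "\<And>N. N \<ge> N0 \<Longrightarrow> R N < r / 2" by force
  show "\<exists>no. \<forall>N\<ge>no. norm (integral {m..1} (\<lambda>x. W x * (real (Suc N) * exp (real (Suc N) * (\<tau> \<xi> - \<tau> x)) *
      exp (- exp (real (Suc N) * (\<tau> \<xi> - \<tau> x))) / \<eta> x)) - W \<xi>) < r"
  proof (intro exI[of _ N0] allI impI)
    fix N assume N: "N \<ge> N0"
    let ?g = "\<lambda>x. (W x - W \<xi>) * \<delta> N x"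
    have gi: "?g integrable_on {u..v}" if "m \<le> u" "v \<le> 1" for u v
      using that by (intro integrable_continuous_real continuous_intros cW c\<delta>) auto
    have Wb: "\<bar>W x - W \<xi>\<bar> \<le> 2 * B" if "x \<in> {m..1}" for x
      using B(2)[OF that] B(2)[of \<xi>] \<xi> by simp
    have "integral {m..1} ?g = integral {m..\<xi> - d} ?g + integral {\<xi> - d..1} ?g"
      by (rule Henstock_Kurzweil_Integration.integral_combine[symmetric]) (use d \<xi> gi in auto)
    also have "integral {\<xi> - d..1} ?g = integral {\<xi> - d..\<xi> + d} ?g + integral {\<xi> + d..1} ?g"
      by (rule Henstock_Kurzweil_Integration.integral_combine[symmetric]) (use d \<xi> gi in auto)
    finally have split: "integral {m..1} ?g = integral {m..\<xi> - d} ?g + (integral {\<xi> - d..\<xi> + d} ?g + integral {\<xi> + d..1} ?g)" .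
    have p1: "\<bar>integral {m..\<xi> - d} ?g\<bar> \<le> 2 * B * (exp (- y N m) - exp (- y N (\<xi> - d)))"
      by (rule part) (use d \<xi> Wb in auto)
    have p2: "\<bar>integral {\<xi> + d..1} ?g\<bar> \<le> 2 * B * (exp (- y N (\<xi> + d)) - exp (- y N 1))"
      by (rule part) (use d \<xi> Wb in auto)
    have "\<bar>integral {\<xi> - d..\<xi> + d} ?g\<bar> \<le> r / 4 * (exp (- y N (\<xi> - d)) - exp (- y N (\<xi> + d)))"
    proof (rule part)
      show "\<bar>W x - W \<xi>\<bar> \<le> r / 4" if "x \<in> {\<xi> - d..\<xi> + d}" for x
      proof -
        have "x \<in> {m..1}" "\<bar>x - \<xi>\<bar> < d0" using that d by auto
        then show ?thesis using d0(2) by (simp add: less_imp_le)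
      qed
    qed (use d in auto)
    also have "\<dots> \<le> r / 4 * 1" using r d by (intro mult_left_mono dec) auto
    finally have p3: "\<bar>integral {\<xi> - d..\<xi> + d} ?g\<bar> \<le> r / 4" by simp
    have i\<delta>: "integral {m..1} (\<delta> N) = exp (- y N m) - exp (- y N 1)"
      using integral_unique[OF h\<delta>] m1 by simp
    have "integral {m..1} ?g = integral {m..1} (\<lambda>x. W x * \<delta> N x) - W \<xi> * integral {m..1} (\<delta> N)"
      unfolding left_diff_distrib
      by (subst integral_diff) (auto intro!: integrable_continuous_real continuous_intros cW c\<delta>)
    then have "integral {m..1} (\<lambda>x. W x * \<delta> N x) - W \<xi>
        = integral {m..1} ?g + W \<xi> * ((exp (- y N m) - exp (- y N 1)) - 1)"
      by (simp add: i\<delta> algebra_simps)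
    moreover have "\<bar>W \<xi> * ((exp (- y N m) - exp (- y N 1)) - 1)\<bar> \<le> B * \<bar>(exp (- y N m) - exp (- y N 1)) - 1\<bar>"
      unfolding abs_mult using B(2)[of \<xi>] \<xi> by (intro mult_right_mono) auto
    ultimately have "\<bar>integral {m..1} (\<lambda>x. W x * \<delta> N x) - W \<xi>\<bar> \<le> R N + r / 4"
      using split p1 p2 p3 unfolding R_def by linarith
    also have "\<dots> < r" using N0[OF N] r by linarith
    finally show "norm (integral {m..1} (\<lambda>x. W x * (real (Suc N) * exp (real (Suc N) * (\<tau> \<xi> - \<tau> x)) *
      exp (- exp (real (Suc N) * (\<tau> \<xi> - \<tau> x))) / \<eta> x)) - W \<xi>) < r"
      by (simp add: \<delta>_def y_def)
  qed
qed

text \<open>Apply N Y lap Y with Y = exp (N \<tau>(\<xi>)) to the integrals at k = N (n + 1). The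
  main part reproduces F v \<eta> at \<xi>, the part with \<open>E\<close> is dominated through its
  majorant by a smoothed step against |F|, and \<open>H\<close> makes their sum negligible as N
  tends to infinity.\<close>

lemma pointwise_bound:
  assumes m: "l \<le> m" and \<xi>: "m < \<xi>" "\<xi> < 1" and c: "\<tau> \<xi> < c"
    and F: "continuous_on {m..1} F" and v: "continuous_on {m..1} v"
    and cE: "\<And>k. k \<ge> kmin \<Longrightarrow> continuous_on {m..1} (E k)"
    and L: "L \<ge> 0" and kmin: "kmin \<ge> 1"
    and E: "\<And>N x. N \<ge> kmin \<Longrightarrow> x \<in> {m..1} \<Longrightarrow> maj (\<lambda>n. E (N * real (Suc n)) x) (\<lambda>n. L / (N * real (Suc n)))"
    and H: "\<And>k. k \<ge> kmin \<Longrightarrow> \<bar>integral {m..1} (\<lambda>x. F x * exp (- k * \<tau> x) * (v x + E k x))\<bar> \<le> K * exp (- k * c)"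
  shows "\<bar>F \<xi> * v \<xi> * \<eta> \<xi>\<bar> \<le> L * integral {\<xi>..1} (\<lambda>x. \<bar>F x\<bar>)"
proof -
  have sub: "{m..1} \<subseteq> {l..1}" using m by auto
  note c\<tau> = continuous_on_subset[OF cont_\<tau> sub] and c\<eta> = continuous_on_subset[OF cont_\<eta> sub]
  define W where "W = (\<lambda>x. F x * v x * \<eta> x)"
  have W: "continuous_on {m..1} W" unfolding W_def by (intro continuous_intros F v c\<eta>)
  obtain B where B: "B \<ge> 1" "\<And>x. x \<in> {m..1} \<Longrightarrow> \<bar>F x * \<eta> x\<bar> \<le> B"
    using continuous_on_Icc_bound[of m 1 "\<lambda>x. F x * \<eta> x"] F c\<eta> continuous_on_mult by blast
  define y where "y = (\<lambda>N x. exp (N * (\<tau> \<xi> - \<tau> x)))"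
  define lim where "lim = (\<lambda>N. integral {m..1} (\<lambda>x. W x * (N * y N x * exp (- y N x) / \<eta> x)))"
  \<comment> \<open>N Y times the bound of \<open>lap_bound\<close> for z = exp (- N c), without the
    factor K; it tends to 0 because c > \<tau>(\<xi>).\<close>
  define err where "err = (\<lambda>N. N * exp (- N * (c - \<tau> \<xi>)) * exp (exp (- N * (c - \<tau> \<xi>))))"
  have main: "\<bar>lim N\<bar> \<le> L * integral {\<xi>..1} (\<lambda>x. \<bar>F x\<bar>) + L * B / N + K * err N" if Nk: "N \<ge> kmin" for N
  proof -
    have N: "N \<ge> 1" using Nk kmin by simp
    define Y where "Y = exp (N * \<tau> \<xi>)"
    have Y: "Y > 0" by (simp add: Y_def)
    define z where "z = (\<lambda>x. exp (- N * \<tau> x))"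
    have z: "0 \<le> z x" "z x \<le> 1" if "x \<in> {m..1}" for x
      using \<tau>_nonneg[of x] that m N by (auto simp: z_def)
    have cz: "continuous_on {m..1} z" unfolding z_def by (intro continuous_intros c\<tau>)
    have Yz: "Y * z x = y N x" for x
      by (simp add: Y_def z_def y_def mult_exp_exp right_diff_distrib)
    have zn: "z x ^ Suc n = exp (- (N * real (Suc n)) * \<tau> x)" for x n
      unfolding z_def exp_of_nat_mult[symmetric] by (simp add: mult_ac)
    have kn: "N * real (Suc n) \<ge> kmin" for n
      using mult_mono[of kmin N 1 "real (Suc n)"] Nk kmin by simp
    have z_pow: "\<bar>z x ^ Suc n\<bar> \<le> 1" if "x \<in> {m..1}" for x n
      using power_le_one[OF z[OF that], of "Suc n"] z(1)[OF that] by (simp del: power_Suc)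
    define s1 where "s1 = (\<lambda>n. integral {m..1} (\<lambda>x. (F x * v x) * z x ^ Suc n))"
    define s2 where "s2 = (\<lambda>n. integral {m..1} (\<lambda>x. F x * (z x ^ Suc n * E (N * real (Suc n)) x)))"
    define s3 where "s3 = (\<lambda>n. integral {m..1} (\<lambda>x. \<bar>F x\<bar> * (z x ^ Suc n * (L / (N * real (Suc n))))))"
    have s: "\<bar>s1 n + s2 n\<bar> \<le> K * exp (- N * c) ^ Suc n" for n
    proof -
      have "s1 n + s2 n = integral {m..1} (\<lambda>x. (F x * v x) * z x ^ Suc n + F x * (z x ^ Suc n * E (N * real (Suc n)) x))"
        unfolding s1_def s2_def
        by (rule integral_add[symmetric]) (intro integrable_continuous_real continuous_intros F v cz cE kn)+
      also have "\<dots> = integral {m..1} (\<lambda>x. F x * exp (- (N * real (Suc n)) * \<tau> x) * (v x + E (N * real (Suc n)) x))"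
        unfolding zn[symmetric] by (simp add: algebra_simps)
      also have "\<bar>\<dots>\<bar> \<le> K * exp (- (N * real (Suc n)) * c)" by (rule H[OF kn])
      also have "exp (- (N * real (Suc n)) * c) = exp (- N * c) ^ Suc n"
        unfolding exp_of_nat_mult[symmetric] by (simp add: mult_ac)
      finally show ?thesis .
    qed
    have maj3: "maj s2 s3"
      unfolding s2_def s3_def
    proof (rule maj_integral)
      fix x assume x: "x \<in> {m..1}"
      have "cms (\<lambda>n. z x * z x ^ n)" using z[OF x] by (intro cms_cmult cms_power)
      then have "cms (\<lambda>n. z x ^ Suc n)" by simp
      then show "maj (\<lambda>n. F x * (z x ^ Suc n * E (N * real (Suc n)) x)) (\<lambda>n. \<bar>F x\<bar> * (z x ^ Suc n * (L / (N * real (Suc n)))))"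
        by (intro maj_cmult maj_mult maj_self E Nk x) simp
    next
      fix n
      show "(\<lambda>x. F x * (z x ^ Suc n * E (N * real (Suc n)) x)) integrable_on {m..1}"
        by (intro integrable_continuous_real continuous_intros F cz cE kn)
      show "(\<lambda>x. \<bar>F x\<bar> * (z x ^ Suc n * (L / (N * real (Suc n))))) integrable_on {m..1}"
        by (intro integrable_continuous_real continuous_intros F cz)
    qed
    have s2b: "\<bar>s2 n\<bar> \<le> s3 0" for n
      using majD(2)[OF maj3, of n] cms_le_0[OF majD(1)[OF maj3], of n] by linarith
    have s1b: "\<bar>s1 n\<bar> \<le> integral {m..1} (\<lambda>x. \<bar>F x * v x\<bar>)" for n
    proof -
      have "norm (s1 n) \<le> integral {m..1} (\<lambda>x. \<bar>F x * v x\<bar>)"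
        unfolding s1_def
      proof (rule integral_norm_bound_integral)
        show "(\<lambda>x. F x * v x * z x ^ Suc n) integrable_on {m..1}" "(\<lambda>x. \<bar>F x * v x\<bar>) integrable_on {m..1}"
          by (intro integrable_continuous_real continuous_intros F v cz)+
        show "norm (F x * v x * z x ^ Suc n) \<le> \<bar>F x * v x\<bar>" if "x \<in> {m..1}" for x
          using mult_left_mono[OF z_pow[OF that, of n], of "\<bar>F x * v x\<bar>"] by (simp add: abs_mult del: power_Suc)
      qed
      then show ?thesis by simp
    qed
    have l1: "N * Y * lap Y s1 = lim N"
    proof -
      have "lap Y s1 = integral {m..1} (\<lambda>x. (F x * v x) * lap Y (\<lambda>n. z x ^ Suc n))"
        unfolding s1_def by (rule lap_integral[where K = 1]) (intro continuous_intros F v cz z_pow | assumption)+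
      then have "N * Y * lap Y s1 = integral {m..1} (\<lambda>x. N * Y * ((F x * v x) * (z x * exp (- Y * z x))))"
        by (simp only: lap_exp integral_mult_right)
      also have "\<dots> = lim N"
        unfolding lim_def
      proof (rule integral_cong)
        fix x assume x: "x \<in> {m..1}"
        have "\<eta> x > 0" using \<eta>_pos x m by auto
        then show "N * Y * ((F x * v x) * (z x * exp (- Y * z x))) = W x * (N * y N x * exp (- y N x) / \<eta> x)"
          unfolding W_def Yz[symmetric] by simp
      qed
      finally show ?thesis .
    qed
    have l3: "N * Y * lap Y s3 = L * integral {m..1} (\<lambda>x. \<bar>F x\<bar> * (1 - exp (- y N x)))"
    proof -
      have "lap Y s3 = integral {m..1} (\<lambda>x. \<bar>F x\<bar> * lap Y (\<lambda>n. z x ^ Suc n * (L / (N * real (Suc n)))))"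
        unfolding s3_def
      proof (rule lap_integral[where K = "1 * (L / 1)"])
        fix n x assume x: "x \<in> {m..1}"
        have "L / (N * real (Suc n)) \<le> L / 1" using L kn[of n] kmin by (intro divide_left_mono) auto
        moreover have "L / (N * real (Suc n)) \<ge> 0" using L N by simp
        ultimately have "\<bar>L / (N * real (Suc n))\<bar> \<le> L / 1" by linarith
        then show "\<bar>z x ^ Suc n * (L / (N * real (Suc n)))\<bar> \<le> 1 * (L / 1)"
          unfolding abs_mult[of "z x ^ Suc n"] by (intro mult_mono z_pow x) auto
      qed (intro continuous_intros F cz)+
      moreover have "N * Y * lap Y (\<lambda>n. z x ^ Suc n * (L / (N * real (Suc n)))) = L * (1 - exp (- y N x))"
        if x: "x \<in> {m..1}" for x
      proof -
        have "\<bar>z x ^ Suc n / real (Suc n)\<bar> \<le> 1" for n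
          using frac_le[OF _ z_pow[OF x, of n], of 1 "real (Suc n)"] by (simp add: abs_divide del: power_Suc)
        from suminf_mult[OF lap_summable'[OF this], of "L / N" Y]
        have "lap Y (\<lambda>n. z x ^ Suc n * (L / (N * real (Suc n)))) = L / N * lap Y (\<lambda>n. z x ^ Suc n / real (Suc n))"
          by (simp add: lap_def mult_ac)
        then have "N * Y * lap Y (\<lambda>n. z x ^ Suc n * (L / (N * real (Suc n)))) = L * (Y * lap Y (\<lambda>n. z x ^ Suc n / real (Suc n)))"
          using N by simp
        also have "\<dots> = L * (1 - exp (- y N x))"
          using lap_exp_div[of Y "z x"] Y Yz[of x] by simp
        finally show ?thesis .
      qed
      ultimately have "N * Y * lap Y s3 = integral {m..1} (\<lambda>x. L * (\<bar>F x\<bar> * (1 - exp (- y N x))))"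
        by (simp only: integral_mult_right[symmetric]) (rule integral_cong, simp add: mult_ac)
      then show ?thesis by simp
    qed
    have l12: "\<bar>N * Y * lap Y (\<lambda>n. s1 n + s2 n)\<bar> \<le> K * err N"
    proof -
      have "\<bar>lap Y (\<lambda>n. s1 n + s2 n)\<bar> \<le> K * exp (- N * c) * exp (Y * exp (- N * c))"
        by (rule lap_bound[OF s]) (use Y in auto)
      then have "N * Y * \<bar>lap Y (\<lambda>n. s1 n + s2 n)\<bar> \<le> N * Y * (K * exp (- N * c) * exp (Y * exp (- N * c)))"
        using Y N by (intro mult_left_mono) auto
      moreover have "Y * exp (- N * c) = exp (- N * (c - \<tau> \<xi>))"
        by (simp add: Y_def mult_exp_exp algebra_simps)
      then have "N * Y * (K * exp (- N * c) * exp (Y * exp (- N * c))) = K * err N"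
        unfolding err_def by (metis (no_types, opaque_lifting) mult.assoc mult.left_commute)
      moreover have "\<bar>N * Y * lap Y (\<lambda>n. s1 n + s2 n)\<bar> = N * Y * \<bar>lap Y (\<lambda>n. s1 n + s2 n)\<bar>"
        using Y N by (simp add: abs_mult)
      ultimately show ?thesis by linarith
    qed
    have "lap Y (\<lambda>n. s1 n + s2 n) = lap Y s1 + lap Y s2" by (rule lap_add[OF s1b s2b])
    then have "N * Y * lap Y (\<lambda>n. s1 n + s2 n) = lim N + N * Y * lap Y s2"
      using l1 by (simp add: algebra_simps)
    moreover have "\<bar>N * Y * lap Y s2\<bar> \<le> N * Y * lap Y s3"
      using lap_maj[OF maj3, of Y] Y N by (simp add: abs_mult)
    ultimately have "\<bar>lim N\<bar> \<le> L * integral {m..1} (\<lambda>x. \<bar>F x\<bar> * (1 - exp (- y N x))) + K * err N"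
      using l12 l3 by linarith
    \<comment> \<open>Right of \<xi> the factor 1 - exp (- y) is at most 1. Left of \<xi> it is at
      most y, and y/\<eta> has integral at most 1/N there.\<close>
    moreover have "integral {m..1} (\<lambda>x. \<bar>F x\<bar> * (1 - exp (- y N x))) \<le> B / N + integral {\<xi>..1} (\<lambda>x. \<bar>F x\<bar>)"
    proof -
      let ?h = "\<lambda>x. \<bar>F x\<bar> * (1 - exp (- y N x))"
      have hi: "?h integrable_on {u..v}" if "m \<le> u" "v \<le> 1" for u v
      proof (rule integrable_on_subinterval)
        show "?h integrable_on {m..1}"
          unfolding y_def by (intro integrable_continuous_real continuous_intros F c\<tau>)
      qed (use that in auto)
      have Fi: "(\<lambda>x. \<bar>F x\<bar>) integrable_on {\<xi>..1}"
        by (rule integrable_on_subinterval[of _ "{m..1}"])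
          (use \<xi> in \<open>auto intro!: integrable_continuous_real continuous_intros F\<close>)
      have g: "((\<lambda>x. y N x / \<eta> x) has_integral (y N \<xi> - y N m) / N) {m..\<xi>}"
        using gumbel_kernel(2)[of m N m \<xi> "\<tau> \<xi>"] m \<xi> N by (simp add: y_def)
      have "integral {m..\<xi>} ?h \<le> integral {m..\<xi>} (\<lambda>x. B * (y N x / \<eta> x))"
      proof (rule integral_le[OF hi])
        show "(\<lambda>x. B * (y N x / \<eta> x)) integrable_on {m..\<xi>}"
          using g by (intro integrable_on_mult_right has_integral_integrable)
        show "?h x \<le> B * (y N x / \<eta> x)" if x: "x \<in> {m..\<xi>}" for x
        proof -
          have x1: "x \<in> {m..1}" using x \<xi> by auto
          have \<eta>: "\<eta> x > 0" using \<eta>_pos x1 m by auto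
          have "1 - exp (- y N x) \<le> y N x" using exp_ge_add_one_self[of "- y N x"] by simp
          then have "?h x \<le> \<bar>F x\<bar> * y N x" by (rule mult_left_mono) simp
          also have "\<dots> = \<bar>F x * \<eta> x\<bar> * (y N x / \<eta> x)" using \<eta> by (simp add: abs_mult)
          also have "\<dots> \<le> B * (y N x / \<eta> x)"
            using B(2)[OF x1] \<eta> by (intro mult_right_mono) (auto simp: y_def)
          finally show ?thesis .
        qed
      qed (use \<xi> in auto)
      also have "\<dots> = B * ((y N \<xi> - y N m) / N)" by (simp only: integral_mult_right integral_unique[OF g])
      also have "\<dots> \<le> B * (1 / N)"
        using B N by (intro mult_left_mono divide_right_mono) (auto simp: y_def)
      finally have "integral {m..\<xi>} ?h \<le> B / N" by simp
      moreover have "integral {\<xi>..1} ?h \<le> integral {\<xi>..1} (\<lambda>x. \<bar>F x\<bar>)"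
        by (rule integral_le[OF hi Fi]) (use \<xi> in \<open>auto simp: mult_left_le\<close>)
      moreover have "integral {m..1} ?h = integral {m..\<xi>} ?h + integral {\<xi>..1} ?h"
        by (rule Henstock_Kurzweil_Integration.integral_combine[symmetric]) (use \<xi> hi in auto)
      ultimately show ?thesis by linarith
    qed
    then have "L * integral {m..1} (\<lambda>x. \<bar>F x\<bar> * (1 - exp (- y N x))) \<le> L * (B / N + integral {\<xi>..1} (\<lambda>x. \<bar>F x\<bar>))"
      using L by (rule mult_left_mono)
    ultimately show ?thesis by (simp add: algebra_simps)
  qed
  have "(\<lambda>j. lim (real (Suc j))) \<longlonglongrightarrow> W \<xi>"
    using gumbel_limit[OF m \<xi> W] by (simp add: lim_def y_def)
  then have lim1: "(\<lambda>j. \<bar>lim (real (Suc j))\<bar>) \<longlonglongrightarrow> \<bar>W \<xi>\<bar>" by (rule tendsto_rabs)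
  have "c - \<tau> \<xi> > 0" using c by simp
  then have "(\<lambda>j. real (Suc j) * exp (- real (Suc j) * q) * exp (exp (- real (Suc j) * q))) \<longlonglongrightarrow> 0"
    if "q = c - \<tau> \<xi>" for q
    unfolding that[symmetric] by real_asymp
  then have "(\<lambda>j. err (real (Suc j))) \<longlonglongrightarrow> 0" by (simp only: err_def)
  moreover have "(\<lambda>j. L * B / real (Suc j)) \<longlonglongrightarrow> 0" by real_asymp
  ultimately have "(\<lambda>j. L * integral {\<xi>..1} (\<lambda>x. \<bar>F x\<bar>) + L * B / real (Suc j) + K * err (real (Suc j)))
      \<longlonglongrightarrow> L * integral {\<xi>..1} (\<lambda>x. \<bar>F x\<bar>) + 0 + K * 0"
    by (intro tendsto_intros)
  then have lim2: "(\<lambda>j. L * integral {\<xi>..1} (\<lambda>x. \<bar>F x\<bar>) + L * B / real (Suc j) + K * err (real (Suc j)))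
      \<longlonglongrightarrow> L * integral {\<xi>..1} (\<lambda>x. \<bar>F x\<bar>)" by simp
  have "\<bar>W \<xi>\<bar> \<le> L * integral {\<xi>..1} (\<lambda>x. \<bar>F x\<bar>)"
  proof (rule LIMSEQ_le[OF lim1 lim2])
    obtain N0 :: nat where "real N0 \<ge> kmin" using real_arch_simple by blast
    then show "\<exists>N. \<forall>n\<ge>N. \<bar>lim (real (Suc n))\<bar>
        \<le> L * integral {\<xi>..1} (\<lambda>x. \<bar>F x\<bar>) + L * B / real (Suc n) + K * err (real (Suc n))"
      by (intro exI[of _ N0] allI impI main) simp
  qed
  then show ?thesis by (simp add: W_def)
qed

end

section \<open>Uniqueness\<close>

text \<open>For j = C / (C + k) one has C/k = j / (1 - j), so C/k - j - j^2 = j^2 (C/k) by the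
  geometric series. Polynomials in j are thus absorbed into multiples of 1/k, the form that
  \<open>lap_exp_div\<close> evaluates.\<close>

lemma majorant_sum:
  assumes C: "C > 0" and N: "N > 0"
  shows "cms (\<lambda>n. C / (N * real (Suc n)) - (C / (C + N * real (Suc n)) + C / (C + N * real (Suc n)) * (C / (C + N * real (Suc n)))))"
proof -
  have cj: "cms (\<lambda>n. C / (C + N * real (n + 1)))" using cms_C(2) C N by simp
  have ck: "cms (\<lambda>n. C * (1 / (N + N * real n)))" using C N by (intro cms_cmult cms_inverse) auto
  have "cms (\<lambda>n. C / (C + N * real (n + 1)) * (C / (C + N * real (n + 1))) * (C * (1 / (N + N * real n))))"
    by (intro cms_mult[OF cms_mult[OF cj cj] ck])
  moreover have "C / (C + N * real (n + 1)) * (C / (C + N * real (n + 1))) * (C * (1 / (N + N * real n)))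
      = C / (N * real (Suc n)) - (C / (C + N * real (Suc n)) + C / (C + N * real (Suc n)) * (C / (C + N * real (Suc n))))" for n
  proof -
    define k where "k = N * real (Suc n)"
    have k: "k > 0" using N by (simp add: k_def)
    have e: "N + N * real n = k" "N * real (n + 1) = k" by (simp_all add: k_def algebra_simps)
    show ?thesis unfolding e k_def[symmetric] using k C
      by (simp add: divide_simps) (simp add: algebra_simps)
  qed
  ultimately show ?thesis by (simp only:)
qed

text \<open>Agreement on [x0, 1] makes both travel times equal at x0 and restricts the integral in
  the pointwise bound to [s, x0]. On a sufficiently short interval left of x0 this bound forces the
  difference to vanish.\<close>

lemma uniqueness_step:
  fixes a b u0 :: "real \<Rightarrow> real"
  assumes sola: "is_sol a \<alpha> u0 ua" and solb: "is_sol b \<beta> u0 ub"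
    and c0: "continuous_on {0..1} u0" and u01: "u0 1 = 0"
    and pa: "pa = (\<lambda>x. x powr \<alpha> * a x)" and pb: "pb = (\<lambda>x. x powr \<beta> * b x)"
    and ma: "medium pa pa' l" and mb: "medium pb pb' l"
    and dv: "\<And>x. x \<in> {l..1} \<Longrightarrow> (u0 has_real_derivative v x) (at x within {l..1})"
    and cv: "continuous_on {l..1} v"
    and \<delta>: "\<delta> > 0" "\<And>x. x \<in> {l..1} \<Longrightarrow> \<bar>v x\<bar> \<ge> \<delta>"
    and dq: "\<And>x. x \<in> {l..1} \<Longrightarrow> ((\<lambda>x. pb x * v x) has_real_derivative q1 x) (at x within {l..1})"
    and cq1: "continuous_on {l..1} q1"
    and t0: "t0 > 0" "\<forall>t\<in>{0<..<t0}. \<exists>d. ((\<lambda>x. ua x t) has_real_derivative d) (at 1 within {0..1}) \<and>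
           ((\<lambda>x. ub x t) has_real_derivative d) (at 1 within {0..1})"
    and x0: "l < x0" "x0 \<le> 1" and eq: "\<And>x. x \<in> {x0..1} \<Longrightarrow> pa x = pb x"
  shows "\<exists>x1. l \<le> x1 \<and> x1 < x0 \<and> (\<forall>x\<in>{x1..1}. pa x = pb x)"
proof -
  interpret A: medium pa pa' l by (rule ma)
  interpret B: medium pb pb' l by (rule mb)
  note l = A.l
  have one: "1 \<in> {l..1}" using l by simp
  define m where "m = (l + x0) / 2"
  have m: "l < m" "m < x0" "m < 1" using x0 by (auto simp: m_def)
  have \<tau>eq: "A.\<tau> x0 = B.\<tau> x0"
    unfolding A.\<tau>_def B.\<tau>_def by (rule integral_cong) (simp add: A.\<eta>_def B.\<eta>_def eq)
  define ct where "ct = min (A.\<tau> m) (B.\<tau> m)"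
  have ct: "A.\<tau> x0 < ct"
    using A.\<tau>_less[of m x0] B.\<tau>_less[of m x0] m x0 \<tau>eq by (simp add: ct_def)
  \<comment> \<open>The gap between c and ct absorbs the powers of \<kappa>; the gap between
    \<tau>(x0) and c leaves room for points \<xi> to the left of x0.\<close>
  define c where "c = (A.\<tau> x0 + ct) / 2"
  have c: "A.\<tau> x0 < c" "c < ct" using ct by (auto simp: c_def)
  have c0': "c \<ge> 0" using c A.\<tau>_nonneg[of x0] x0 by simp
  \<comment> \<open>Chosen so that \<open>B.\<eta> x * q x\<close> equals (pb u0')'. Then V = u0 + z
    satisfies \<kappa>^2 V - (pb V')' = \<kappa>^2 u0.\<close>
  define q where "q = (\<lambda>x. q1 x / B.\<eta> x)"
  have B\<eta>: "B.\<eta> x \<noteq> 0" if "x \<in> {l..1}" for x using B.\<eta>_pos[OF that] by simp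
  have cq: "continuous_on {l..1} q"
    unfolding q_def using B\<eta> by (intro continuous_on_divide cq1 B.cont_\<eta>) auto
  obtain Ca where Ca: "Ca > 0" "\<forall>C\<ge>Ca. \<exists>X. maj_family l A.opA C X"
    using A.opA_fixed_point by blast
  obtain Cb where Cb: "Cb > 0" "\<forall>C\<ge>Cb. \<exists>X. maj_family l B.opA C X"
    using B.opA_fixed_point by blast
  obtain Cg where Cg: "Cg > 0" "\<forall>C\<ge>Cg. \<exists>X. maj_family l (B.opG q) C X"
    using B.opG_fixed_point[OF cq] by blast
  define C where "C = Max {Ca, Cb, Cg}"
  have C: "C \<ge> Ca" "C \<ge> Cb" "C \<ge> Cg" "C > 0" using Ca(1) by (auto simp: C_def less_max_iff_disj)
  obtain Xa where fa: "maj_family l A.opA C Xa" using Ca(2) C(1) by blast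
  obtain Xb where fb: "maj_family l B.opA C Xb" using Cb(2) C(2) by blast
  obtain g where fg: "maj_family l (B.opG q) C g" using Cg(2) C(3) by blast
  note Xa = maj_familyD[OF fa] and Xb = maj_familyD[OF fb] and g = maj_familyD[OF fg]
  obtain Ka where Ka: "Ka > 0" "\<forall>\<kappa> X. \<kappa> \<ge> 1 \<longrightarrow> continuous_on {l..1} X \<longrightarrow> (\<forall>x\<in>{l..1}. X x = A.opA \<kappa> X x) \<longrightarrow>
    (\<forall>x\<in>{l..1}. \<bar>X x\<bar> \<le> 1 / 2) \<longrightarrow> (\<exists>\<psi> \<xi> \<rho> c. A.concentrated_test m Ka \<kappa> X \<psi> \<xi> \<rho> c)"
    using A.concentrated_test_exists[OF m(1,3)] by blast
  obtain Kb where Kb: "Kb > 0" "\<forall>\<kappa> X. \<kappa> \<ge> 1 \<longrightarrow> continuous_on {l..1} X \<longrightarrow> (\<forall>x\<in>{l..1}. X x = B.opA \<kappa> X x) \<longrightarrow>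
    (\<forall>x\<in>{l..1}. \<bar>X x\<bar> \<le> 1 / 2) \<longrightarrow> (\<exists>\<psi> \<xi> \<rho> c. B.concentrated_test m Kb \<kappa> X \<psi> \<xi> \<rho> c)"
    using B.concentrated_test_exists[OF m(1,3)] by blast
  define K where "K = max Ka Kb"
  have K: "Ka \<le> K" "Kb \<le> K" "K > 0" using Ka(1) by (auto simp: K_def)
  have p1: "pa 1 = pb 1" using eq x0 by simp
  obtain T U where T: "T > 0" and U: "U \<ge> 0" and data:
    "\<forall>\<kappa> \<psi>a \<xi>a \<rho>a \<psi>b \<xi>b \<rho>b M R. test_fun pa l \<kappa> \<psi>a \<xi>a \<rho>a \<longrightarrow> test_fun pb l \<kappa> \<psi>b \<xi>b \<rho>b \<longrightarrow>
    (\<forall>x\<in>{l..1}. \<bar>\<psi>a x\<bar> \<le> M \<and> \<bar>\<psi>b x\<bar> \<le> M \<and> \<bar>\<rho>a x\<bar> \<le> R \<and> \<bar>\<rho>b x\<bar> \<le> R) \<longrightarrow>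
    \<bar>integral {l..1} (\<lambda>x. u0 x * \<psi>a x) - integral {l..1} (\<lambda>x. u0 x * \<psi>b x)\<bar> \<le> U * (M * exp (- \<kappa>\<^sup>2 * T) + R)"
    using data_estimate[OF sola solb c0 l pa A.cont_p A.p_pos pb B.cont_p B.p_pos p1 t0] by blast
  have sub01: "{l..1} \<subseteq> {0..1}" using l by auto
  have cu: "continuous_on {l..1} u0" by (rule continuous_on_subset[OF c0 sub01])
  have "continuous_on {l..1} (\<lambda>x. 1 / (2 * B.\<eta> x))"
    using B\<eta> by (intro continuous_intros B.cont_\<eta>) auto
  moreover have cpp: "continuous_on {l..1} (\<lambda>x. (pa x - pb x) / pa x)"
    by (intro continuous_on_divide continuous_intros A.cont_p B.cont_p) (metis A.p_pos less_irrefl)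
  ultimately have "\<exists>M\<ge>1. \<forall>f\<in>{u0, v, A.\<nu>, \<lambda>x. 1 / (2 * B.\<eta> x), \<lambda>x. 1 / A.\<eta> x, \<lambda>x. (pa x - pb x) / pa x}.
      \<forall>x\<in>{l..1}. \<bar>f x\<bar> \<le> M"
    using cu cv A.cont_\<nu> A.cont_inv_\<eta> by (intro continuous_on_Icc_common_bound) simp_all
  then obtain M where M: "M \<ge> 1" and bdM:
    "\<forall>f\<in>{u0, v, A.\<nu>, \<lambda>x. 1 / (2 * B.\<eta> x), \<lambda>x. 1 / A.\<eta> x, \<lambda>x. (pa x - pb x) / pa x}. \<forall>x\<in>{l..1}. \<bar>f x\<bar> \<le> M"
    by blast
  have uM: "\<bar>u0 x\<bar> \<le> M" and vM: "\<bar>v x\<bar> \<le> M" and \<nu>M: "\<bar>A.\<nu> x\<bar> \<le> M" and sM: "\<bar>1 / (2 * B.\<eta> x)\<bar> \<le> M"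
    and eM: "\<bar>1 / A.\<eta> x\<bar> \<le> M" and pM: "\<bar>(pa x - pb x) / pa x\<bar> \<le> M" if "x \<in> {l..1}" for x
    using bdM that by simp_all
  \<comment> \<open>The last factor splits off the shift in \<kappa> = 2 C + k. All factors except
    pa - pb are nonzero, so \<open>F\<close> vanishes exactly where the coefficients agree.\<close>
  define F where "F = (\<lambda>x. (pa x - pb x) / pa x * sqrt (A.\<eta> x) * exp (- (2 * C) * A.\<tau> x))"
  have cF: "continuous_on {l..1} F"
    unfolding F_def by (intro continuous_intros cpp A.cont_\<eta> A.cont_\<tau>)
  define gg where "gg = (\<lambda>k x. g (2 * C + k) x / (2 * B.\<eta> x))"
  define r where "r = (\<lambda>k x. - integral {x..1} (\<lambda>s. A.\<nu> s * Xa (2 * C + k) s) - Xa (2 * C + k) x)"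
  define E where "E = (\<lambda>k x. (v x + gg k x) * (1 + r k x) - v x)"
  have cgg: "continuous_on {l..1} (gg k)" if "k \<ge> 0" for k
    unfolding gg_def using that B\<eta> by (intro continuous_intros g B.cont_\<eta>) auto
  have cE: "continuous_on {l..1} (E k)" if "k \<ge> 0" for k
    unfolding E_def r_def using that
    by (intro continuous_intros cgg cv Xa A.integral_\<nu>) auto
  \<comment> \<open>E = v r + gg + gg r has majorants M (M + 1) j, M j and M (M + 1) j^2; the three
    coefficients are added, and j + j^2 lies below C/k.\<close>
  define L where "L = (M * (M + 1) + M + M * (M + 1)) * C"
  have L: "L \<ge> 0" using M C by (auto simp: L_def)
  have Emaj: "maj (\<lambda>n. E (N * real (Suc n)) x) (\<lambda>n. L / (N * real (Suc n)))"
    if N: "N > 0" and x: "x \<in> {l..1}" for N x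
  proof -
    define j where "j = (\<lambda>n. C / (C + N * real (n + 1)))"
    have cj: "cms j" unfolding j_def using cms_C(2) C N by simp
    have N0: "N \<ge> 0" using N by simp
    have kap: "2 * C + N * real (n + 1) \<ge> 2 * C" for n using N by simp
    have I: "maj (\<lambda>n. integral {x..1} (\<lambda>s. A.\<nu> s * Xa (2 * C + N * real (n + 1)) s)) (\<lambda>n. M * j n)"
      by (rule A.maj_integral_\<nu>[OF Xa(1)[OF kap] _ \<nu>M x]) (use Xa(3)[OF N0] in \<open>simp_all add: j_def\<close>)
    have rm: "maj (\<lambda>n. r (N * real (Suc n)) x) (\<lambda>n. M * j n + j n)"
      using maj_diff[OF maj_uminus[OF I] Xa(3)[OF N0 x]] by (simp add: r_def j_def)
    have "maj (\<lambda>n. 1 / (2 * B.\<eta> x) * g (2 * C + N * real (n + 1)) x) (\<lambda>n. M * j n)"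
      unfolding j_def by (rule maj_cmult[OF sM[OF x] g(3)[OF N0 x]])
    then have gm: "maj (\<lambda>n. gg (N * real (Suc n)) x) (\<lambda>n. M * j n)"
      by (simp add: gg_def)
    have "maj (\<lambda>n. v x * r (N * real (Suc n)) x + gg (N * real (Suc n)) x + gg (N * real (Suc n)) x * r (N * real (Suc n)) x)
       (\<lambda>n. M * (M * j n + j n) + M * j n + (M * j n) * (M * j n + j n))"
      by (intro maj_add maj_mult maj_cmult[OF vM[OF x]] rm gm)
    then have "maj (\<lambda>n. E (N * real (Suc n)) x) (\<lambda>n. M * (M * j n + j n) + M * j n + (M * j n) * (M * j n + j n))"
      by (simp add: E_def algebra_simps)
    then show ?thesis
    proof (rule maj_trans)
      have L': "L / (N * real (Suc n)) = (M * (M + 1) + M + M * (M + 1)) * (C / (N * real (Suc n)))" for n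
        by (simp add: L_def)
      define D where "D = (\<lambda>n. C / (N * real (Suc n)) - (j n + j n * j n))"
      have "cms D" unfolding D_def j_def using majorant_sum[OF C(4) N] by simp
      then have "cms (\<lambda>n. (M * (M + 1) + M + M * (M + 1)) * D n + ((M * (M + 1) + M) * (j n * j n) + M * (M + 1) * j n))"
        using M by (intro cms_add cms_cmult cms_mult[OF cj cj] cj) auto
      moreover have "(M * (M + 1) + M + M * (M + 1)) * D n + ((M * (M + 1) + M) * (j n * j n) + M * (M + 1) * j n)
          = L / (N * real (Suc n)) - (M * (M * j n + j n) + M * j n + (M * j n) * (M * j n + j n))" for n
        unfolding L' D_def by (simp only: algebra_simps)
      ultimately show "cms (\<lambda>n. L / (N * real (Suc n)) - (M * (M * j n + j n) + M * j n + (M * j n) * (M * j n + j n)))"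
        by (simp only:)
    qed
  qed
  have "\<forall>\<^sub>F \<kappa> in at_top. \<kappa> ^ 3 * (exp (- \<kappa>\<^sup>2 * T) + exp (- \<kappa> * ct)) \<le> exp (- \<kappa> * c)"
    using c c0' T by real_asymp
  \<comment> \<open>The cube consists of \<kappa>^2 from the orthogonality identity and one \<kappa>
    from the bound on the defects.\<close>
  then obtain \<kappa>0 where \<kappa>0: "\<And>\<kappa>. \<kappa> \<ge> \<kappa>0 \<Longrightarrow> \<kappa> ^ 3 * (exp (- \<kappa>\<^sup>2 * T) + exp (- \<kappa> * ct)) \<le> exp (- \<kappa> * c)"
    by (auto simp: eventually_at_top_linorder)
  define k0 where "k0 = Max {1, C, \<kappa>0}"
  have k0: "k0 \<ge> 1" "k0 \<ge> C" "k0 \<ge> \<kappa>0" by (auto simp: k0_def)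
  define Q where "Q = U * K + 2 * (M + M) * K + M * (M + M) * K"
  have Q: "Q \<ge> 0" unfolding Q_def using U K M by auto
  have H: "\<bar>integral {m..1} (\<lambda>x. F x * exp (- k * A.\<tau> x) * (v x + E k x))\<bar> \<le> (K * Q) * exp (- k * c)"
    if k: "k \<ge> k0" for k
  proof -
    define \<kappa> where "\<kappa> = 2 * C + k"
    have \<kappa>: "\<kappa> \<ge> 2 * C" "\<kappa> \<ge> 1" "\<kappa> \<ge> \<kappa>0" "\<kappa> > 0" "\<kappa> \<ge> k" and kC: "k \<ge> C" "k \<ge> 0"
      using k k0 C by (auto simp: \<kappa>_def)
    define R where "R = K * \<kappa> * exp (- \<kappa> * ct)"
    have R0: "R \<ge> 0" using K \<kappa> by (simp add: R_def)
    have R: "K' * \<kappa> * exp (- \<kappa> * t) \<le> R" if "K' \<le> K" "ct \<le> t" "K' > 0" for K' t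
      unfolding R_def using that \<kappa> by (intro mult_mono) auto
    have ctm: "ct \<le> A.\<tau> m" "ct \<le> B.\<tau> m" by (auto simp: ct_def)
    have ha: "\<forall>x\<in>{l..1}. \<bar>Xa \<kappa> x\<bar> \<le> 1 / 2" unfolding \<kappa>_def by (rule maj_family_half[OF fa C(4) kC(1)])
    have hb: "\<forall>x\<in>{l..1}. \<bar>Xb \<kappa> x\<bar> \<le> 1 / 2" unfolding \<kappa>_def by (rule maj_family_half[OF fb C(4) kC(1)])
    have hg: "\<forall>x\<in>{l..1}. \<bar>g \<kappa> x\<bar> \<le> 1 / 2" unfolding \<kappa>_def by (rule maj_family_half[OF fg C(4) kC(1)])
    obtain \<psi>a \<xi>a \<rho>a ca where "A.concentrated_test m Ka \<kappa> (Xa \<kappa>) \<psi>a \<xi>a \<rho>a ca"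
      using Ka(2) \<kappa>(2) Xa(1)[OF \<kappa>(1)] Xa(2)[OF \<kappa>(1)] ha by blast
    then have ta: "test_fun pa l \<kappa> \<psi>a \<xi>a \<rho>a"
      and ba: "\<forall>x\<in>{l..1}. \<bar>\<psi>a x\<bar> \<le> Ka \<and> \<bar>\<rho>a x\<bar> \<le> Ka * \<kappa> * exp (- \<kappa> * A.\<tau> m)"
      and xa: "\<forall>x\<in>{l..m}. \<bar>\<xi>a x\<bar> \<le> Ka * \<kappa> * exp (- \<kappa> * A.\<tau> m)"
      and ca: "ca \<ge> 1 / Ka"
      and xa1: "\<forall>x\<in>{m..1}. \<xi>a x = ca * (sqrt (A.\<eta> x) * exp (- \<kappa> * A.\<tau> x) * (1 - integral {x..1} (\<lambda>s. A.\<nu> s * Xa \<kappa> s) - Xa \<kappa> x))"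
      unfolding A.concentrated_test_def by blast+
    obtain \<psi>b \<xi>b \<rho>b cb where "B.concentrated_test m Kb \<kappa> (Xb \<kappa>) \<psi>b \<xi>b \<rho>b cb"
      using Kb(2) \<kappa>(2) Xb(1)[OF \<kappa>(1)] Xb(2)[OF \<kappa>(1)] hb by blast
    then have tb: "test_fun pb l \<kappa> \<psi>b \<xi>b \<rho>b"
      and bb: "\<forall>x\<in>{l..1}. \<bar>\<psi>b x\<bar> \<le> Kb \<and> \<bar>\<rho>b x\<bar> \<le> Kb * \<kappa> * exp (- \<kappa> * B.\<tau> m)"
      unfolding B.concentrated_test_def by blast+
    have bd: "\<forall>x\<in>{l..1}. \<bar>\<psi>a x\<bar> \<le> K \<and> \<bar>\<psi>b x\<bar> \<le> K \<and> \<bar>\<rho>a x\<bar> \<le> R \<and> \<bar>\<rho>b x\<bar> \<le> R"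
      using ba bb K(1,2) R[OF K(1) ctm(1) Ka(1)] R[OF K(2) ctm(2) Kb(1)] by (meson order_trans)
    have xaR: "\<bar>\<xi>a x\<bar> \<le> R" if "x \<in> {l..m}" for x
      using xa that R[OF K(1) ctm(1) Ka(1)] by (meson order_trans)
    define \<Delta> where "\<Delta> = integral {l..1} (\<lambda>x. u0 x * \<psi>a x) - integral {l..1} (\<lambda>x. u0 x * \<psi>b x)"
    have \<Delta>: "\<bar>\<Delta>\<bar> \<le> U * (K * exp (- \<kappa>\<^sup>2 * T) + R)"
      unfolding \<Delta>_def using data ta tb bd by blast
    obtain z where z1: "z 1 = 0"
      and dz: "\<And>x. x \<in> {l..1} \<Longrightarrow> (z has_real_derivative g \<kappa> x / (2 * B.\<eta> x)) (at x within {l..1})"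
      and dZ: "\<And>x. x \<in> {l..1} \<Longrightarrow>
        ((\<lambda>x. B.\<eta> x * g \<kappa> x / 2) has_real_derivative \<kappa>\<^sup>2 * z x - B.\<eta> x * q x) (at x within {l..1})"
      using B.z_solution[OF \<kappa>(4) cq g(1)[OF \<kappa>(1)] g(2)[OF \<kappa>(1), rule_format]] by blast
    define V where "V = (\<lambda>x. u0 x + z x)"
    define V' where "V' = (\<lambda>x. v x + gg k x)"
    have ggz: "gg k x = g \<kappa> x / (2 * B.\<eta> x)" for x by (simp add: gg_def \<kappa>_def)
    have ggb: "\<bar>gg k x\<bar> \<le> M" if x: "x \<in> {l..1}" for x
    proof -
      have "\<bar>gg k x\<bar> = \<bar>g \<kappa> x\<bar> * \<bar>1 / (2 * B.\<eta> x)\<bar>" by (simp add: ggz abs_mult abs_divide)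
      also have "\<dots> \<le> 1 * M" proof (rule mult_mono[OF _ sM[OF x]])
        show "\<bar>g \<kappa> x\<bar> \<le> 1" using bspec[OF hg x] by linarith
      qed auto
      finally show ?thesis by simp
    qed
    have zb: "\<bar>z x\<bar> \<le> M" if x: "x \<in> {l..1}" for x
    proof -
      have "norm (z x - z 1) \<le> M * norm (x - 1)"
        by (rule field_differentiable_bound[where S = "{l..1}" and f' = "gg k"])
          (use dz ggb x one in \<open>auto simp: ggz\<close>)
      also have "\<dots> \<le> M * 1" using x l M by (intro mult_left_mono) auto
      finally show ?thesis by (simp add: z1)
    qed
    have cV': "continuous_on {l..1} V'" unfolding V'_def by (intro continuous_intros cv cgg kC)
    have dV: "(V has_real_derivative V' x) (at x within {l..1})" if x: "x \<in> {l..1}" for x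
      unfolding V_def V'_def ggz by (rule DERIV_add[OF dv[OF x] dz[OF x]])
    have cV: "continuous_on {l..1} V" by (rule DERIV_continuous_on[OF dV])
    have dY: "((\<lambda>x. pb x * V' x) has_real_derivative \<kappa>\<^sup>2 * (V x - u0 x)) (at x within {l..1})" if x: "x \<in> {l..1}" for x
    proof -
      have "((\<lambda>x. pb x * v x + B.\<eta> x * g \<kappa> x / 2) has_real_derivative \<kappa>\<^sup>2 * (V x - u0 x)) (at x within {l..1})"
        by (rule DERIV_cong[OF DERIV_add[OF dq[OF x] dZ[OF x]]]) (use B\<eta>[OF x] in \<open>simp add: V_def q_def\<close>)
      then show ?thesis
      proof (rule has_field_derivative_transform_within[OF _ zero_less_one x])
        fix y assume y: "y \<in> {l..1}"
        show "pb y * v y + B.\<eta> y * g \<kappa> y / 2 = pb y * V' y"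
          unfolding V'_def ggz B.\<eta>_square[OF y, symmetric] using B\<eta>[OF y] by (simp add: field_simps)
      qed
    qed
    let ?P = "\<lambda>x. (pa x - pb x) * V' x * (\<xi>a x / pa x)"
    have V1: "V 1 = 0" by (simp add: V_def u01 z1)
    have ident: "integral {l..1} ?P = - \<kappa>\<^sup>2 * \<Delta> - integral {l..1} (\<lambda>x. V x * \<rho>a x) + integral {l..1} (\<lambda>x. V x * \<rho>b x)"
      unfolding \<Delta>_def
      by (rule orthogonality_identity[OF l(2) ta tb A.p_pos B.p_pos A.cont_p B.cont_p cu cV' dV V1 dY])
    have V\<rho>: "\<bar>integral {l..1} (\<lambda>x. V x * \<rho> x)\<bar> \<le> (M + M) * R"
      if "continuous_on {l..1} \<rho>" "\<And>x. x \<in> {l..1} \<Longrightarrow> \<bar>\<rho> x\<bar> \<le> R" for \<rho>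
    proof -
      have "norm (integral {l..1} (\<lambda>x. V x * \<rho> x)) \<le> ((M + M) * R) * (1 - l)"
      proof (rule integral_bound)
        show "continuous_on {l..1} (\<lambda>x. V x * \<rho> x)" by (intro continuous_intros cV that)
        show "norm (V x * \<rho> x) \<le> (M + M) * R" if x: "x \<in> {l..1}" for x
        proof -
          have "\<bar>V x\<bar> \<le> M + M" using uM[OF x] zb[OF x] by (simp add: V_def)
          then show ?thesis unfolding real_norm_def abs_mult
            using \<open>\<And>x. x \<in> {l..1} \<Longrightarrow> \<bar>\<rho> x\<bar> \<le> R\<close>[OF x] M by (intro mult_mono) auto
        qed
      qed (use l in simp)
      also have "\<dots> \<le> (M + M) * R" using l M R0 by (intro mult_left_le) auto
      finally show ?thesis by simp
    qed
    have cxa: "continuous_on {l..1} \<xi>a" by (rule test_fun_cont(2)[OF ta])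
    have cP: "continuous_on {l..1} ?P"
      by (intro continuous_intros A.cont_p B.cont_p cV' cxa) (metis A.p_pos less_irrefl)
    have "norm (integral {l..m} ?P) \<le> (M * (M + M) * R) * (m - l)"
    proof (rule integral_bound)
      show "continuous_on {l..m} ?P" by (rule continuous_on_subset[OF cP]) (use m in auto)
      show "norm (?P x) \<le> M * (M + M) * R" if x: "x \<in> {l..m}" for x
      proof -
        have x1: "x \<in> {l..1}" using x m by auto
        have "\<bar>V' x\<bar> \<le> M + M" using vM[OF x1] ggb[OF x1] by (simp add: V'_def)
        moreover have "norm (?P x) = \<bar>(pa x - pb x) / pa x\<bar> * \<bar>V' x\<bar> * \<bar>\<xi>a x\<bar>"
          by (simp add: abs_mult abs_divide)
        ultimately show ?thesis
          using pM[OF x1] xaR[OF x] M by (simp only:) (intro mult_mono, auto)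
      qed
    qed (use m in simp)
    also have "\<dots> \<le> M * (M + M) * R" using m l M R0 by (intro mult_left_le) auto
    finally have P1: "\<bar>integral {l..m} ?P\<bar> \<le> M * (M + M) * R" by simp
    have split: "integral {l..1} ?P = integral {l..m} ?P + integral {m..1} ?P"
      by (rule Henstock_Kurzweil_Integration.integral_combine[symmetric])
        (use m in simp, use m in simp, rule integrable_continuous_real[OF cP])
    have "integral {m..1} ?P = integral {m..1} (\<lambda>x. ca * (F x * exp (- k * A.\<tau> x) * (v x + E k x)))"
    proof (rule integral_cong)
      fix x assume x: "x \<in> {m..1}"
      have e: "exp (- \<kappa> * A.\<tau> x) = exp (- (2 * C) * A.\<tau> x) * exp (- k * A.\<tau> x)"
        by (simp add: mult_exp_exp \<kappa>_def algebra_simps)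
      have "v x + E k x = V' x * (1 + r k x)" by (simp add: E_def V'_def)
      moreover have "\<xi>a x = ca * (sqrt (A.\<eta> x) * (exp (- (2 * C) * A.\<tau> x) * exp (- k * A.\<tau> x)) * (1 + r k x))"
        using xa1 x unfolding e[symmetric] by (simp add: r_def \<kappa>_def)
      ultimately show "?P x = ca * (F x * exp (- k * A.\<tau> x) * (v x + E k x))"
        by (simp add: F_def mult_ac)
    qed
    then have P2: "integral {m..1} ?P = ca * integral {m..1} (\<lambda>x. F x * exp (- k * A.\<tau> x) * (v x + E k x))"
      by (simp only: integral_mult_right)
    define J where "J = integral {m..1} (\<lambda>x. F x * exp (- k * A.\<tau> x) * (v x + E k x))"
    define e1 where "e1 = exp (- \<kappa>\<^sup>2 * T)"
    define e2 where "e2 = exp (- \<kappa> * ct)"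
    have e0: "e1 \<ge> 0" "e2 \<ge> 0" by (auto simp: e1_def e2_def)
    have "\<bar>ca * J\<bar> \<le> \<kappa>\<^sup>2 * (U * (K * e1 + R)) + 2 * ((M + M) * R) + M * (M + M) * R"
    proof -
      have "\<bar>\<kappa>\<^sup>2 * \<Delta>\<bar> \<le> \<kappa>\<^sup>2 * (U * (K * e1 + R))"
        unfolding abs_mult e1_def using \<Delta> by (simp add: mult_left_mono)
      moreover have "\<bar>integral {l..1} (\<lambda>x. V x * \<rho>a x)\<bar> \<le> (M + M) * R" "\<bar>integral {l..1} (\<lambda>x. V x * \<rho>b x)\<bar> \<le> (M + M) * R"
        using bd by (blast intro: V\<rho> test_fun_cont(3)[OF ta] test_fun_cont(3)[OF tb])+
      moreover have "ca * J = - (\<kappa>\<^sup>2 * \<Delta>) - integral {l..1} (\<lambda>x. V x * \<rho>a x) + integral {l..1} (\<lambda>x. V x * \<rho>b x) - integral {l..m} ?P"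
        using ident split P2 by (simp add: J_def)
      ultimately show ?thesis using P1 by linarith
    qed
    also have "\<dots> \<le> Q * (\<kappa> ^ 3 * (e1 + e2))"
    proof -
      have R_eq: "R = K * (\<kappa> * e2)" by (simp add: R_def e2_def)
      have k23: "\<kappa>\<^sup>2 \<le> \<kappa> ^ 3" "\<kappa> \<le> \<kappa> ^ 3"
        using power_increasing[OF _ \<kappa>(2), of 2 3] power_increasing[OF _ \<kappa>(2), of 1 3] by auto
      have "\<kappa>\<^sup>2 * (K * e1 + R) = K * (\<kappa>\<^sup>2 * e1 + \<kappa> ^ 3 * e2)"
        by (simp add: R_eq algebra_simps power2_eq_square power3_eq_cube)
      also have "\<dots> \<le> K * (\<kappa> ^ 3 * (e1 + e2))"
        using k23 e0 K by (simp add: distrib_left mult_right_mono)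
      finally have "U * (\<kappa>\<^sup>2 * (K * e1 + R)) \<le> U * (K * (\<kappa> ^ 3 * (e1 + e2)))"
        using U by (rule mult_left_mono)
      moreover have "R \<le> K * (\<kappa> ^ 3 * (e1 + e2))"
        unfolding R_eq using k23 e0 K \<kappa> by (intro mult_left_mono mult_mono) auto
      then have "2 * (M + M) * R \<le> 2 * (M + M) * (K * (\<kappa> ^ 3 * (e1 + e2)))"
          "M * (M + M) * R \<le> M * (M + M) * (K * (\<kappa> ^ 3 * (e1 + e2)))"
        using M by (auto intro!: mult_left_mono)
      ultimately show ?thesis by (simp add: Q_def algebra_simps)
    qed
    also have "\<dots> \<le> Q * exp (- k * c)"
    proof (rule mult_left_mono[OF _ Q])
      have "\<kappa> ^ 3 * (e1 + e2) \<le> exp (- \<kappa> * c)" unfolding e1_def e2_def by (rule \<kappa>0[OF \<kappa>(3)])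
      also have "\<dots> \<le> exp (- k * c)" using \<kappa>(5) c0' by (simp add: mult_right_mono)
      finally show "\<kappa> ^ 3 * (e1 + e2) \<le> exp (- k * c)" .
    qed
    finally have caJ: "\<bar>ca * J\<bar> \<le> Q * exp (- k * c)" .
    \<comment> \<open>The amplitude of the test function depends on \<kappa>; its lower bound allows
      it to be divided out uniformly.\<close>
    have "1 \<le> K * ca"
    proof -
      have "1 \<le> Ka * ca" using ca Ka(1) by (simp add: field_simps)
      moreover have "ca > 0" using ca Ka(1) by (smt (verit) divide_pos_pos)
      ultimately show ?thesis using mult_right_mono[OF K(1), of ca] by linarith
    qed
    then have "1 * \<bar>J\<bar> \<le> K * ca * \<bar>J\<bar>" by (rule mult_right_mono) simp
    also have "\<dots> \<le> K * \<bar>ca * J\<bar>"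
      using K by (simp add: abs_mult mult_right_mono)
    also have "\<dots> \<le> K * (Q * exp (- k * c))" using caJ K by (intro mult_left_mono) auto
    finally show ?thesis by (simp add: J_def)
  qed
  have subm: "{m..1} \<subseteq> {l..1}" using m by auto
  have point: "\<bar>F \<xi> * v \<xi> * A.\<eta> \<xi>\<bar> \<le> L * integral {\<xi>..1} (\<lambda>x. \<bar>F x\<bar>)"
    if \<xi>: "m < \<xi>" "\<xi> < 1" "A.\<tau> \<xi> < c" for \<xi>
  proof (rule A.pointwise_bound[where m = m and c = c and E = E and K = "K * Q" and kmin = k0 and v = v])
    show "continuous_on {m..1} (E k)" if "k \<ge> k0" for k
      using cE[of k] that k0 subm by (auto intro: continuous_on_subset)
    show "maj (\<lambda>n. E (N * real (Suc n)) x) (\<lambda>n. L / (N * real (Suc n)))" if "N \<ge> k0" "x \<in> {m..1}" for N x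
      using that k0 subm by (intro Emaj) auto
    show "continuous_on {m..1} F" "continuous_on {m..1} v"
      by (rule continuous_on_subset[OF cF subm], rule continuous_on_subset[OF cv subm])
  qed (use \<xi> m L k0 H in auto)
  have F0: "F x = 0" if "x \<in> {x0..1}" for x using eq[OF that] by (simp add: F_def)
  have "\<exists>d>0. \<forall>x\<in>{l..1}. dist x x0 < d \<longrightarrow> dist (A.\<tau> x) (A.\<tau> x0) < c - A.\<tau> x0"
    using A.cont_\<tau>[unfolded continuous_on_iff, rule_format, of x0 "c - A.\<tau> x0"] x0 c by simp
  then obtain d where d: "d > 0" "\<And>x. x \<in> {l..1} \<Longrightarrow> dist x x0 < d \<Longrightarrow> dist (A.\<tau> x) (A.\<tau> x0) < c - A.\<tau> x0"
    by blast
  \<comment> \<open>The first entry keeps the travel time below c, the second keeps the interval to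
    the right of m, and the third makes h L at most half of \<delta>/M, a lower bound for |v|
    \<eta>. Using L + 1 covers L = 0.\<close>
  define h where "h = Min {d / 2, (x0 - m) / 2, \<delta> / (2 * M * (L + 1))}"
  have h: "h > 0" "h < d" "h < x0 - m" "h * L \<le> \<delta> / (2 * M)"
  proof -
    have pos: "\<delta> / (2 * M * (L + 1)) > 0" using \<delta> M L by (intro divide_pos_pos mult_pos_pos) auto
    then show h0: "h > 0" using d m by (auto simp: h_def)
    show "h < d" "h < x0 - m" using d m by (auto simp: h_def min_less_iff_disj)
    have "h * L \<le> h * (L + 1)" using h0 by simp
    also have "\<dots> \<le> \<delta> / (2 * M * (L + 1)) * (L + 1)" using L by (intro mult_right_mono) (auto simp: h_def)
    also have "\<dots> = \<delta> / (2 * M)" using L by simp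
    finally show "h * L \<le> \<delta> / (2 * M)" .
  qed
  define x1 where "x1 = x0 - h"
  have x1: "m < x1" "x1 < x0" using h by (auto simp: x1_def)
  have sub1: "{x1..x0} \<subseteq> {l..1}" using x1 m x0 by auto
  have "continuous_on {x1..x0} (\<lambda>x. \<bar>F x\<bar>)"
    by (intro continuous_intros continuous_on_subset[OF cF sub1])
  \<comment> \<open>At a maximum point of |F| the integral is at most h |F(s)|, so the pointwise
    bound says that (\<delta>/M) |F(s)| is at most half of itself.\<close>
  then obtain s where s: "s \<in> {x1..x0}" "\<And>x. x \<in> {x1..x0} \<Longrightarrow> \<bar>F x\<bar> \<le> \<bar>F s\<bar>"
    using continuous_attains_sup[of "{x1..x0}" "\<lambda>x. \<bar>F x\<bar>"] x1 by auto
  have "F s = 0"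
  proof (cases "s = x0")
    case True
    then show ?thesis using F0 x0 by simp
  next
    case False
    then have s': "m < s" "s < x0" "s < 1" "s \<in> {l..1}" using s x1 x0 m by auto
    have "\<bar>A.\<tau> s - A.\<tau> x0\<bar> < c - A.\<tau> x0"
      using d(2)[OF s'(4)] s s'(2) h by (simp add: dist_real_def x1_def)
    then have "\<bar>F s * v s * A.\<eta> s\<bar> \<le> L * integral {s..1} (\<lambda>x. \<bar>F x\<bar>)"
      using s' by (intro point) auto
    also have "integral {s..1} (\<lambda>x. \<bar>F x\<bar>) \<le> h * \<bar>F s\<bar>"
    proof -
      have Fi: "(\<lambda>x. \<bar>F x\<bar>) integrable_on {u..w}" if "{u..w} \<subseteq> {l..1}" for u w
        by (intro integrable_continuous_real continuous_intros continuous_on_subset[OF cF that])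
      have "integral {s..1} (\<lambda>x. \<bar>F x\<bar>) = integral {s..x0} (\<lambda>x. \<bar>F x\<bar>) + integral {x0..1} (\<lambda>x. \<bar>F x\<bar>)"
        using s' x0 by (intro Henstock_Kurzweil_Integration.integral_combine[symmetric] Fi) auto
      also have "integral {x0..1} (\<lambda>x. \<bar>F x\<bar>) = integral {x0..1} (\<lambda>x. 0)"
        by (rule integral_cong) (simp add: F0)
      also have "integral {s..x0} (\<lambda>x. \<bar>F x\<bar>) \<le> integral {s..x0} (\<lambda>x. \<bar>F s\<bar>)"
        using s s' x0 by (intro integral_le Fi) auto
      also have "\<dots> = (x0 - s) * \<bar>F s\<bar>" using s' by simp
      also have "\<dots> \<le> h * \<bar>F s\<bar>" using s by (intro mult_right_mono) (auto simp: x1_def)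
      finally show ?thesis by simp
    qed
    finally have "\<bar>F s * v s * A.\<eta> s\<bar> \<le> L * (h * \<bar>F s\<bar>)" using L by (simp add: mult_left_mono)
    also have "\<dots> = (h * L) * \<bar>F s\<bar>" by simp
    also have "\<dots> \<le> \<delta> / (2 * M) * \<bar>F s\<bar>" using h(4) by (rule mult_right_mono) simp
    finally have up: "\<bar>F s * v s * A.\<eta> s\<bar> \<le> \<delta> / (2 * M) * \<bar>F s\<bar>" .
    have "1 / M \<le> A.\<eta> s"
      using eM[OF s'(4)] A.\<eta>_pos[OF s'(4)] M by (simp add: field_simps)
    then have "\<bar>F s\<bar> * \<delta> * (1 / M) \<le> \<bar>F s\<bar> * \<bar>v s\<bar> * A.\<eta> s"
      using \<delta>(1) \<delta>(2)[OF s'(4)] M by (intro mult_mono) auto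
    also have "\<dots> = \<bar>F s * v s * A.\<eta> s\<bar>" using A.\<eta>_pos[OF s'(4)] by (simp add: abs_mult)
    finally have "\<delta> / M * \<bar>F s\<bar> \<le> \<delta> / M * \<bar>F s\<bar> / 2" using up by (simp add: mult_ac)
    moreover have "t \<le> 0" if "t \<le> t / 2" for t :: real using that by simp
    ultimately have "\<delta> / M * \<bar>F s\<bar> \<le> 0" by blast
    moreover have "\<delta> / M * \<bar>F s\<bar> > 0" if "F s \<noteq> 0"
      using that \<delta>(1) M by (intro mult_pos_pos) auto
    ultimately show ?thesis by linarith
  qed
  then have Fz: "F x = 0" if "x \<in> {x1..1}" for x
    using s(2)[of x] F0[of x] that by (cases "x \<le> x0") auto
  have "pa x = pb x" if x: "x \<in> {x1..1}" for x
  proof -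
    have "x \<in> {l..1}" using x x1 m by auto
    then show ?thesis using Fz[OF x] A.p_pos[of x] A.\<eta>_pos[of x] by (simp add: F_def)
  qed
  then show ?thesis using x1 m by (intro exI[of _ x1]) auto
qed

section \<open>From the coefficient classes to media, and continuation of the agreement\<close>

lemma Ck_on_derivatives:
  assumes "Ck_on k f" "k \<ge> 2"
  obtains f' f'' where "\<And>x. x \<in> {0..1} \<Longrightarrow> (f has_real_derivative f' x) (at x within {0..1})"
    and "\<And>x. x \<in> {0..1} \<Longrightarrow> (f' has_real_derivative f'' x) (at x within {0..1})"
    and "continuous_on {0..1} f''"
proof -
  obtain D where D: "D 0 = f" "\<forall>j<k. \<forall>x\<in>{0..1}. (D j has_real_derivative D (Suc j) x) (at x within {0..1})"
      "continuous_on {0..1} (D k)"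
    using assms(1) unfolding Ck_on_def by blast
  show ?thesis
  proof (rule that[of "D 1" "D 2"])
    show "(f has_real_derivative D 1 x) (at x within {0..1})" if "x \<in> {0..1}" for x
      using D(2)[rule_format, of 0 x] assms(2) that D(1) by simp
    show "(D 1 has_real_derivative D 2 x) (at x within {0..1})" if "x \<in> {0..1}" for x
      using D(2)[rule_format, of 1 x] assms(2) that by (simp add: numeral_2_eq_2)
    show "continuous_on {0..1} (D 2)"
    proof (cases "k = 2")
      case True
      then show ?thesis using D(3) by simp
    next
      case False
      then have "2 < k" using assms(2) by simp
      from DERIV_continuous_on[OF D(2)[rule_format, OF this]] show ?thesis .
    qed
  qed
qed

lemma medium_powr:
  assumes a: "Ck_on k a" "k \<ge> 2" and pos: "\<And>x. x \<in> {0..1} \<Longrightarrow> a x > 0" and l: "0 < l" "l < 1"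
  shows "\<exists>p'. medium (\<lambda>x. x powr \<alpha> * a x) p' l"
proof -
  obtain a' a'' where a': "\<And>x. x \<in> {0..1} \<Longrightarrow> (a has_real_derivative a' x) (at x within {0..1})"
    and a'': "\<And>x. x \<in> {0..1} \<Longrightarrow> (a' has_real_derivative a'' x) (at x within {0..1})"
    using Ck_on_derivatives[OF a] by metis
  have sub: "{l..1} \<subseteq> {0..1}" using l by auto
  have ca: "continuous_on {l..1} a" "continuous_on {l..1} a'"
    using DERIV_continuous_on[OF a'] DERIV_continuous_on[OF a''] sub by (auto intro: continuous_on_subset)
  define p' where "p' = (\<lambda>x. \<alpha> * x powr (\<alpha> - 1) * a x + a' x * x powr \<alpha>)"
  have "medium (\<lambda>x. x powr \<alpha> * a x) p' l"
  proof
    fix x assume x: "x \<in> {l..1}"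
    then have x0: "x > 0" "x \<in> {0..1}" using l by auto
    show "x powr \<alpha> * a x > 0" using pos[OF x0(2)] x0 by simp
    show "((\<lambda>x. x powr \<alpha> * a x) has_real_derivative p' x) (at x within {l..1})"
      unfolding p'_def
      by (rule DERIV_mult[OF has_field_derivative_at_within[OF has_real_derivative_powr[OF x0(1)]] DERIV_subset[OF a'[OF x0(2)] sub]])
  next
    show "continuous_on {l..1} p'"
      unfolding p'_def by (intro continuous_intros ca) (use l in auto)
  qed (use l in auto)
  then show ?thesis by blast
qed

text \<open>Continuity method: by continuity the infimum of the admissible left ends is itself
  admissible, and \<open>step\<close> would go below it if it were greater than l.\<close>

lemma agreement_backwards:
  fixes f :: "real \<Rightarrow> real"
  assumes l: "l \<le> 1" and f: "continuous_on {l..1} f" and one: "f 1 = 0"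
    and step: "\<And>x. l < x \<Longrightarrow> x \<le> 1 \<Longrightarrow> \<forall>y\<in>{x..1}. f y = 0 \<Longrightarrow> \<exists>x'. l \<le> x' \<and> x' < x \<and> (\<forall>y\<in>{x'..1}. f y = 0)"
  shows "\<forall>y\<in>{l..1}. f y = 0"
proof -
  define S where "S = {x \<in> {l..1}. \<forall>y\<in>{x..1}. f y = 0}"
  have S1: "1 \<in> S" using l one by (auto simp: S_def)
  have bdd: "bdd_below S" by (auto simp: S_def intro!: bdd_belowI[of _ l])
  define x0 where "x0 = Inf S"
  have x0: "l \<le> x0" "x0 \<le> 1"
    unfolding x0_def using S1 bdd by (auto intro!: cInf_greatest cInf_lower simp: S_def)
  have above: "f y = 0" if y: "x0 < y" "y \<le> 1" for y
  proof -
    obtain x where "x \<in> S" "x < y" using cInf_lessD[of S y] S1 y by (auto simp: x0_def)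
    then show ?thesis using y by (auto simp: S_def)
  qed
  have "f x0 = 0"
  proof (rule ccontr)
    assume nz: "f x0 \<noteq> 0"
    then have lt: "x0 < 1" using one x0 by (cases "x0 = 1") auto
    have x0l: "x0 \<in> {l..1}" using x0 by simp
    obtain d where d: "d > 0" "\<And>x. x \<in> {l..1} \<Longrightarrow> dist x x0 < d \<Longrightarrow> dist (f x) (f x0) < \<bar>f x0\<bar>"
      using f[unfolded continuous_on_iff, rule_format, OF x0l, of "\<bar>f x0\<bar>"] nz by auto
    define y where "y = x0 + min (d / 2) (1 - x0)"
    have y: "x0 < y" "y \<le> 1" "y - x0 < d" using d(1) lt by (auto simp: y_def min_def)
    have "dist (f y) (f x0) < \<bar>f x0\<bar>" using y x0 by (intro d) (auto simp: dist_real_def)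
    then show False using above[OF y(1,2)] by (simp add: dist_real_def)
  qed
  then have zero: "\<forall>y\<in>{x0..1}. f y = 0" using above by (auto simp: le_less)
  show ?thesis
  proof (cases "x0 = l")
    case True
    then show ?thesis using zero by simp
  next
    case False
    then obtain x' where "l \<le> x'" "x' < x0" "\<forall>y\<in>{x'..1}. f y = 0"
      using step[OF _ x0(2) zero] x0(1) by auto
    then have "x' \<in> S" using x0 by (auto simp: S_def)
    then have "x0 \<le> x'" unfolding x0_def using bdd by (rule cInf_lower)
    then show ?thesis using \<open>x' < x0\<close> by simp
  qed
qed

theorem theorem4p2:
  fixes \<epsilon>0 \<epsilon>1 \<delta>0 \<delta>1 \<alpha> \<beta> :: real
    and a0 a b u0 :: "real \<Rightarrow> real"
    and ua ub :: "real \<Rightarrow> real \<Rightarrow> real"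
  assumes "\<epsilon>0 > 0" "\<epsilon>1 > 0" "\<delta>0 > 0" "\<delta>1 > 0"
    and "Ck_on 2 a0" "\<forall>x\<in>{0..1}. a0 x > 0"
    and "(a, \<alpha>, u0) \<in> classA a0 \<epsilon>0 \<epsilon>1 \<delta>0 \<delta>1"
    and "(b, \<beta>, u0) \<in> classA a0 \<epsilon>0 \<epsilon>1 \<delta>0 \<delta>1"
    and "is_sol a \<alpha> u0 ua" "is_sol b \<beta> u0 ub"
    and "\<exists>t0>0. \<forall>t\<in>{0<..<t0}. \<exists>d.
           ((\<lambda>x. ua x t) has_real_derivative d) (at 1 within {0..1}) \<and>
           ((\<lambda>x. ub x t) has_real_derivative d) (at 1 within {0..1})"
  shows "\<forall>x\<in>{\<epsilon>1..1}. x powr \<alpha> * a x = x powr \<beta> * b x"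
proof (cases "\<epsilon>1 < 1")
  \<comment> \<open>At most the point 1 is left, where the powers equal 1 and both coefficients
    equal \<open>a0 1\<close>.\<close>
  case False
  have "a 1 = b 1"
    using assms(1,7,8) by (auto simp: classA_def)
  moreover have "x = 1" if "x \<in> {\<epsilon>1..1}" for x using that False by simp
  ultimately show ?thesis by force
next
  \<comment> \<open>\<open>\<epsilon>1\<close> serves as the left end l of both media, so the test
    functions stay away from the degenerate point 0.\<close>
  case l1: True
  define pa where "pa = (\<lambda>x. x powr \<alpha> * a x)"
  define pb where "pb = (\<lambda>x. x powr \<beta> * b x)"
  have a: "Ck_on 3 a" "\<And>x. x \<in> {0..1} \<Longrightarrow> a x > 0" "a 1 = a0 1"
    and b: "Ck_on 3 b" "\<And>x. x \<in> {0..1} \<Longrightarrow> b x > 0" "b 1 = a0 1"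
    and u: "Ck_on 4 u0" "u0 1 = 0" "\<And>x. x \<in> {\<epsilon>1..1} \<Longrightarrow> \<bar>dx u0 x\<bar> \<ge> \<delta>1"
    using assms(1,3,7,8) by (force simp: classA_def classA0_def Let_def)+
  obtain pa' where ma: "medium pa pa' \<epsilon>1"
    using medium_powr[OF a(1) _ a(2) assms(2) l1] unfolding pa_def by auto
  obtain pb' where mb: "medium pb pb' \<epsilon>1"
    using medium_powr[OF b(1) _ b(2) assms(2) l1] unfolding pb_def by auto
  obtain v w where v: "\<And>x. x \<in> {0..1} \<Longrightarrow> (u0 has_real_derivative v x) (at x within {0..1})"
    and w: "\<And>x. x \<in> {0..1} \<Longrightarrow> (v has_real_derivative w x) (at x within {0..1})"
    and cw: "continuous_on {0..1} w"
    using Ck_on_derivatives[OF u(1)] by auto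
  have sub: "{\<epsilon>1..1} \<subseteq> {0..1}" using assms(2) by auto
  have dxv: "dx u0 x = v x" if "x \<in> {0..1}" for x
    unfolding dx_def using that v[OF that]
    by (intro vector_derivative_within_closed_interval) (auto simp: has_real_derivative_iff_has_vector_derivative)
  obtain t0 where t0: "t0 > 0" "\<forall>t\<in>{0<..<t0}. \<exists>d. ((\<lambda>x. ua x t) has_real_derivative d) (at 1 within {0..1}) \<and>
           ((\<lambda>x. ub x t) has_real_derivative d) (at 1 within {0..1})"
    using assms(11) by blast
  have cv: "continuous_on {\<epsilon>1..1} v" "continuous_on {\<epsilon>1..1} w"
    using continuous_on_subset[OF DERIV_continuous_on[OF w] sub] continuous_on_subset[OF cw sub] by auto
  have "\<forall>x\<in>{\<epsilon>1..1}. pa x - pb x = 0"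
  proof (rule agreement_backwards)
    show "continuous_on {\<epsilon>1..1} (\<lambda>x. pa x - pb x)"
      using medium.cont_p[OF ma] medium.cont_p[OF mb] by (rule continuous_on_diff)
    show "pa 1 - pb 1 = 0" using a(3) b(3) by (simp add: pa_def pb_def)
    fix x assume x: "\<epsilon>1 < x" "x \<le> 1" "\<forall>y\<in>{x..1}. pa y - pb y = 0"
    have "\<exists>x1. \<epsilon>1 \<le> x1 \<and> x1 < x \<and> (\<forall>y\<in>{x1..1}. pa y = pb y)"
    proof (rule uniqueness_step[OF assms(9,10) DERIV_continuous_on[OF v] u(2) pa_def pb_def ma mb _ cv(1) assms(4) _ _ _ t0 x(1,2)])
      show "(u0 has_real_derivative v y) (at y within {\<epsilon>1..1})" if "y \<in> {\<epsilon>1..1}" for y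
        using DERIV_subset[OF v sub] that sub by blast
      show "\<delta>1 \<le> \<bar>v y\<bar>" if "y \<in> {\<epsilon>1..1}" for y
        using u(3)[OF that] dxv[of y] that sub by auto
      show "((\<lambda>x. pb x * v x) has_real_derivative pb' y * v y + w y * pb y) (at y within {\<epsilon>1..1})" if "y \<in> {\<epsilon>1..1}" for y
        using that sub by (intro DERIV_mult medium.dp[OF mb] DERIV_subset[OF w sub]) auto
      show "continuous_on {\<epsilon>1..1} (\<lambda>y. pb' y * v y + w y * pb y)"
        by (intro continuous_intros medium.cont_p'[OF mb] medium.cont_p[OF mb] cv)
      show "pa y = pb y" if "y \<in> {x..1}" for y using x(3) that by auto
    qed
    then show "\<exists>x'. \<epsilon>1 \<le> x' \<and> x' < x \<and> (\<forall>y\<in>{x'..1}. pa y - pb y = 0)" by auto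
  qed (use l1 in simp)
  then show ?thesis by (simp add: pa_def pb_def)
qed

end
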